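(* Let $\lambda:\mathbb{Z}\to\mathbb{C}$ and $w:\mathbb{Z}\to\mathbb{C}\setminus\{0\}$ be such that $$\sum_{n=-\infty}^{\infty}\left|\frac{w_n^2}{(\lambda_n-z_0)(\lambda_{n+1}-z_0)}\right|<\infty$$ for at least one $z_0\in\mathbb{C}_0^\lambda$, and assume that $F_{\mathcal J}$ does not vanish identically on $\mathbb{C}_0^\lambda$. Let $J:=J_{\min}=J_{\max}$. Then: (i) For all $z\in\operatorname{spec}_p(J)$, $\nu_g(z)=1$. (ii) Suppose additionally that the set $\mathbb{C}\setminus\operatorname{der}(\lambda)$ is connected. Then the set $\operatorname{spec}(J)\cap\mathbb{C}_0^\lambda$ consists of isolated eigenvalues and, if $z\in\mathbb{C}_0^\lambda\cap\operatorname{spec}(J)$, then $\nu_a(z)$ coincides with the order of $z$ as a zero of $F_{\mathcal J}$. Moreover, the space of generalized eigenvectors (of $J$ at $z$) is spanned by the vectors $f(z),f'(z),\dots,f^{(\nu_a(z)-1)}(z)$.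
   Context: Formal matrix: for $\lambda:\mathbb{Z}\to\mathbb{C}$, $w:\mathbb{Z}\to\mathbb{C}\setminus\{0\}$, the doubly infinite symmetric tridiagonal (Jacobi) matrix $\mathcal J$ acts on all complex sequences $x=(x_n)_{n\in\mathbb{Z}}$ by $(\mathcal Jx)_n=w_{n-1}x_{n-1}+\lambda_nx_n+w_nx_{n+1}$, $n\in\mathbb{Z}$. Operators: $\{e_n\mid n\in\mathbb{Z}\}$ is the standard basis of $\ell^2(\mathbb{Z})$. $J_{\min}$ is the closure in $\ell^2(\mathbb{Z})$ of the (closable) restriction of $\mathcal J$ to $\operatorname{span}\{e_n\mid n\in\mathbb{Z}\}$. $J_{\max}$ has domain $\{x\in\ell^2(\mathbb{Z})\mid\mathcal Jx\in\ell^2(\mathbb{Z})\}$ and acts by $J_{\max}x=\mathcal Jx$. Under the hypotheses of the theorem, $J_{\min}=J_{\max}$. $\operatorname{spec}_p$ denotes the point spectrum (set of eigenvalues). Sets: $\operatorname{Ran}(\lambda)=\{\lambda_n\mid n\in\mathbb{Z}\}$; $\mathbb{C}_0^\lambda=\mathbb{C}\setminus\overline{\operatorname{Ran}(\lambda)}$; $\operatorname{der}(\lambda)$ is the set of all finite limit points of $\lambda$, i.e. of all limits of convergent subsequences $(\lambda_{n_k})_k$ with pairwise distinct indices $n_k$. Function $\mathfrak F$: for a complex sequence with $\sum_{k\in\mathbb{Z}}|x_kx_{k+1}|<\infty$, $$\mathfrak F(\{x_k\}_{k=-\infty}^{\infty}):=1+\sum_{m=1}^\infty(-1)^m\sum_{k_1=-\infty}^{\infty}\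 \sum_{k_2=k_1+2}^{\infty}\cdots\sum_{k_m=k_{m-1}+2}^{\infty}\ \prod_{j=1}^m x_{k_j}x_{k_j+1}.$$ For a one-sided sequence, $\mathfrak F(\{x_k\}_{k=n}^{\infty})$ is defined by setting the missing $x_k:=0$. Characteristic function: $\gamma:\mathbb{Z}\to\mathbb{C}$ is any sequence with $\gamma_n\gamma_{n+1}=w_n$ for all $n$. If the summability condition holds for one $z_0\in\mathbb{C}_0^\lambda$ it holds for all, and $F_{\mathcal J}(z):=\mathfrak F\left(\left\{\frac{\gamma_n^2}{z-\lambda_n}\right\}_{n=-\infty}^\infty\right)$ for $z\in\mathbb{C}_0^\lambda$; this is analytic on $\mathbb{C}_0^\lambda$ and independent of the choice of $\gamma$. The sequence $f(z)$: for $z\in\mathbb{C}_0^\lambda$ and $n\in\mathbb{Z}$, $$f_n(z):=\mathcal P_n(z)\,\mathfrak F\left(\left\{\frac{\gamma_k^2}{\lambda_k-z}\right\}_{k=n+1}^{\infty}\right),$$ where $\mathcal P_n(z):=\prod_{k=1}^n\frac{w_{k-1}}{z-\lambda_k}$ if $n\ge0$ and $\mathcal P_n(z):=\prod_{k=n+1}^0\frac{z-\lambda_k}{w_{k-1}}$ if $n<0$. Derivatives $f'(z),f^{(j)}(z)$ are taken entrywise with respect to $z$. Multiplicities: for $z\in\operatorname{spec}_p(J)$, the geometric multiplicity is $\nu_g(z):=\dim\operatorname{Ker}(J-z)$. If $z$ is an isolated point of $\operatorname{spec}(J)$, the algebraic multiplicity is $\nu_a(z):=\dim\operatorname{Ran}P_z$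 with $P_z:=-\frac{1}{2\pi i}\oint_{\gamma_z}(J-\xi)^{-1}d\xi$ the Riesz projection, $\gamma_z$ a positively oriented Jordan curve in $\rho(J)$ having $z$ as the only spectral point of $J$ in its interior. The space of generalized eigenvectors is $\{v\in\ell^2(\mathbb{Z})\mid(J-z)^nv=0\text{ for some }n\in\mathbb{N}\}$.
   Formalization: The equality J_min = J_max is assumed as a hypothesis, because the summability condition and the non-vanishing of F_J do not imply it (for rapidly growing λ all solutions of Jx = 0 can be square-summable). *)

theory Defs
  imports "HOL-Complex_Analysis.Complex_Analysis"
begin

section \<open>The space of square-summable sequences indexed by the integers\<close>

typedef ell2 = "{x :: int \<Rightarrow> complex. (\<lambda>n. (norm (x n))\<^sup>2) summable_on UNIV}"
  morphisms seq_of Abs_ell2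
  by (rule exI[of _ "\<lambda>_. 0"]) simp

setup_lifting type_definition_ell2

lemma summable_sq_iff:
  fixes x :: "int \<Rightarrow> complex"
  shows "(\<lambda>n. (norm (x n))\<^sup>2) summable_on UNIV \<longleftrightarrow> (\<exists>B. \<forall>F. finite F \<longrightarrow> L2_set (\<lambda>n. norm (x n)) F \<le> B)"
proof
  assume s: "(\<lambda>n. (norm (x n))\<^sup>2) summable_on UNIV"
  show "\<exists>B. \<forall>F. finite F \<longrightarrow> L2_set (\<lambda>n. norm (x n)) F \<le> B"
    unfolding L2_set_def
    by (intro exI[of _ "sqrt (\<Sum>\<^sub>\<infinity>n. (norm (x n))\<^sup>2)"] allI impI real_sqrt_le_mono
        finite_sum_le_infsum[OF s]) auto
next
  assume "\<exists>B. \<forall>F. finite F \<longrightarrow> L2_set (\<lambda>n. norm (x n)) F \<le> B"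
  then obtain B where B: "\<And>F. finite F \<Longrightarrow> L2_set (\<lambda>n. norm (x n)) F \<le> B" by blast
  have "(\<Sum>n\<in>F. (norm (x n))\<^sup>2) \<le> B\<^sup>2" if "finite F" for F
    using power_mono[OF B[OF that] L2_set_nonneg, of 2] by (simp add: L2_set_def sum_nonneg)
  then show "(\<lambda>n. (norm (x n))\<^sup>2) summable_on UNIV"
    by (intro nonneg_bdd_above_summable_on) (auto simp: bdd_above_def)
qed

lemma L2_set_add_le:
  fixes x y :: "int \<Rightarrow> complex"
  shows "L2_set (\<lambda>n. norm (x n + y n)) F \<le> L2_set (\<lambda>n. norm (x n)) F + L2_set (\<lambda>n. norm (y n)) F"
  by (rule order_trans[OF L2_set_mono L2_set_triangle_ineq]) (auto intro: norm_triangle_ineq)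

lemma summable_sq_add:
  fixes x y :: "int \<Rightarrow> complex"
  assumes "(\<lambda>n. (norm (x n))\<^sup>2) summable_on UNIV" "(\<lambda>n. (norm (y n))\<^sup>2) summable_on UNIV"
  shows "(\<lambda>n. (norm (x n + y n))\<^sup>2) summable_on UNIV"
proof -
  obtain B C where B: "\<And>F. finite F \<Longrightarrow> L2_set (\<lambda>n. norm (x n)) F \<le> B"
      and C: "\<And>F. finite F \<Longrightarrow> L2_set (\<lambda>n. norm (y n)) F \<le> C"
    using assms unfolding summable_sq_iff by blast
  have "\<And>F. finite F \<Longrightarrow> L2_set (\<lambda>n. norm (x n + y n)) F \<le> B + C"
    by (rule order_trans[OF L2_set_add_le add_mono[OF B C]])
  then show ?thesis
    unfolding summable_sq_iff by blast
qed

lemma summable_sq_cmult: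
  fixes x :: "int \<Rightarrow> complex"
  assumes "(\<lambda>n. (norm (x n))\<^sup>2) summable_on UNIV"
  shows "(\<lambda>n. (norm (c * x n))\<^sup>2) summable_on UNIV"
  unfolding norm_mult power_mult_distrib by (rule summable_on_cmult_right[OF assms])

lift_definition cscale :: "complex \<Rightarrow> ell2 \<Rightarrow> ell2" (infixr \<open>*\<^sub>C\<close> 75)
  is "\<lambda>c x n. c * x n"
  by (rule summable_sq_cmult)

instantiation ell2 :: real_normed_vector
begin

lift_definition zero_ell2 :: ell2 is "\<lambda>_. 0" by simp

lift_definition plus_ell2 :: "ell2 \<Rightarrow> ell2 \<Rightarrow> ell2" is "\<lambda>x y n. x n + y n"
  by (rule summable_sq_add)

lift_definition uminus_ell2 :: "ell2 \<Rightarrow> ell2" is "\<lambda>x n. - x n"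
  by simp

lift_definition minus_ell2 :: "ell2 \<Rightarrow> ell2 \<Rightarrow> ell2" is "\<lambda>x y n. x n - y n"
  using summable_sq_add[of _ "\<lambda>n. - _ n"] by simp

definition scaleR_ell2 :: "real \<Rightarrow> ell2 \<Rightarrow> ell2"
  where "scaleR_ell2 r x = complex_of_real r *\<^sub>C x"

definition norm_ell2 :: "ell2 \<Rightarrow> real"
  where "norm_ell2 x = sqrt (\<Sum>\<^sub>\<infinity>n. (norm (seq_of x n))\<^sup>2)"

definition sgn_ell2 :: "ell2 \<Rightarrow> ell2"
  where "sgn_ell2 x = inverse (norm x) *\<^sub>R x"

definition dist_ell2 :: "ell2 \<Rightarrow> ell2 \<Rightarrow> real"
  where "dist_ell2 x y = norm (x - y)"

definition uniformity_ell2 :: "(ell2 \<times> ell2) filter"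
  where "uniformity_ell2 = (INF e\<in>{0<..}. principal {(x, y). dist x y < e})"

definition open_ell2 :: "ell2 set \<Rightarrow> bool"
  where "open_ell2 U \<longleftrightarrow> (\<forall>x\<in>U. eventually (\<lambda>(x', y). x' = x \<longrightarrow> y \<in> U) uniformity)"

instance
proof
  fix x y z :: ell2 and a b :: real
  have summ: "(\<lambda>n. (norm (seq_of u n))\<^sup>2) summable_on UNIV" for u
    using seq_of[of u] by simp
  show "x + y + z = x + (y + z)" by transfer (simp add: add.assoc)
  show "x + y = y + x" by transfer (simp add: add.commute)
  show "0 + x = x" by transfer simp
  show "- x + x = 0" by transfer simp
  show "x - y = x + - y" by transfer simp
  show "a *\<^sub>R (x + y) = a *\<^sub>R x + a *\<^sub>R y"
    unfolding scaleR_ell2_def by transfer (simp add: algebra_simps)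
  show "(a + b) *\<^sub>R x = a *\<^sub>R x + b *\<^sub>R x"
    unfolding scaleR_ell2_def by transfer (simp add: algebra_simps)
  show "a *\<^sub>R b *\<^sub>R x = (a * b) *\<^sub>R x"
    unfolding scaleR_ell2_def by transfer (simp add: algebra_simps)
  show "1 *\<^sub>R x = x"
    unfolding scaleR_ell2_def by transfer simp
  show "dist x y = norm (x - y)" by (rule dist_ell2_def)
  show "sgn x = inverse (norm x) *\<^sub>R x" by (rule sgn_ell2_def)
  show "uniformity = (INF e\<in>{0<..}. principal {(x, y). dist (x::ell2) y < e})"
    by (rule uniformity_ell2_def)
  show "open U \<longleftrightarrow> (\<forall>x\<in>U. eventually (\<lambda>(x', y). x' = x \<longrightarrow> y \<in> U) uniformity)" for U :: "ell2 set"
    by (rule open_ell2_def)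
  show "norm x = 0 \<longleftrightarrow> x = 0"
  proof
    assume "norm x = 0"
    then have "(\<Sum>\<^sub>\<infinity>n. (norm (seq_of x n))\<^sup>2) \<le> 0"
      by (simp add: norm_ell2_def)
    then have "seq_of x n = 0" for n
      using nonneg_infsum_le_0D[OF _ summ[of x], of n] by simp
    then show "x = 0"
      by (simp add: seq_of_inject[symmetric] zero_ell2.rep_eq fun_eq_iff)
  next
    assume "x = 0"
    then show "norm x = 0" by (simp add: norm_ell2_def zero_ell2.rep_eq)
  qed
  have L2_le: "L2_set (\<lambda>n. norm (seq_of u n)) F \<le> norm u" if "finite F" for u F
    unfolding norm_ell2_def L2_set_def
    by (intro real_sqrt_le_mono finite_sum_le_infsum[OF summ that]) auto
  show "norm (x + y) \<le> norm x + norm y"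
  proof -
    have nn: "0 \<le> norm x + norm y"
      unfolding norm_ell2_def by (intro add_nonneg_nonneg real_sqrt_ge_zero infsum_nonneg) auto
    have "(\<Sum>n\<in>F. (norm (seq_of (x + y) n))\<^sup>2) \<le> (norm x + norm y)\<^sup>2" if "finite F" for F
    proof -
      have "L2_set (\<lambda>n. norm (seq_of (x + y) n)) F \<le> norm x + norm y"
        unfolding plus_ell2.rep_eq
        by (rule order_trans[OF L2_set_add_le add_mono[OF L2_le L2_le]]) (use that in auto)
      from power_mono[OF this L2_set_nonneg, of 2] show ?thesis
        by (simp add: L2_set_def sum_nonneg)
    qed
    then have "(\<Sum>\<^sub>\<infinity>n. (norm (seq_of (x + y) n))\<^sup>2) \<le> (norm x + norm y)\<^sup>2"
      by (intro infsum_le_finite_sums[OF summ]) auto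
    then show ?thesis
      unfolding norm_ell2_def[of "x + y"] by (rule real_le_lsqrt[OF nn])
  qed
  show "norm (a *\<^sub>R x) = \<bar>a\<bar> * norm x"
    by (simp add: norm_ell2_def scaleR_ell2_def cscale.rep_eq norm_mult power_mult_distrib
        infsum_cmult_right' real_sqrt_mult)
qed

end

global_interpretation cell2: vector_space cscale
  by unfold_locales (transfer; simp add: algebra_simps)+

definition unit_vec :: "int \<Rightarrow> ell2" where
  "unit_vec n = Abs_ell2 (\<lambda>k. if k = n then 1 else 0)"


section \<open>Unbounded operators\<close>

text \<open>A possibly unbounded operator is represented by its graph, so that closures, compositions
  and powers of operators (with their natural domains) are those of relations.\<close>

type_synonym operator = "(ell2 \<times> ell2) set"

definition shift :: "operator \<Rightarrow> complex \<Rightarrow> operator" where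
  "shift J z = {(x, y - z *\<^sub>C x) | x y. (x, y) \<in> J}"

definition kernel :: "operator \<Rightarrow> ell2 set" where
  "kernel A = {v. (v, 0) \<in> A}"

definition is_resolvent :: "operator \<Rightarrow> complex \<Rightarrow> (ell2 \<Rightarrow>\<^sub>L ell2) \<Rightarrow> bool" where
  "is_resolvent J z R \<longleftrightarrow> (shift J z)\<inverse> = {(y, blinfun_apply R y) | y. True}"

definition resolvent_set :: "operator \<Rightarrow> complex set" where
  "resolvent_set J = {z. \<exists>R. is_resolvent J z R}"

definition resolvent :: "operator \<Rightarrow> complex \<Rightarrow> ell2 \<Rightarrow>\<^sub>L ell2" where
  "resolvent J z = (THE R. is_resolvent J z R)"

definition spec :: "operator \<Rightarrow> complex set" where
  "spec J = - resolvent_set J"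

definition point_spec :: "operator \<Rightarrow> complex set" where
  "point_spec J = {z. \<exists>v. v \<noteq> 0 \<and> (v, z *\<^sub>C v) \<in> J}"

definition geometric_mult :: "operator \<Rightarrow> complex \<Rightarrow> nat" where
  "geometric_mult J z = cell2.dim (kernel (shift J z))"

definition generalized_eigenspace :: "operator \<Rightarrow> complex \<Rightarrow> ell2 set" where
  "generalized_eigenspace J z = (\<Union>n. kernel (shift J z ^^ n))"

text \<open>Jordan curves are taken piecewise continuously differentiable, so that the contour integral
  of the operator-valued resolvent makes sense.\<close>

definition riesz_contour :: "operator \<Rightarrow> complex \<Rightarrow> (real \<Rightarrow> complex) \<Rightarrow> bool" where
  "riesz_contour J z g \<longleftrightarrow>
     valid_path g \<and> simple_path g \<and> pathfinish g = pathstart g \<and>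
     path_image g \<subseteq> resolvent_set J \<and>
     inside (path_image g) \<inter> spec J = {z} \<and>
     winding_number g z = 1"

definition blinfun_cscale :: "complex \<Rightarrow> (ell2 \<Rightarrow>\<^sub>L ell2) \<Rightarrow> (ell2 \<Rightarrow>\<^sub>L ell2)" where
  "blinfun_cscale c A = Blinfun (\<lambda>x. c *\<^sub>C blinfun_apply A x)"

definition riesz_projection :: "operator \<Rightarrow> (real \<Rightarrow> complex) \<Rightarrow> ell2 \<Rightarrow>\<^sub>L ell2" where
  "riesz_projection J g =
     blinfun_cscale (- 1 / (2 * of_real pi * \<i>))
       (integral {0..1} (\<lambda>t. blinfun_cscale (vector_derivative g (at t)) (resolvent J (g t))))"

text \<open>Only meaningful at isolated points of the spectrum, where an admissible contour exists and
  the projection does not depend on it.\<close>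

definition algebraic_mult :: "operator \<Rightarrow> complex \<Rightarrow> nat" where
  "algebraic_mult J z =
     cell2.dim (range (blinfun_apply (riesz_projection J (SOME g. riesz_contour J z g))))"


section \<open>Jacobi operators\<close>

definition jacobi :: "(int \<Rightarrow> complex) \<Rightarrow> (int \<Rightarrow> complex) \<Rightarrow> (int \<Rightarrow> complex) \<Rightarrow> int \<Rightarrow> complex" where
  "jacobi lam w x n = w (n - 1) * x (n - 1) + lam n * x n + w n * x (n + 1)"

definition J_max :: "(int \<Rightarrow> complex) \<Rightarrow> (int \<Rightarrow> complex) \<Rightarrow> operator" where
  "J_max lam w = {(x, y). seq_of y = jacobi lam w (seq_of x)}"

definition J_min :: "(int \<Rightarrow> complex) \<Rightarrow> (int \<Rightarrow> complex) \<Rightarrow> operator" where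
  "J_min lam w = closure {(x, y). x \<in> cell2.span (range unit_vec) \<and> seq_of y = jacobi lam w (seq_of x)}"

text \<open>Summability of \<open>w n\<^sup>2 / ((lam n - z) * (lam (n + 1) - z))\<close> together with a nonvanishing
  characteristic function does not imply \<^term>\<open>J_min lam w = J_max lam w\<close>: if
  \<open>w n = 2 powr (- \<bar>n\<bar> - 3) * sqrt (lam n * lam (n + 1))\<close> with \<open>lam n > 0\<close> growing sufficiently
  fast in both directions, then every solution of \<open>jacobi lam w x = 0\<close> is square-summable.\<close>

definition C0 :: "(int \<Rightarrow> complex) \<Rightarrow> complex set" where
  "C0 lam = - closure (range lam)"

definition der :: "(int \<Rightarrow> complex) \<Rightarrow> complex set" where
  "der lam = {l. \<exists>n :: nat \<Rightarrow> int. inj n \<and> (\<lambda>k. lam (n k)) \<longlonglongrightarrow> l}"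


section \<open>The characteristic function\<close>

text \<open>\<open>nested_sum x m A\<close> is the \<open>m\<close>-fold iterated sum of the products of
  \<open>x k\<^sub>j * x (k\<^sub>j + 1)\<close> over \<open>k\<^sub>1 \<in> A\<close> and \<open>k\<^sub>j\<^sub>+\<^sub>1 \<ge> k\<^sub>j + 2\<close>,
  with the factors not involving an inner summation index pulled out of the inner sums.\<close>

fun nested_sum :: "(int \<Rightarrow> complex) \<Rightarrow> nat \<Rightarrow> int set \<Rightarrow> complex" where
  "nested_sum x 0 A = 1"
| "nested_sum x (Suc m) A = (\<Sum>\<^sub>\<infinity>k\<in>A. x k * x (k + 1) * nested_sum x m {k + 2..})"

definition frakF :: "(int \<Rightarrow> complex) \<Rightarrow> complex" where
  "frakF x = 1 + (\<Sum>m. (- 1) ^ Suc m * nested_sum x (Suc m) UNIV)"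

definition frakF_from :: "int \<Rightarrow> (int \<Rightarrow> complex) \<Rightarrow> complex" where
  "frakF_from n x = frakF (\<lambda>k. if n \<le> k then x k else 0)"

definition char_fun :: "(int \<Rightarrow> complex) \<Rightarrow> (int \<Rightarrow> complex) \<Rightarrow> complex \<Rightarrow> complex" where
  "char_fun lam \<gamma> z = frakF (\<lambda>n. (\<gamma> n)\<^sup>2 / (z - lam n))"

definition calP :: "(int \<Rightarrow> complex) \<Rightarrow> (int \<Rightarrow> complex) \<Rightarrow> int \<Rightarrow> complex \<Rightarrow> complex" where
  "calP lam w n z =
     (if 0 \<le> n then \<Prod>k = 1..n. w (k - 1) / (z - lam k)
      else \<Prod>k = n + 1..0. (z - lam k) / w (k - 1))"

definition f_sol ::
    "(int \<Rightarrow> complex) \<Rightarrow> (int \<Rightarrow> complex) \<Rightarrow> (int \<Rightarrow> complex) \<Rightarrow> int \<Rightarrow> complex \<Rightarrow> complex" where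
  "f_sol lam w \<gamma> n z = calP lam w n z * frakF_from (n + 1) (\<lambda>k. (\<gamma> k)\<^sup>2 / (lam k - z))"

definition f_deriv ::
    "(int \<Rightarrow> complex) \<Rightarrow> (int \<Rightarrow> complex) \<Rightarrow> (int \<Rightarrow> complex) \<Rightarrow> nat \<Rightarrow> complex \<Rightarrow> int \<Rightarrow> complex" where
  "f_deriv lam w \<gamma> j z = (\<lambda>n. (deriv ^^ j) (f_sol lam w \<gamma> n) z)"

end

theory Submission
  imports Defs
begin

text \<open>
  For \<open>z\<close> off the closure of the diagonal the formal eigenvalue equation has a solution \<open>f\<close>
  decaying geometrically at plus infinity and, by reflection, a solution \<open>g\<close> decaying at minus
  infinity; their Wronskian is \<open>(z - lam 0) * F z\<close> with \<open>F\<close> the characteristic function.  If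
  \<open>F z \<noteq> 0\<close>, the Green kernel built from \<open>f\<close> and \<open>g\<close> decays geometrically off the diagonal and
  gives the resolvent, with \<open>F z\<close> times its norm locally bounded.  Hence the spectrum off the
  closure of the diagonal is the zero set of \<open>F\<close>, and at a zero of order \<open>\<nu>\<close> the resolvent has a
  pole of order at most \<open>\<nu>\<close>, so that the range of the Riesz projection lies in the kernel of
  \<open>(J - z) ^ \<nu>\<close>; conversely the projection fixes every generalised eigenvector.  Differentiating
  \<open>(J - z) f = 0\<close> gives \<open>(J - z) f\<^sup>(\<^sup>j\<^sup>) = j f\<^sup>(\<^sup>j\<^sup>-\<^sup>1\<^sup>)\<close>, and the derivatives of order
  below \<open>\<nu>\<close> are square-summable because \<open>f\<close> and \<open>g\<close> are proportional up to order \<open>\<nu>\<close>.  As the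
  kernel of \<open>J - z\<close> is one-dimensional, these \<open>\<nu>\<close> vectors form a basis of the kernel of
  \<open>(J - z) ^ \<nu>\<close>.
\<close>

section \<open>The Hilbert space\<close>

text \<open>The equality \<open>J_min lam w = J_max lam w\<close> enters through one fact: the
  matrix is complex symmetric, so the operator is symmetric for the bilinear \<open>pairing\<close>,
  on finite vectors by inspection and on the whole domain by closure. Against a truncated solution
  this makes the Wronskian of an eigenvector with any solution square-summable at one end vanish;
  hence the simple kernel, and injectivity of \<open>J - z\<close> where \<open>F z\<close> is
  nonzero. Single quotients \<open>w n / (z - lam n)\<close> need not be bounded, so decay is read
  off squares, in which only the summable products of neighbouring quotients occur; the rate 1/2 is
  the root of a freely chosen 1/4. All bounds are uniform on discs, since both the pole order and
  the derivatives in \<open>z\<close> are controlled by them, and the Green kernel is left undivided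
  by the Wronskian so that its bound survives at zeros of \<open>F\<close>. Contour integrals of
  operators are examined entry by entry, which reduces them to scalar Cauchy theory. The resolvent
  bounds the length of Jordan chains only from above; that the bound is attained comes from the
  explicit vectors.\<close>

lemma seq_of_summable: "(\<lambda>n. (norm (seq_of x n))\<^sup>2) summable_on UNIV"
  using seq_of[of x] by simp

lemma range_seq_of: "x \<in> range seq_of \<longleftrightarrow> (\<lambda>n. (norm (x n))\<^sup>2) summable_on UNIV"
  using type_definition.Rep_range[OF type_definition_ell2] by simp

lemma ell2_eqI: "(\<And>n. seq_of x n = seq_of y n) \<Longrightarrow> x = y"
  by (simp add: seq_of_inject[symmetric] fun_eq_iff)

lemma norm_ell2_sq: "(norm x)\<^sup>2 = (\<Sum>\<^sub>\<infinity>n. (norm (seq_of x n))\<^sup>2)"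
  unfolding norm_ell2_def by (intro real_sqrt_pow2 infsum_nonneg) simp

lemma L2_set_le_norm: "finite F \<Longrightarrow> L2_set (\<lambda>n. norm (seq_of x n)) F \<le> norm x"
  unfolding norm_ell2_def L2_set_def
  by (intro real_sqrt_le_mono finite_sum_le_infsum[OF seq_of_summable]) auto

lemma norm_seq_of_le: "norm (seq_of x n) \<le> norm x"
  using L2_set_le_norm[of "{n}" x] by simp

lemma ell2_boundI:
  fixes x :: "int \<Rightarrow> complex"
  assumes "\<And>F. finite F \<Longrightarrow> (\<Sum>n\<in>F. (norm (x n))\<^sup>2) \<le> B\<^sup>2" "0 \<le> B"
  obtains u where "seq_of u = x" "norm u \<le> B"
proof -
  have s: "(\<lambda>n. (norm (x n))\<^sup>2) summable_on UNIV"
    by (rule nonneg_bdd_above_summable_on) (use assms in \<open>auto simp: bdd_above_def\<close>)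
  then obtain u where u: "seq_of u = x"
    using range_seq_of[of x] by auto
  have "(\<Sum>\<^sub>\<infinity>n. (norm (seq_of u n))\<^sup>2) \<le> B\<^sup>2"
    by (rule infsum_le_finite_sums) (use s u assms in auto)
  then have "norm u \<le> B"
    using norm_ell2_sq[of u] assms(2) power2_le_imp_le by metis
  with u that show thesis by blast
qed

lemma seq_of_simps [simp]:
  "seq_of 0 n = 0" "seq_of (x + y) n = seq_of x n + seq_of y n" "seq_of (- x) n = - seq_of x n"
  "seq_of (x - y) n = seq_of x n - seq_of y n" "seq_of (c *\<^sub>C x) n = c * seq_of x n"
  by (simp_all add: zero_ell2.rep_eq plus_ell2.rep_eq uminus_ell2.rep_eq minus_ell2.rep_eq cscale.rep_eq)

lemma seq_of_scaleR [simp]: "seq_of (r *\<^sub>R x) n = of_real r * seq_of x n"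
  by (simp add: scaleR_ell2_def)

lemma seq_of_unit_vec: "seq_of (unit_vec k) n = (if n = k then 1 else 0)"
proof -
  have "(\<lambda>n. (norm (if n = k then 1 else 0 :: complex))\<^sup>2) summable_on {k}"
    by (rule summable_on_finite) simp
  then have "(\<lambda>n. (norm (if n = k then 1 else 0 :: complex))\<^sup>2) summable_on UNIV"
    by (rule summable_on_cong_neutral[THEN iffD1, rotated -1]) auto
  then show ?thesis unfolding unit_vec_def by (simp add: Abs_ell2_inverse)
qed

lemma norm_cscale [simp]: "norm (c *\<^sub>C x) = norm c * norm x"
  by (simp add: norm_ell2_def norm_mult power_mult_distrib infsum_cmult_right' real_sqrt_mult)

lemma bounded_bilinear_cscale: "bounded_bilinear (*\<^sub>C)"
proof
  show "\<exists>K. \<forall>a b. norm (a *\<^sub>C b) \<le> norm a * norm b * K"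
    by (rule exI[of _ 1]) simp
qed (auto intro!: ell2_eqI simp: algebra_simps scaleR_conv_of_real)

lemma bounded_linear_seq_of: "bounded_linear (\<lambda>x. seq_of x n)"
  by (rule bounded_linear_intro[where K=1]) (auto simp: norm_seq_of_le scaleR_conv_of_real)

text \<open>The entrywise limit \<open>l\<close> is not known to be square-summable in advance. The
  Cauchy inequality over a finite index set survives the limit in \<open>j\<close>, which exhibits
  \<open>X i - l\<close> as a vector of small norm; then \<open>l\<close> is a difference of two
  vectors. Completeness is used later for Neumann series and operator-valued integrals.\<close>

lemma ell2_Cauchy_convergent:
  fixes X :: "nat \<Rightarrow> ell2"
  assumes "Cauchy X"
  shows "convergent X"
proof -
  have coord: "Cauchy (\<lambda>i. seq_of (X i) n)" for n
    by (rule bounded_linear.Cauchy[OF bounded_linear_seq_of assms])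
  define l where "l n = lim (\<lambda>i. seq_of (X i) n)" for n
  have l: "(\<lambda>i. seq_of (X i) n) \<longlonglongrightarrow> l n" for n
    using Cauchy_convergent[OF coord, of n] unfolding l_def by (simp add: convergent_LIMSEQ_iff)
  have close: "\<exists>N. \<forall>i\<ge>N. \<exists>u. seq_of u = (\<lambda>n. seq_of (X i) n - l n) \<and> norm u \<le> e" if e: "e > 0" for e
  proof -
    obtain N where N: "\<And>i j. i \<ge> N \<Longrightarrow> j \<ge> N \<Longrightarrow> norm (X i - X j) < e"
      using CauchyD[OF assms e] by metis
    have "\<exists>u. seq_of u = (\<lambda>n. seq_of (X i) n - l n) \<and> norm u \<le> e" if i: "i \<ge> N" for i
    proof -
      have "(\<Sum>n\<in>F. (norm (seq_of (X i) n - l n))\<^sup>2) \<le> e\<^sup>2" if F: "finite F" for F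
      proof (rule tendsto_upperbound)
        show "((\<lambda>j. \<Sum>n\<in>F. (norm (seq_of (X i) n - seq_of (X j) n))\<^sup>2)
            \<longlongrightarrow> (\<Sum>n\<in>F. (norm (seq_of (X i) n - l n))\<^sup>2)) sequentially"
          by (intro tendsto_intros l)
        have "(\<Sum>n\<in>F. (norm (seq_of (X i) n - seq_of (X j) n))\<^sup>2) \<le> e\<^sup>2" if "j \<ge> N" for j
        proof -
          have "(L2_set (\<lambda>n. norm (seq_of (X i - X j) n)) F)\<^sup>2 \<le> e\<^sup>2"
            by (intro power_mono L2_set_nonneg order_trans[OF L2_set_le_norm[OF F]] less_imp_le N i that)
          then show ?thesis by (simp add: L2_set_def sum_nonneg)
        qed
        then show "\<forall>\<^sub>F j in sequentially. (\<Sum>n\<in>F. (norm (seq_of (X i) n - seq_of (X j) n))\<^sup>2) \<le> e\<^sup>2"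
          by (auto simp: eventually_sequentially)
      qed simp
      then show ?thesis
        using ell2_boundI[of "\<lambda>n. seq_of (X i) n - l n" e] \<open>e > 0\<close> by (metis less_imp_le)
    qed
    then show ?thesis by blast
  qed
  obtain i u where u: "seq_of u = (\<lambda>n. seq_of (X i) n - l n)"
    using close[of 1] by auto
  define L where "L = X i - u"
  have L: "seq_of L n = l n" for n by (simp add: L_def u)
  have "X \<longlonglongrightarrow> L"
  proof (rule LIMSEQ_I)
    fix r :: real assume "0 < r"
    then obtain N where N: "\<And>i. i \<ge> N \<Longrightarrow> \<exists>u. seq_of u = (\<lambda>n. seq_of (X i) n - l n) \<and> norm u \<le> r/2"
      using close[of "r/2"] by auto
    have "norm (X i - L) < r" if i: "i \<ge> N" for i
    proof -
      obtain u where u: "seq_of u = (\<lambda>n. seq_of (X i) n - l n)" "norm u \<le> r/2"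
        using N[OF i] by blast
      then have "X i - L = u" by (intro ell2_eqI) (simp add: L)
      with u \<open>0 < r\<close> show ?thesis by simp
    qed
    then show "\<exists>no. \<forall>n\<ge>no. norm (X n - L) < r" by blast
  qed
  then show ?thesis by (rule convergentI)
qed

instance ell2 :: banach
  by standard (rule ell2_Cauchy_convergent)

subsection \<open>The bilinear pairing\<close>

text \<open>No complex conjugate: the Jacobi matrix is symmetric but not Hermitian, and it is this
  bilinear form for which it is symmetric.\<close>

definition pairing :: "ell2 \<Rightarrow> ell2 \<Rightarrow> complex" where
  "pairing x y = (\<Sum>\<^sub>\<infinity>n. seq_of x n * seq_of y n)"

lemma pairing_finite_le:
  assumes "finite F"
  shows "(\<Sum>n\<in>F. norm (seq_of x n * seq_of y n)) \<le> norm x * norm y"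
proof -
  have "(\<Sum>n\<in>F. norm (seq_of x n * seq_of y n)) = (\<Sum>n\<in>F. \<bar>norm (seq_of x n)\<bar> * \<bar>norm (seq_of y n)\<bar>)"
    by (simp add: norm_mult)
  also have "\<dots> \<le> L2_set (\<lambda>n. norm (seq_of x n)) F * L2_set (\<lambda>n. norm (seq_of y n)) F"
    by (rule L2_set_mult_ineq)
  also have "\<dots> \<le> norm x * norm y"
    by (intro mult_mono L2_set_le_norm assms L2_set_nonneg norm_ge_zero)
  finally show ?thesis .
qed

lemma pairing_abs_summable: "(\<lambda>n. norm (seq_of x n * seq_of y n)) summable_on UNIV"
  by (rule nonneg_bdd_above_summable_on) (auto intro!: bdd_aboveI2 pairing_finite_le)

lemma pairing_summable: "(\<lambda>n. seq_of x n * seq_of y n) summable_on UNIV"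
  by (rule abs_summable_summable[OF pairing_abs_summable])

lemma bounded_bilinear_pairing: "bounded_bilinear pairing"
proof
  show "pairing (a + a') b = pairing a b + pairing a' b" for a a' b
    unfolding pairing_def using infsum_add[OF pairing_summable[of a b] pairing_summable[of a' b]]
    by (simp add: algebra_simps)
  show "pairing a (b + b') = pairing a b + pairing a b'" for a b b'
    unfolding pairing_def using infsum_add[OF pairing_summable[of a b] pairing_summable[of a b']]
    by (simp add: algebra_simps)
  show "pairing (r *\<^sub>R a) b = r *\<^sub>R pairing a b" for r a b
    unfolding pairing_def by (simp add: scaleR_conv_of_real mult.assoc infsum_cmult_right')
  show "pairing a (r *\<^sub>R b) = r *\<^sub>R pairing a b" for r a b
    unfolding pairing_def by (simp add: scaleR_conv_of_real mult.left_commute infsum_cmult_right')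
  show "\<exists>K. \<forall>a b. norm (pairing a b) \<le> norm a * norm b * K"
  proof (intro exI[of _ 1] allI)
    fix a b
    have "norm (pairing a b) \<le> (\<Sum>\<^sub>\<infinity>n. norm (seq_of a n * seq_of b n))"
      unfolding pairing_def by (rule norm_infsum_bound[OF pairing_abs_summable])
    also have "\<dots> \<le> norm a * norm b"
      by (rule infsum_le_finite_sums[OF pairing_abs_summable]) (rule pairing_finite_le)
    finally show "norm (pairing a b) \<le> norm a * norm b * 1" by simp
  qed
qed

lemma pairing_cscale: "pairing (c *\<^sub>C x) y = c * pairing x y" "pairing x (c *\<^sub>C y) = c * pairing x y"
  unfolding pairing_def by (simp_all add: mult.assoc mult.left_commute infsum_cmult_right')

lemma pairing_unit_vec: "pairing (unit_vec k) y = seq_of y k"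
proof -
  have "pairing (unit_vec k) y = (\<Sum>\<^sub>\<infinity>n\<in>{k}. seq_of y n)"
    unfolding pairing_def by (rule infsum_cong_neutral) (auto simp: seq_of_unit_vec)
  then show ?thesis by simp
qed

subsection \<open>Exponentially localised kernels\<close>

text \<open>Each side of \<open>m\<close> maps injectively to exponents and contributes at most the
  full geometric sum 2.\<close>

lemma half_power_int_sum:
  assumes "finite F"
  shows "(\<Sum>n\<in>F. (1/2::real) ^ nat \<bar>n - m\<bar>) \<le> 4"
proof -
  define A where "A = {n\<in>F. n \<ge> m}"
  define B where "B = {n\<in>F. n < m}"
  have half: "(\<Sum>n\<in>S. (1/2::real) ^ n) \<le> 2" if "finite S" for S :: "nat set"
    using sum_le_suminf[of "\<lambda>n. (1/2::real)^n" S] that suminf_geometric[of "1/2::real"]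
    by (simp add: summable_geometric)
  have img: "(\<Sum>n\<in>S. (1/2::real) ^ nat \<bar>n - m\<bar>) \<le> 2"
    if "finite S" "inj_on (\<lambda>n. nat \<bar>n - m\<bar>) S" for S
  proof -
    have "(\<Sum>n\<in>S. (1/2::real) ^ nat \<bar>n - m\<bar>) = (\<Sum>k\<in>(\<lambda>n. nat \<bar>n - m\<bar>) ` S. (1/2) ^ k)"
      by (simp add: sum.reindex[OF that(2)])
    also have "\<dots> \<le> 2" by (rule half) (use that in simp)
    finally show ?thesis .
  qed
  have "F = A \<union> B" "A \<inter> B = {}" by (auto simp: A_def B_def)
  then have "(\<Sum>n\<in>F. (1/2::real) ^ nat \<bar>n - m\<bar>)
      = (\<Sum>n\<in>A. (1/2) ^ nat \<bar>n - m\<bar>) + (\<Sum>n\<in>B. (1/2) ^ nat \<bar>n - m\<bar>)"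
    using assms by (metis finite_Un sum.union_disjoint)
  also have "\<dots> \<le> 2 + 2"
    by (intro add_mono img) (use assms in \<open>auto simp: A_def B_def inj_on_def\<close>)
  finally show ?thesis by simp
qed

lemma half_power_int_summable: "(\<lambda>n. (1/2::real) ^ nat \<bar>n - m\<bar>) summable_on UNIV"
  by (rule nonneg_bdd_above_summable_on) (auto intro!: bdd_aboveI2 half_power_int_sum)

lemma geometric_in_ell2:
  assumes "\<And>n. norm (x n) \<le> C * (1/2) ^ nat \<bar>n\<bar>"
  shows "x \<in> range seq_of"
proof -
  have C: "0 \<le> C" using order_trans[OF norm_ge_zero assms[of 0]] by simp
  have "(norm (x n))\<^sup>2 \<le> C\<^sup>2 * (1/2) ^ nat \<bar>n - 0\<bar>" for n
  proof -
    have "(norm (x n))\<^sup>2 \<le> (C * (1/2) ^ nat \<bar>n\<bar>)\<^sup>2"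
      by (rule power_mono[OF assms]) simp
    also have "\<dots> = C\<^sup>2 * ((1/2) ^ nat \<bar>n\<bar> * (1/2) ^ nat \<bar>n\<bar>)"
      by (simp add: power_mult_distrib power2_eq_square)
    also have "\<dots> \<le> C\<^sup>2 * ((1/2) ^ nat \<bar>n\<bar> * 1)"
      by (intro mult_left_mono) (auto simp: power_le_one)
    finally show ?thesis by simp
  qed
  then show ?thesis unfolding range_seq_of
    by (intro summable_on_comparison_test[OF
          summable_on_cmult_right[OF half_power_int_summable[of 0], of "C\<^sup>2"]]) auto
qed

definition kernel_apply :: "(int \<Rightarrow> int \<Rightarrow> complex) \<Rightarrow> ell2 \<Rightarrow> int \<Rightarrow> complex" where
  "kernel_apply G y n = (\<Sum>\<^sub>\<infinity>m. G n m * seq_of y m)"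

lemma kernel_apply_abs_summable:
  assumes G: "\<And>n m. norm (G n m) \<le> C * (1/2) ^ nat \<bar>n - m\<bar>"
  shows "(\<lambda>m. norm (G n m * seq_of y m)) summable_on UNIV"
proof (rule summable_on_comparison_test)
  show "(\<lambda>m. (C * norm y) * (1/2) ^ nat \<bar>m - n\<bar>) summable_on UNIV"
    by (rule summable_on_cmult_right[OF half_power_int_summable])
  show "norm (G n m * seq_of y m) \<le> (C * norm y) * (1/2) ^ nat \<bar>m - n\<bar>" for m
  proof -
    have "norm (G n m * seq_of y m) \<le> (C * (1/2) ^ nat \<bar>n - m\<bar>) * norm y"
      unfolding norm_mult
      by (intro mult_mono G norm_seq_of_le norm_ge_zero order_trans[OF norm_ge_zero G])
    then show ?thesis by (simp add: abs_minus_commute mult_ac)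
  qed
qed auto

lemma kernel_apply_summable:
  assumes "\<And>n m. norm (G n m) \<le> C * (1/2) ^ nat \<bar>n - m\<bar>"
  shows "(\<lambda>m. G n m * seq_of y m) summable_on UNIV"
  by (rule abs_summable_summable[OF kernel_apply_abs_summable[OF assms]])

text \<open>Schur's test: Cauchy--Schwarz against the weight \<open>norm (G n m)\<close>.\<close>

lemma kernel_apply_bound:
  assumes G: "\<And>n m. norm (G n m) \<le> C * (1/2) ^ nat \<bar>n - m\<bar>" and F: "finite F"
  shows "(\<Sum>n\<in>F. (norm (kernel_apply G y n))\<^sup>2) \<le> (4 * C * norm y)\<^sup>2"
proof -
  have C: "0 \<le> C" using order_trans[OF norm_ge_zero G[of 0 0]] by simp
  \<comment> \<open>Columns are cut down to a finite \<open>M\<close>, so that Cauchy-Schwarz and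
    the exchange of sums are finite; \<open>M\<close> is exhausted at the end. The constant
    \<open>4 * C\<close> bounds the row sums and the column sums of the weight
    \<open>p\<close>.\<close>
  have fin: "(\<Sum>n\<in>F. (norm (\<Sum>m\<in>M. G n m * seq_of y m))\<^sup>2) \<le> (4 * C * norm y)\<^sup>2" if M: "finite M" for M
  proof -
    define p where "p n m = C * (1/2::real) ^ nat \<bar>n - m\<bar>" for n m
    have p0: "p n m \<ge> 0" for n m by (simp add: p_def C)
    have pM: "(\<Sum>m\<in>M. p n m) \<le> 4 * C" for n
      using mult_left_mono[OF half_power_int_sum[OF M, of n] C]
      by (simp add: p_def sum_distrib_left[symmetric] abs_minus_commute)
    have pF: "(\<Sum>n\<in>F. p n m) \<le> 4 * C" for m
      using mult_left_mono[OF half_power_int_sum[OF F, of m] C]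
      by (simp add: p_def sum_distrib_left[symmetric])
    have "(norm (\<Sum>m\<in>M. G n m * seq_of y m))\<^sup>2 \<le> 4 * C * (\<Sum>m\<in>M. p n m * (norm (seq_of y m))\<^sup>2)" for n
    proof -
      have "norm (\<Sum>m\<in>M. G n m * seq_of y m) \<le> (\<Sum>m\<in>M. sqrt (p n m) * (sqrt (p n m) * norm (seq_of y m)))"
      proof (rule order_trans[OF norm_sum sum_mono])
        fix m
        have "norm (G n m * seq_of y m) \<le> p n m * norm (seq_of y m)"
          unfolding norm_mult p_def by (intro mult_right_mono G) simp
        then show "norm (G n m * seq_of y m) \<le> sqrt (p n m) * (sqrt (p n m) * norm (seq_of y m))"
          using p0[of n m] by (simp add: mult.assoc[symmetric])
      qed
      then have "(norm (\<Sum>m\<in>M. G n m * seq_of y m))\<^sup>2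
          \<le> (\<Sum>m\<in>M. sqrt (p n m) * (sqrt (p n m) * norm (seq_of y m)))\<^sup>2"
        by (rule power_mono) simp
      also have "\<dots> \<le> (\<Sum>m\<in>M. (sqrt (p n m))\<^sup>2) * (\<Sum>m\<in>M. (sqrt (p n m) * norm (seq_of y m))\<^sup>2)"
        by (rule Cauchy_Schwarz_ineq_sum)
      also have "\<dots> = (\<Sum>m\<in>M. p n m) * (\<Sum>m\<in>M. p n m * (norm (seq_of y m))\<^sup>2)"
        by (simp add: p0 power_mult_distrib)
      also have "\<dots> \<le> 4 * C * (\<Sum>m\<in>M. p n m * (norm (seq_of y m))\<^sup>2)"
        by (intro mult_right_mono pM sum_nonneg mult_nonneg_nonneg p0) auto
      finally show ?thesis .
    qed
    then have "(\<Sum>n\<in>F. (norm (\<Sum>m\<in>M. G n m * seq_of y m))\<^sup>2)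
        \<le> (\<Sum>n\<in>F. 4 * C * (\<Sum>m\<in>M. p n m * (norm (seq_of y m))\<^sup>2))"
      by (rule sum_mono)
    also have "\<dots> = 4 * C * (\<Sum>n\<in>F. \<Sum>m\<in>M. p n m * (norm (seq_of y m))\<^sup>2)"
      by (simp add: sum_distrib_left)
    also have "\<dots> = 4 * C * (\<Sum>m\<in>M. (\<Sum>n\<in>F. p n m) * (norm (seq_of y m))\<^sup>2)"
      by (subst sum.swap) (simp add: sum_distrib_right)
    also have "\<dots> \<le> 4 * C * (\<Sum>m\<in>M. (4 * C) * (norm (seq_of y m))\<^sup>2)"
      by (intro mult_left_mono sum_mono mult_right_mono pF) (use C in auto)
    also have "\<dots> = (4 * C)\<^sup>2 * (L2_set (\<lambda>m. norm (seq_of y m)) M)\<^sup>2"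
      by (simp add: L2_set_def sum_nonneg sum_distrib_left[symmetric] power2_eq_square)
    also have "\<dots> \<le> (4 * C)\<^sup>2 * (norm y)\<^sup>2"
      by (intro mult_left_mono power_mono L2_set_le_norm M L2_set_nonneg) simp
    finally show ?thesis by (simp add: power_mult_distrib)
  qed
  show ?thesis
  proof (rule tendsto_upperbound)
    show "((\<lambda>M. \<Sum>n\<in>F. (norm (\<Sum>m\<in>M. G n m * seq_of y m))\<^sup>2) \<longlongrightarrow>
        (\<Sum>n\<in>F. (norm (kernel_apply G y n))\<^sup>2)) (finite_subsets_at_top UNIV)"
      unfolding kernel_apply_def by (intro tendsto_intros infsum_tendsto kernel_apply_summable[OF G])
    show "\<forall>\<^sub>F M in finite_subsets_at_top UNIV.
        (\<Sum>n\<in>F. (norm (\<Sum>m\<in>M. G n m * seq_of y m))\<^sup>2) \<le> (4 * C * norm y)\<^sup>2"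
      by (intro eventually_finite_subsets_at_top_weakI fin)
  qed simp
qed

lemma kernel_operator:
  assumes G: "\<And>n m. norm (G n m) \<le> C * (1/2) ^ nat \<bar>n - m\<bar>"
  obtains R :: "ell2 \<Rightarrow>\<^sub>L ell2"
  where "\<And>y. seq_of (blinfun_apply R y) = kernel_apply G y" "norm R \<le> 4 * C"
proof -
  have C: "0 \<le> C" using order_trans[OF norm_ge_zero G[of 0 0]] by simp
  have "\<exists>u. seq_of u = kernel_apply G y \<and> norm u \<le> 4 * C * norm y" for y
    using ell2_boundI[OF kernel_apply_bound[OF G, where y=y]] C by (metis mult_nonneg_nonneg norm_ge_zero zero_le_numeral)
  then obtain T where T: "\<And>y. seq_of (T y) = kernel_apply G y" "\<And>y. norm (T y) \<le> 4 * C * norm y"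
    by metis
  have bl: "bounded_linear T"
  proof (rule bounded_linear_intro[where K="4 * C"])
    fix x y r
    show "T (x + y) = T x + T y"
      by (rule ell2_eqI) (simp add: T kernel_apply_def distrib_left
          infsum_add[OF kernel_apply_summable[OF G] kernel_apply_summable[OF G]])
    show "T (r *\<^sub>R x) = r *\<^sub>R T x"
      by (rule ell2_eqI) (simp add: T kernel_apply_def mult.left_commute infsum_cmult_right')
    show "norm (T x) \<le> norm x * (4 * C)" using T(2)[of x] by (simp add: mult_ac)
  qed
  have ap: "blinfun_apply (Blinfun T) = T" by (rule bounded_linear_Blinfun_apply[OF bl])
  show thesis
  proof (rule that)
    show "seq_of (blinfun_apply (Blinfun T) y) = kernel_apply G y" for y by (simp add: ap T)
    show "norm (Blinfun T) \<le> 4 * C" by (rule norm_blinfun_bound) (use T C in \<open>auto simp: ap\<close>)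
  qed
qed

section \<open>Jacobi operators with coinciding minimal and maximal domain\<close>

lemma J_max_iff: "(x, y) \<in> J_max lam w \<longleftrightarrow> seq_of y = jacobi lam w (seq_of x)"
  by (simp add: J_max_def)

lemma J_max_add: "(x, y) \<in> J_max lam w \<Longrightarrow> (x', y') \<in> J_max lam w \<Longrightarrow> (x + x', y + y') \<in> J_max lam w"
  by (simp add: J_max_iff fun_eq_iff jacobi_def algebra_simps)

lemma J_max_cscale: "(x, y) \<in> J_max lam w \<Longrightarrow> (c *\<^sub>C x, c *\<^sub>C y) \<in> J_max lam w"
  by (simp add: J_max_iff fun_eq_iff jacobi_def algebra_simps)

lemma shift_iff: "(x, y) \<in> shift J z \<longleftrightarrow> (x, y + z *\<^sub>C x) \<in> J"
  by (auto simp: shift_def) (metis add_diff_cancel)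

lemma kernel_shift_iff: "v \<in> kernel (shift J z) \<longleftrightarrow> (v, z *\<^sub>C v) \<in> J"
  by (simp add: kernel_def shift_iff)

definition formal_solution ::
    "(int \<Rightarrow> complex) \<Rightarrow> (int \<Rightarrow> complex) \<Rightarrow> complex \<Rightarrow> (int \<Rightarrow> complex) \<Rightarrow> bool" where
  "formal_solution lam w z x \<longleftrightarrow> (\<forall>n. jacobi lam w x n = z * x n)"

lemma formal_solution_J_max:
  "(v, z *\<^sub>C v) \<in> J_max lam w \<longleftrightarrow> formal_solution lam w z (seq_of v)"
  by (auto simp: J_max_iff formal_solution_def fun_eq_iff)

text \<open>As \<open>w\<close> vanishes nowhere, the recurrence can be solved upwards and downwards
  from two consecutive entries.\<close>

lemma formal_solution_eq_0:
  assumes w: "\<And>n. w n \<noteq> 0" and sol: "formal_solution lam w z x" and 0: "x k = 0" "x (k + 1) = 0"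
  shows "x n = 0"
proof -
  have rec: "w (n - 1) * x (n - 1) + lam n * x n + w n * x (n + 1) = z * x n" for n
    using sol by (simp add: formal_solution_def jacobi_def)
  have "x n = 0 \<and> x (n + 1) = 0"
  proof (induction n rule: int_induct[where k=k])
    case base show ?case using 0 by simp
  next
    case (step1 i) then show ?case using rec[of "i + 1"] w[of "i + 1"] by (simp add: add.commute)
  next
    case (step2 i) then show ?case using rec[of i] w[of "i - 1"] by simp
  qed
  then show ?thesis ..
qed

lemma formal_solution_diff_scale:
  assumes "formal_solution lam w z x" "formal_solution lam w z y"
  shows "formal_solution lam w z (\<lambda>n. x n - c * y n)"
  unfolding formal_solution_def
proof
  fix n
  have "jacobi lam w (\<lambda>n. x n - c * y n) n = jacobi lam w x n - c * jacobi lam w y n"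
    by (simp add: jacobi_def algebra_simps)
  then show "jacobi lam w (\<lambda>n. x n - c * y n) n = z * (x n - c * y n)"
    using assms by (simp add: formal_solution_def algebra_simps)
qed

text \<open>The factor \<open>w n\<close> makes this independent of \<open>n\<close> for two
  solutions with the same \<open>z\<close>.\<close>

definition wronskian :: "(int \<Rightarrow> complex) \<Rightarrow> (int \<Rightarrow> complex) \<Rightarrow> (int \<Rightarrow> complex) \<Rightarrow> int \<Rightarrow> complex" where
  "wronskian w x y n = w n * (x n * y (n + 1) - x (n + 1) * y n)"

lemma wronskian_step:
  assumes "formal_solution lam w z x" "formal_solution lam w z y"
  shows "wronskian w x y n = wronskian w x y (n - 1)"
proof -
  have X: "w n * x (n + 1) = z * x n - lam n * x n - w (n - 1) * x (n - 1)"
    and Y: "w n * y (n + 1) = z * y n - lam n * y n - w (n - 1) * y (n - 1)"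
    using assms by (auto simp: formal_solution_def jacobi_def algebra_simps)
  have "wronskian w x y n = x n * (w n * y (n + 1)) - (w n * x (n + 1)) * y n"
    by (simp add: wronskian_def algebra_simps)
  also have "\<dots> = wronskian w x y (n - 1)"
    unfolding X Y by (simp add: wronskian_def algebra_simps)
  finally show ?thesis .
qed

lemma wronskian_const:
  assumes "formal_solution lam w z x" "formal_solution lam w z y"
  shows "wronskian w x y n = wronskian w x y m"
proof (induction n rule: int_induct[where k=m])
  case (step1 i) then show ?case using wronskian_step[OF assms, of "i + 1"] by simp
next
  case (step2 i) then show ?case using wronskian_step[OF assms, of i] by simp
qed simp

text \<open>The difference of the two sides vanishes at \<open>k\<close> by the choice of the factor
  and at \<open>k + 1\<close> because the Wronskian does, hence everywhere.\<close>

lemma wronskian_eq_0_imp_proportional: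
  assumes w: "\<And>n. w n \<noteq> 0" and x: "formal_solution lam w z x" and y: "formal_solution lam w z y"
    and W: "wronskian w x y m = 0" and k: "y k \<noteq> 0"
  shows "x n = x k / y k * y n"
proof -
  let ?d = "\<lambda>n. x n - x k / y k * y n"
  have "wronskian w x y k = 0" using wronskian_const[OF x y] W by metis
  then have "?d k = 0" "?d (k + 1) = 0"
    using k w[of k] by (auto simp: wronskian_def field_simps)
  from formal_solution_eq_0[OF w formal_solution_diff_scale[OF x y] this, of n]
  show ?thesis by (simp only: right_minus_eq)
qed

text \<open>For fixed \<open>v\<close> the identity is checked on unit vectors, extended by
  linearity to their span, and carried to the closure since \<open>pairing\<close> is continuous.
  The equality of the two operators then makes it available for every \<open>u\<close> in the
  maximal domain.\<close>

lemma J_min_eq_J_max_symmetric: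
  assumes J: "J_min lam w = J_max lam w" and u: "(u, u') \<in> J_max lam w" and v: "(v, v') \<in> J_max lam w"
  shows "pairing u' v = pairing u v'"
proof -
  have core: "\<exists>y. seq_of y = jacobi lam w (seq_of x) \<and> pairing y v = pairing x v'"
    if "x \<in> cell2.span (range unit_vec)" for x
    using that
  proof (rule cell2.span_induct)
    show "cell2.subspace {x. \<exists>y. seq_of y = jacobi lam w (seq_of x) \<and> pairing y v = pairing x v'}"
    proof (rule cell2.subspaceI)
      show "0 \<in> {x. \<exists>y. seq_of y = jacobi lam w (seq_of x) \<and> pairing y v = pairing x v'}"
        by (auto intro!: exI[of _ 0] simp: fun_eq_iff jacobi_def pairing_def)
    next
      fix x x' assume "x \<in> {x. \<exists>y. seq_of y = jacobi lam w (seq_of x) \<and> pairing y v = pairing x v'}"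
        "x' \<in> {x. \<exists>y. seq_of y = jacobi lam w (seq_of x) \<and> pairing y v = pairing x v'}"
      then obtain y y' where "(x, y) \<in> J_max lam w" "pairing y v = pairing x v'"
        "(x', y') \<in> J_max lam w" "pairing y' v = pairing x' v'" by (auto simp: J_max_iff)
      then show "x + x' \<in> {x. \<exists>y. seq_of y = jacobi lam w (seq_of x) \<and> pairing y v = pairing x v'}"
        using J_max_add[of x y lam w x' y']
        by (auto intro!: exI[of _ "y + y'"] simp: J_max_iff bounded_bilinear.add_left[OF bounded_bilinear_pairing])
    next
      fix c x assume "x \<in> {x. \<exists>y. seq_of y = jacobi lam w (seq_of x) \<and> pairing y v = pairing x v'}"
      then obtain y where "(x, y) \<in> J_max lam w" "pairing y v = pairing x v'" by (auto simp: J_max_iff)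
      then show "c *\<^sub>C x \<in> {x. \<exists>y. seq_of y = jacobi lam w (seq_of x) \<and> pairing y v = pairing x v'}"
        using J_max_cscale[of x y lam w c]
        by (auto intro!: exI[of _ "c *\<^sub>C y"] simp: J_max_iff pairing_cscale)
    qed
  next
    fix x assume "x \<in> range unit_vec"
    then obtain k where k: "x = unit_vec k" by blast
    let ?y = "w (k - 1) *\<^sub>C unit_vec (k - 1) + (lam k *\<^sub>C unit_vec k + w k *\<^sub>C unit_vec (k + 1))"
    have "seq_of ?y = jacobi lam w (seq_of x)"
      by (auto simp: fun_eq_iff jacobi_def k seq_of_unit_vec)
    moreover have "pairing ?y v = pairing x v'"
      using v by (simp add: k pairing_unit_vec pairing_cscale J_max_iff jacobi_def
          bounded_bilinear.add_left[OF bounded_bilinear_pairing])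
    ultimately show "\<exists>y. seq_of y = jacobi lam w (seq_of x) \<and> pairing y v = pairing x v'" by blast
  qed
  have "closed {p. pairing (snd p) v = pairing (fst p) v'}"
    by (intro closed_Collect_eq continuous_intros
        bounded_linear.continuous_on[OF bounded_bilinear.bounded_linear_left[OF bounded_bilinear_pairing]])
  moreover have "{(x, y). x \<in> cell2.span (range unit_vec) \<and> seq_of y = jacobi lam w (seq_of x)}
      \<subseteq> {p. pairing (snd p) v = pairing (fst p) v'}"
    using core by clarsimp (metis seq_of_inject)
  ultimately have "J_min lam w \<subseteq> {p. pairing (snd p) v = pairing (fst p) v'}"
    unfolding J_min_def by (rule closure_minimal[rotated])
  with u J show ?thesis by auto
qed

text \<open>Cutting a formal solution off at one end gives an element of the domain of the operator, and
  the symmetry of the operator then reads off the Wronskian at the cut.\<close>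

lemma wronskian_cut:
  assumes J: "J_min lam w = J_max lam w" and y: "(y, z *\<^sub>C y) \<in> J_max lam w" and s: "s \<noteq> 0"
    and u: "\<And>n. jacobi lam w (seq_of u) n - z * seq_of u n =
      s * (if n = 0 then w 0 * x 1 else if n = 1 then - w 0 * x 0 else 0)"
  shows "wronskian w x (seq_of y) 0 = 0"
proof -
  \<comment> \<open>The truncated solution solves the equation except at the two indices next to the
    cut, so its image is \<open>z *\<^sub>C u\<close> plus two unit vectors. The sign
    \<open>s\<close> is 1 if the right part is kept and -1 if the left part is kept.\<close>
  let ?u' = "z *\<^sub>C u + ((s * w 0 * x 1) *\<^sub>C unit_vec 0 + (- s * w 0 * x 0) *\<^sub>C unit_vec 1)"
  have "jacobi lam w (seq_of u) n = seq_of ?u' n" for n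
    using u[of n] by (auto simp: seq_of_unit_vec diff_eq_eq)
  then have "(u, ?u') \<in> J_max lam w" by (simp add: J_max_iff fun_eq_iff)
  from J_min_eq_J_max_symmetric[OF J this y]
  show ?thesis using s
    by (auto simp: pairing_cscale pairing_unit_vec wronskian_def
        bounded_bilinear.add_left[OF bounded_bilinear_pairing]
        bounded_bilinear.diff_left[OF bounded_bilinear_pairing])
qed

lemma wronskian_right_solution:
  assumes J: "J_min lam w = J_max lam w" and y: "(y, z *\<^sub>C y) \<in> J_max lam w"
    and x: "formal_solution lam w z x" and x2: "(\<lambda>n. if n \<ge> 1 then x n else 0) \<in> range seq_of"
  shows "wronskian w x (seq_of y) m = 0"
proof -
  obtain u where u: "seq_of u = (\<lambda>n. if n \<ge> 1 then x n else 0)" using x2 by auto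
  have "jacobi lam w (seq_of u) n - z * seq_of u n =
      1 * (if n = 0 then w 0 * x 1 else if n = 1 then - w 0 * x 0 else 0)" for n
    using x[unfolded formal_solution_def jacobi_def, rule_format, of n]
    by (auto simp: u jacobi_def algebra_simps)
  from wronskian_cut[OF J y _ this] show ?thesis
    using wronskian_const[OF x y[unfolded formal_solution_J_max], of m 0] by simp
qed

lemma wronskian_left_solution:
  assumes J: "J_min lam w = J_max lam w" and y: "(y, z *\<^sub>C y) \<in> J_max lam w"
    and x: "formal_solution lam w z x" and x2: "(\<lambda>n. if n \<le> 0 then x n else 0) \<in> range seq_of"
  shows "wronskian w x (seq_of y) m = 0"
proof -
  obtain u where u: "seq_of u = (\<lambda>n. if n \<le> 0 then x n else 0)" using x2 by auto
  have "jacobi lam w (seq_of u) n - z * seq_of u n =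
      (-1) * (if n = 0 then w 0 * x 1 else if n = 1 then - w 0 * x 0 else 0)" for n
    using x[unfolded formal_solution_def jacobi_def, rule_format, of n]
    by (auto simp: u jacobi_def algebra_simps)
  from wronskian_cut[OF J y _ this] show ?thesis
    using wronskian_const[OF x y[unfolded formal_solution_J_max], of m 0] by simp
qed

lemma range_seq_of_restrict:
  assumes "x \<in> range seq_of"
  shows "(\<lambda>n. if P n then x n else 0) \<in> range seq_of"
  using assms unfolding range_seq_of
  by (rule summable_on_comparison_test) auto

text \<open>The right half of one eigenvector, paired with another, annihilates their Wronskian, so
  any two are proportional. The argument covers eigenvalues in the closure of the diagonal as
  well.\<close>

lemma kernel_eq_span:
  assumes w: "\<And>n. w n \<noteq> 0" and J: "J_min lam w = J_max lam w"
    and v: "v \<in> kernel (shift (J_max lam w) z)" "v \<noteq> 0"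
  shows "kernel (shift (J_max lam w) z) = cell2.span {v}"
proof -
  have v': "(v, z *\<^sub>C v) \<in> J_max lam w" using v by (simp add: kernel_shift_iff)
  obtain k where k: "seq_of v k \<noteq> 0" using v(2) ell2_eqI[of v 0] by auto
  have "\<exists>c. x = c *\<^sub>C v" if "(x, z *\<^sub>C x) \<in> J_max lam w" for x
  proof -
    have x: "formal_solution lam w z (seq_of x)" using that by (simp add: formal_solution_J_max)
    have "wronskian w (seq_of x) (seq_of v) 0 = 0"
      by (rule wronskian_right_solution[OF J v' x range_seq_of_restrict]) simp
    note p = wronskian_eq_0_imp_proportional[OF w x v'[unfolded formal_solution_J_max] this k]
    have "x = (seq_of x k / seq_of v k) *\<^sub>C v"
      by (rule ell2_eqI) (simp only: seq_of_simps, rule p)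
    then show ?thesis ..
  qed
  then show ?thesis
    using J_max_cscale[OF v']
    by (fastforce simp: cell2.span_singleton kernel_shift_iff mult.commute[of _ z])
qed

lemma geometric_mult_eq_1:
  assumes w: "\<And>n. w n \<noteq> 0" and J: "J_min lam w = J_max lam w" and z: "z \<in> point_spec (J_max lam w)"
  shows "geometric_mult (J_max lam w) z = 1"
proof -
  obtain v where v: "v \<in> kernel (shift (J_max lam w) z)" "v \<noteq> 0"
    using z by (auto simp: point_spec_def kernel_shift_iff)
  have "cell2.independent {v}" using v(2) by (simp add: cell2.dependent_single)
  then show ?thesis
    by (simp add: geometric_mult_def kernel_eq_span[OF w J v] cell2.dim_eq_card_independent)
qed

section \<open>The function \<open>\<FF>\<close>\<close>

text \<open>A finite set carrying almost all of the mass is taken for \<open>F\<close>. This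
  supplies the limits of tails at both ends of the integers.\<close>

lemma infsum_avoiding_finite_small:
  fixes M :: "'a \<Rightarrow> real"
  assumes M: "M summable_on UNIV" "\<And>k. 0 \<le> M k" and e: "0 < e"
  obtains F where "finite F" "\<And>A. A \<inter> F = {} \<Longrightarrow> infsum M A < e"
proof -
  have "\<forall>\<^sub>F F in finite_subsets_at_top UNIV. infsum M UNIV - e < sum M F"
    using order_tendstoD(1)[OF infsum_tendsto[OF M(1)], of "infsum M UNIV - e"] e by simp
  then obtain F where F: "finite F" "infsum M UNIV - e < sum M F"
    unfolding eventually_finite_subsets_at_top by auto
  have sub: "M summable_on A" for A using M(1) by (rule summable_on_subset_banach) simp
  have "infsum M A < e" if "A \<inter> F = {}" for A
  proof -
    have "infsum M A + sum M F = infsum M (A \<union> F)"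
      using infsum_Un_disjoint[OF sub sub that] F(1) by simp
    also have "\<dots> \<le> infsum M UNIV" by (rule infsum_mono2[OF sub sub]) (use M in auto)
    finally show ?thesis using F(2) by linarith
  qed
  with F that show thesis by blast
qed

text \<open>In the factorisation of the right side as \<open>a - b\<close> times
  \<open>m + 1\<close> monomials of degree \<open>m\<close>, each monomial is at least
  \<open>b ^ m\<close>. It replaces integration of a power when sums over ordered indices are
  telescoped.\<close>

lemma power_Suc_diff_ge:
  fixes a b :: real
  assumes "0 \<le> b" "b \<le> a"
  shows "real (Suc m) * ((a - b) * b ^ m) \<le> a ^ Suc m - b ^ Suc m"
proof (induction m)
  case (Suc m)
  have "real (Suc (Suc m)) * ((a - b) * b ^ Suc m) = b * (real (Suc m) * ((a - b) * b ^ m)) + (a - b) * b ^ Suc m"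
    by (simp add: algebra_simps)
  also have "\<dots> \<le> a * (a ^ Suc m - b ^ Suc m) + (a - b) * b ^ Suc m"
  proof (intro add_right_mono)
    have "b * (real (Suc m) * ((a - b) * b ^ m)) \<le> b * (a ^ Suc m - b ^ Suc m)"
      by (rule mult_left_mono[OF Suc.IH assms(1)])
    also have "\<dots> \<le> a * (a ^ Suc m - b ^ Suc m)"
      by (rule mult_right_mono[OF assms(2)]) (use assms in \<open>simp add: power_mono del: power_Suc\<close>)
    finally show "b * (real (Suc m) * ((a - b) * b ^ m)) \<le> a * (a ^ Suc m - b ^ Suc m)" .
  qed
  also have "\<dots> = a ^ Suc (Suc m) - b ^ Suc (Suc m)" by (simp add: algebra_simps)
  finally show ?case .
qed simp

lemma nested_sum_cong:
  assumes "\<And>k. x k * x (k + 1) = y k * y (k + 1)"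
  shows "nested_sum x m A = nested_sum y m A"
  by (induction m arbitrary: A) (simp_all add: assms)

text \<open>Only products of neighbours matter, which reconciles the denominators
  \<open>z - lam n\<close> of \<open>char_fun\<close> with \<open>lam n - z\<close> in
  \<open>f_sol\<close>.\<close>

lemma frakF_cong:
  assumes "\<And>k. x k * x (k + 1) = y k * y (k + 1)"
  shows "frakF x = frakF y"
  unfolding frakF_def nested_sum_cong[of x y, OF assms] ..

text \<open>Only the outermost index is confined to \<open>A\<close>; the inner ones run freely to
  the right. Hence \<open>frakF_on A x - 1\<close> is additive over disjoint sets, while for a
  half-line \<open>{n..}\<close> the inner indices stay in it and the function of the truncated
  sequence results.\<close>

definition frakF_on :: "int set \<Rightarrow> (int \<Rightarrow> complex) \<Rightarrow> complex" where
  "frakF_on A x = 1 + (\<Sum>m. (- 1) ^ Suc m * nested_sum x (Suc m) A)"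

lemma frakF_eq: "frakF x = frakF_on UNIV x"
  by (simp only: frakF_def frakF_on_def)

lemma nested_sum_truncate:
  "nested_sum (\<lambda>k. if n \<le> k then x k else 0) (Suc m) UNIV = nested_sum x (Suc m) {n..}"
proof -
  let ?y = "\<lambda>k. if n \<le> k then x k else 0"
  have tail: "nested_sum ?y m {k..} = nested_sum x m {k..}" if "n \<le> k" for m k
    using that
  proof (induction m arbitrary: k)
    case (Suc m)
    then show ?case
      unfolding nested_sum.simps by (intro infsum_cong) auto
  qed simp
  show ?thesis
    unfolding nested_sum.simps by (rule infsum_cong_neutral) (auto simp: tail)
qed

lemma frakF_from_eq: "frakF_from n x = frakF_on {n..} x"
  by (simp only: frakF_from_def frakF_def frakF_on_def nested_sum_truncate)

text \<open>The majorant is kept apart from \<open>x\<close> so that one \<open>M\<close> can serve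
  all spectral parameters in a disc.\<close>

locale dominated_products =
  fixes x :: "int \<Rightarrow> complex" and M :: "int \<Rightarrow> real"
  assumes product_le: "norm (x k * x (k + 1)) \<le> M k"
    and M_summable: "M summable_on UNIV"
begin

abbreviation "Msum \<equiv> infsum M UNIV"

lemma M_nonneg: "0 \<le> M k"
  using order_trans[OF norm_ge_zero product_le] .

lemma M_summable_on: "M summable_on A"
  using M_summable by (rule summable_on_subset_banach) simp

lemma M_infsum_nonneg: "0 \<le> infsum M A"
  by (rule infsum_nonneg) (rule M_nonneg)

lemma M_infsum_mono: "A \<subseteq> B \<Longrightarrow> infsum M A \<le> infsum M B"
  by (rule infsum_mono2[OF M_summable_on M_summable_on]) (auto simp: M_nonneg)

lemma tail_step: "infsum M {n..} = M n + infsum M {n + 1..}"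
proof -
  have "{n..} = {n} \<union> {n + 1..}" by auto
  then show ?thesis
    using infsum_Un_disjoint[OF M_summable_on M_summable_on, of "{n}" "{n + 1..}"] by simp
qed

text \<open>With \<open>T k\<close> the tail sum from \<open>k\<close>, \<open>M k\<close> equals
  \<open>T k - T (k + 1)\<close>, so \<open>power_Suc_diff_ge\<close> bounds each term by a
  difference of powers of tails and the sum telescopes. The new factor \<open>Suc m\<close>
  completes the factorial.\<close>

lemma tail_power_sum_le:
  assumes "finite F" "F \<subseteq> {n..}"
  shows "(\<Sum>k\<in>F. M k * (infsum M {k + 2..} ^ m / fact m)) \<le> infsum M {n..} ^ Suc m / fact (Suc m)"
proof -
  let ?T = "\<lambda>n. infsum M {n..}"
  have step: "real (Suc m) * (M k * ?T (k + 2) ^ m) \<le> ?T k ^ Suc m - ?T (k + 1) ^ Suc m" for k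
  proof -
    have "real (Suc m) * (M k * ?T (k + 2) ^ m) \<le> real (Suc m) * (M k * ?T (k + 1) ^ m)"
      by (intro mult_left_mono power_mono M_infsum_mono M_infsum_nonneg M_nonneg) auto
    also have "\<dots> \<le> ?T k ^ Suc m - ?T (k + 1) ^ Suc m"
      using power_Suc_diff_ge[of "?T (k + 1)" "?T k" m] tail_step[of k] M_nonneg[of k] M_infsum_nonneg
      by simp
    finally show ?thesis .
  qed
  have tele: "(\<Sum>j<N. real (Suc m) * (M (n + int j) * ?T (n + int j + 2) ^ m))
      \<le> ?T n ^ Suc m - ?T (n + int N) ^ Suc m" for N
  proof (induction N)
    case (Suc N)
    show ?case using Suc.IH step[of "n + int N"] by (simp add: algebra_simps del: power_Suc)
  qed simp
  have F: "F = (\<lambda>j. n + int j) ` ((\<lambda>k. nat (k - n)) ` F)"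
    using assms(2) by (force simp: image_image image_iff)
  obtain N where N: "(\<lambda>k. nat (k - n)) ` F \<subseteq> {..<N}"
    using finite_nat_iff_bounded[of "(\<lambda>k. nat (k - n)) ` F"] assms(1) by auto
  have "(\<Sum>k\<in>F. real (Suc m) * (M k * ?T (k + 2) ^ m))
      = (\<Sum>j\<in>(\<lambda>k. nat (k - n)) ` F. real (Suc m) * (M (n + int j) * ?T (n + int j + 2) ^ m))"
    by (subst F, subst sum.reindex) (auto simp: inj_on_def)
  also have "\<dots> \<le> (\<Sum>j<N. real (Suc m) * (M (n + int j) * ?T (n + int j + 2) ^ m))"
    by (rule sum_mono2[OF _ N]) (auto intro!: mult_nonneg_nonneg M_nonneg M_infsum_nonneg zero_le_power)
  also have "\<dots> \<le> ?T n ^ Suc m"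
    using tele[of N] zero_le_power[OF M_infsum_nonneg[of "{n + int N..}"], of "Suc m"] by linarith
  finally have "(\<Sum>k\<in>F. real (Suc m) * (M k * ?T (k + 2) ^ m)) / fact (Suc m) \<le> ?T n ^ Suc m / fact (Suc m)"
    by (rule divide_right_mono) simp
  also have "(\<Sum>k\<in>F. real (Suc m) * (M k * ?T (k + 2) ^ m)) / fact (Suc m)
      = (\<Sum>k\<in>F. M k * (?T (k + 2) ^ m / fact m))"
    by (simp add: sum_divide_distrib fact_Suc del: of_nat_Suc)
  finally show ?thesis .
qed

text \<open>The ordering of the indices yields the factor \<open>1 / fact m\<close>, so the series
  defining \<open>frakF\<close> is dominated by an exponential series.\<close>

lemma nested_sum_tail_le: "norm (nested_sum x m {n..}) \<le> infsum M {n..} ^ m / fact m"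
proof (induction m arbitrary: n)
  case (Suc m)
  let ?t = "\<lambda>k. x k * x (k + 1) * nested_sum x m {k + 2..}"
  have t: "norm (?t k) \<le> M k * (infsum M {k + 2..} ^ m / fact m)" for k
    unfolding norm_mult[of "_ * _"] by (intro mult_mono product_le Suc.IH M_nonneg norm_ge_zero)
  have fin: "(\<Sum>k\<in>F. norm (?t k)) \<le> infsum M {n..} ^ Suc m / fact (Suc m)"
    if "finite F" "F \<subseteq> {n..}" for F
    by (rule order_trans[OF sum_mono[OF t] tail_power_sum_le[OF that]])
  have abs: "(\<lambda>k. norm (?t k)) summable_on {n..}"
    by (rule nonneg_bdd_above_summable_on) (auto intro!: bdd_aboveI2 fin)
  have "norm (nested_sum x (Suc m) {n..}) \<le> (\<Sum>\<^sub>\<infinity>k\<in>{n..}. norm (?t k))"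
    unfolding nested_sum.simps by (rule norm_infsum_bound[OF abs])
  also have "\<dots> \<le> infsum M {n..} ^ Suc m / fact (Suc m)"
    by (rule infsum_le_finite_sums[OF abs fin])
  finally show ?case .
qed simp

lemma nested_sum_term_le:
  "norm (x k * x (k + 1) * nested_sum x m {k + 2..}) \<le> M k * (Msum ^ m / fact m)"
proof -
  have "infsum M {k + 2..} ^ m / fact m \<le> Msum ^ m / fact m"
    by (intro divide_right_mono power_mono M_infsum_mono M_infsum_nonneg) auto
  then show ?thesis
    unfolding norm_mult[of "_ * _"]
    by (intro mult_mono product_le order_trans[OF nested_sum_tail_le] M_nonneg norm_ge_zero)
qed

lemma nested_sum_terms_summable:
  "(\<lambda>k. x k * x (k + 1) * nested_sum x m {k + 2..}) summable_on A"
proof -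
  have "(\<lambda>k. M k * (Msum ^ m / fact m)) summable_on A"
    by (rule summable_on_cmult_left[OF M_summable_on])
  then have "(\<lambda>k. norm (x k * x (k + 1) * nested_sum x m {k + 2..})) summable_on A"
    by (rule Infinite_Sum.abs_summable_on_comparison_test') (rule nested_sum_term_le)
  then show ?thesis by (rule abs_summable_summable)
qed

lemma nested_sum_Suc_le: "norm (nested_sum x (Suc m) A) \<le> infsum M A * (Msum ^ m / fact m)"
proof -
  have "((\<lambda>k. M k * (Msum ^ m / fact m)) has_sum (infsum M A * (Msum ^ m / fact m))) A"
    by (intro has_sum_cmult_left has_sum_infsum M_summable_on)
  then show ?thesis
    unfolding nested_sum.simps
    by (rule norm_infsum_le[OF has_sum_infsum[OF nested_sum_terms_summable] _ nested_sum_term_le])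
qed

lemma nested_sum_Un:
  "A \<inter> B = {} \<Longrightarrow> nested_sum x (Suc m) (A \<union> B) = nested_sum x (Suc m) A + nested_sum x (Suc m) B"
  unfolding nested_sum.simps by (rule infsum_Un_disjoint[OF nested_sum_terms_summable nested_sum_terms_summable])

lemma exp_bound_sums: "(\<lambda>m. c * (Msum ^ m / fact m)) sums (c * exp Msum)"
  using sums_mult[OF exp_converges[of Msum], of c] by (simp add: divide_inverse mult.commute)

lemma frakF_series_norm_le:
  "norm ((- 1) ^ Suc m * nested_sum x (Suc m) A) \<le> infsum M A * (Msum ^ m / fact m)"
  using nested_sum_Suc_le[of m A] by (simp add: norm_mult norm_power del: nested_sum.simps)

lemma frakF_series_summable: "summable (\<lambda>m. (- 1) ^ Suc m * nested_sum x (Suc m) A)"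
  by (rule summable_comparison_test'[OF sums_summable[OF exp_bound_sums] frakF_series_norm_le])

text \<open>The factor \<open>infsum M A\<close> is what matters: it tends to 0 as \<open>A\<close>
  leaves every finite set, which gives the limits at plus infinity and, applied to the complement of
  a half-line, at minus infinity.\<close>

lemma frakF_on_diff_1_le: "norm (frakF_on A x - 1) \<le> infsum M A * exp Msum"
proof -
  have "norm (\<Sum>m. (- 1) ^ Suc m * nested_sum x (Suc m) A) \<le> (\<Sum>m. infsum M A * (Msum ^ m / fact m))"
    by (rule norm_suminf_le[OF frakF_series_norm_le sums_summable[OF exp_bound_sums]])
  also have "\<dots> = infsum M A * exp Msum"
    by (rule sums_unique[OF exp_bound_sums, symmetric])
  finally show ?thesis
    by (simp add: frakF_on_def del: nested_sum.simps power_Suc)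
qed

lemma frakF_on_le: "norm (frakF_on A x) \<le> 1 + Msum * exp Msum"
proof -
  have "norm (frakF_on A x) \<le> norm (frakF_on A x - 1) + norm (1::complex)"
    using norm_triangle_ineq[of "frakF_on A x - 1" 1] by simp
  also have "\<dots> \<le> Msum * exp Msum + 1"
    by (intro add_mono order_trans[OF frakF_on_diff_1_le] mult_right_mono M_infsum_mono) auto
  finally show ?thesis by simp
qed

lemma frakF_on_Un:
  assumes "A \<inter> B = {}"
  shows "frakF_on (A \<union> B) x = frakF_on A x + (frakF_on B x - 1)"
  unfolding frakF_on_def nested_sum_Un[OF assms]
  by (simp add: distrib_left suminf_add[OF frakF_series_summable frakF_series_summable, symmetric]
      del: nested_sum.simps power_Suc)

text \<open>Fixing the first index at \<open>n\<close> pulls out one product with a minus sign; the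
  remaining sums form the same series from \<open>n + 2\<close>, one order lower.\<close>

lemma frakF_on_singleton: "frakF_on {n} x = 1 - x n * x (n + 1) * frakF_on {n + 2..} x"
proof -
  let ?b = "\<lambda>m. (- 1) ^ m * nested_sum x m {n + 2..}"
  have "summable (\<lambda>m. ?b (Suc m))" by (rule frakF_series_summable)
  then have b: "summable ?b" by (subst (asm) summable_Suc_iff)
  have "suminf ?b = frakF_on {n + 2..} x"
    using suminf_split_head[OF b] by (simp add: frakF_on_def del: nested_sum.simps(2) power_Suc)
  moreover have "(- 1) ^ Suc m * nested_sum x (Suc m) {n} = - (x n * x (n + 1)) * ?b m" for m
    by simp
  ultimately show ?thesis
    using suminf_mult[OF b, of "- (x n * x (n + 1))"] by (simp add: frakF_on_def del: nested_sum.simps power_Suc)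
qed

lemma frakF_on_recurrence:
  "frakF_on {n..} x = frakF_on {n + 1..} x - x n * x (n + 1) * frakF_on {n + 2..} x"
proof -
  have "{n..} = {n + 1..} \<union> {n}" by auto
  then show ?thesis using frakF_on_Un[of "{n + 1..}" "{n}"] by (simp add: frakF_on_singleton)
qed

lemma frakF_on_tail_tendsto: "((\<lambda>n. frakF_on {n..} x) \<longlongrightarrow> 1) at_top"
proof (rule tendstoI)
  fix e :: real assume "0 < e"
  then obtain F where F: "finite F" "\<And>A. A \<inter> F = {} \<Longrightarrow> infsum M A < e / exp Msum"
    using infsum_avoiding_finite_small[OF M_summable M_nonneg, of "e / exp Msum"] by auto
  have "dist (frakF_on {n..} x) 1 < e" if "n > Max (insert 0 F)" for n
  proof -
    have "{n..} \<inter> F = {}" using that F(1) by auto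
    from F(2)[OF this] have "infsum M {n..} * exp Msum < e" by (simp add: pos_less_divide_eq)
    with frakF_on_diff_1_le[of "{n..}"] show ?thesis by (simp add: dist_norm)
  qed
  then show "\<forall>\<^sub>F n in at_top. dist (frakF_on {n..} x) 1 < e"
    by (rule eventually_mono[OF eventually_gt_at_top])
qed

lemma frakF_on_tail_tendsto_UNIV: "((\<lambda>n. frakF_on {n..} x) \<longlongrightarrow> frakF_on UNIV x) at_bot"
proof (rule tendstoI)
  fix e :: real assume "0 < e"
  then obtain F where F: "finite F" "\<And>A. A \<inter> F = {} \<Longrightarrow> infsum M A < e / exp Msum"
    using infsum_avoiding_finite_small[OF M_summable M_nonneg, of "e / exp Msum"] by auto
  have "dist (frakF_on {n..} x) (frakF_on UNIV x) < e" if "n < Min (insert 0 F)" for n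
  proof -
    have "{..<n} \<inter> F = {}" using that F(1) by auto
    from F(2)[OF this] have "infsum M {..<n} * exp Msum < e" by (simp add: pos_less_divide_eq)
    moreover have "{n..} \<union> {..<n} = UNIV" by auto
    then have "frakF_on UNIV x = frakF_on {n..} x + (frakF_on {..<n} x - 1)"
      using frakF_on_Un[of "{n..}" "{..<n}"] by fastforce
    ultimately show ?thesis
      using frakF_on_diff_1_le[of "{..<n}"] by (simp add: dist_norm norm_minus_commute)
  qed
  then show "\<forall>\<^sub>F n in at_bot. dist (frakF_on {n..} x) (frakF_on UNIV x) < e"
    unfolding eventually_at_bot_linorder by (intro exI[of _ "Min (insert 0 F) - 1"]) auto
qed

end

section \<open>Holomorphic dependence of the series on a parameter\<close>

lemma holomorphic_on_openI:
  assumes "\<And>z. z \<in> U \<Longrightarrow> \<exists>r>0. f holomorphic_on ball z r"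
  shows "f holomorphic_on U"
  unfolding holomorphic_on_def
proof
  fix z assume "z \<in> U"
  then obtain r where "0 < r" "f holomorphic_on ball z r" using assms by blast
  then have "f field_differentiable at z"
    by (intro holomorphic_on_imp_differentiable_at[of f "ball z r"]) auto
  then show "f field_differentiable at z within U" by (rule field_differentiable_at_within)
qed

lemma holomorphic_on_infsum:
  fixes f :: "'a \<Rightarrow> complex \<Rightarrow> complex"
  assumes U: "open U" and f: "\<And>k. k \<in> A \<Longrightarrow> f k holomorphic_on U"
    and le: "\<And>k z. k \<in> A \<Longrightarrow> z \<in> U \<Longrightarrow> norm (f k z) \<le> M k" and M: "M summable_on A"
  shows "(\<lambda>z. \<Sum>\<^sub>\<infinity>k\<in>A. f k z) holomorphic_on U"
proof (rule holomorphic_on_openI)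
  fix z assume "z \<in> U"
  then obtain r where r: "0 < r" "cball z r \<subseteq> U" using U by (meson open_contains_cball)
  then have br: "ball z r \<subseteq> U" by (meson ball_subset_cball order_trans)
  have lim: "uniform_limit (cball z r) (\<lambda>F z. \<Sum>k\<in>F. f k z) (\<lambda>z. \<Sum>\<^sub>\<infinity>k\<in>A. f k z) (finite_subsets_at_top A)"
    by (rule Weierstrass_m_test_general[OF le M]) (use r in auto)
  have hol: "\<forall>\<^sub>F F in finite_subsets_at_top A. continuous_on (cball z r) (\<lambda>z. \<Sum>k\<in>F. f k z)
      \<and> (\<lambda>z. \<Sum>k\<in>F. f k z) holomorphic_on ball z r"
  proof (rule eventually_finite_subsets_at_top_weakI)
    fix F assume "finite F" "F \<subseteq> A"
    then have "(\<lambda>z. \<Sum>k\<in>F. f k z) holomorphic_on U" by (intro holomorphic_on_sum f) auto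
    then show "continuous_on (cball z r) (\<lambda>z. \<Sum>k\<in>F. f k z) \<and> (\<lambda>z. \<Sum>k\<in>F. f k z) holomorphic_on ball z r"
      using holomorphic_on_imp_continuous_on continuous_on_subset r(2) holomorphic_on_subset br by blast
  qed
  have "(\<lambda>z. \<Sum>\<^sub>\<infinity>k\<in>A. f k z) holomorphic_on ball z r"
    by (rule holomorphic_uniform_limit[OF hol lim finite_subsets_at_top_neq_bot])
  with r(1) show "\<exists>r>0. (\<lambda>z. \<Sum>\<^sub>\<infinity>k\<in>A. f k z) holomorphic_on ball z r" by blast
qed

lemma nested_sum_holomorphic:
  assumes U: "open U" and hol: "\<And>k. (\<lambda>z. x z k) holomorphic_on U"
    and dom: "\<And>z. z \<in> U \<Longrightarrow> dominated_products (x z) M"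
  shows "(\<lambda>z. nested_sum (x z) m A) holomorphic_on U"
proof (induction m arbitrary: A)
  case (Suc m)
  show ?case
  proof (cases "U = {}")
    case False
    then have M: "M summable_on B" for B
      using dominated_products.M_summable_on[OF dom] by auto
    have "(\<lambda>z. \<Sum>\<^sub>\<infinity>k\<in>A. x z k * x z (k + 1) * nested_sum (x z) m {k + 2..}) holomorphic_on U"
      by (rule holomorphic_on_infsum[OF U _ _ summable_on_cmult_left[OF M]])
        (auto intro!: holomorphic_intros hol Suc.IH dominated_products.nested_sum_term_le[OF dom])
    then show ?thesis by simp
  qed (simp add: holomorphic_on_def)
qed simp

lemma frakF_on_holomorphic:
  assumes U: "open U" and hol: "\<And>k. (\<lambda>z. x z k) holomorphic_on U"
    and dom: "\<And>z. z \<in> U \<Longrightarrow> dominated_products (x z) M"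
  shows "(\<lambda>z. frakF_on A (x z)) holomorphic_on U"
proof (cases "U = {}")
  case False
  then obtain z0 where z0: "z0 \<in> U" by blast
  let ?t = "\<lambda>m z. (- 1) ^ Suc m * nested_sum (x z) (Suc m) A"
  let ?B = "\<lambda>m. infsum M A * (infsum M UNIV ^ m / fact m)"
  note le = dominated_products.frakF_series_norm_le[OF dom]
  have "summable (\<lambda>m. norm (?B m))"
    using sums_summable[OF dominated_products.exp_bound_sums[OF dom[OF z0]], of "infsum M A"]
      dominated_products.M_infsum_nonneg[OF dom[OF z0]] by (simp add: abs_mult)
  then have B: "?B summable_on UNIV" by (rule norm_summable_imp_summable_on)
  have "(\<lambda>z. \<Sum>\<^sub>\<infinity>m. ?t m z) holomorphic_on U"
    by (rule holomorphic_on_infsum[OF U _ le B]) (intro holomorphic_intros nested_sum_holomorphic[OF U hol dom])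
  then have "(\<lambda>z. 1 + (\<Sum>\<^sub>\<infinity>m. ?t m z)) holomorphic_on U" by (intro holomorphic_intros)
  \<comment> \<open>The outer series was treated as an unordered sum so that the M-test for
    \<open>infsum\<close> applies to it too; absolute convergence identifies the two.\<close>
  moreover have "(\<Sum>\<^sub>\<infinity>m. ?t m z) = (\<Sum>m. ?t m z)" if "z \<in> U" for z
  proof (rule infsumI, rule norm_summable_imp_has_sum)
    show "summable (\<lambda>m. norm (?t m z))"
      by (rule summable_comparison_test'[OF sums_summable[OF dominated_products.exp_bound_sums[OF dom[OF that]]]])
        (use le[OF that] in auto)
    show "(\<lambda>m. ?t m z) sums (\<Sum>m. ?t m z)"
      by (rule summable_sums[OF dominated_products.frakF_series_summable[OF dom[OF that]]])
  qed
  ultimately show ?thesis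
    unfolding frakF_on_def by (subst holomorphic_cong[OF refl]) auto
qed (simp add: holomorphic_on_def)

section \<open>Weyl solutions and the Green kernel\<close>

lemma filterlim_minus_int: "filterlim (\<lambda>N. c - int N) at_bot sequentially"
  unfolding filterlim_at_bot eventually_sequentially
proof
  show "\<exists>N. \<forall>n\<ge>N. c - int n \<le> Z" for Z by (intro exI[of _ "nat (c - Z)"]) auto
qed

lemma filterlim_plus_int: "filterlim (\<lambda>N. int N + c) at_top sequentially"
  unfolding filterlim_at_top eventually_sequentially
proof
  show "\<exists>N. \<forall>n\<ge>N. Z \<le> int n + c" for Z by (intro exI[of _ "nat (Z - c)"]) auto
qed

lemma open_C0: "open (C0 lam)"
  by (simp add: C0_def open_Compl)

lemma C0_not_lam: "z \<in> C0 lam \<Longrightarrow> z \<noteq> lam n"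
  using closure_subset[of "range lam"] by (auto simp: C0_def)

lemma calP_step:
  assumes w: "\<And>n. w n \<noteq> 0" and z: "z \<noteq> lam n"
  shows "calP lam w n z = calP lam w (n - 1) z * (w (n - 1) / (z - lam n))"
proof (cases "1 \<le> n")
  case True
  then have "{1..n} = insert n {1..n - 1}" by auto
  then show ?thesis using True by (simp add: calP_def mult.commute)
next
  case False
  then have "{n..0} = insert n {n + 1..0}" by auto
  \<comment> \<open>At \<open>n = 0\<close> the definition takes its first branch; both products are
    empty there, so the second formula holds as well.\<close>
  moreover have "calP lam w n z = (\<Prod>k = n + 1..0. (z - lam k) / w (k - 1))"
    using False by (cases "n = 0") (auto simp: calP_def)
  ultimately show ?thesis using False w[of "n - 1"] z by (simp add: calP_def)
qed

lemma calP_0 [simp]: "calP lam w 0 z = 1"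
  by (simp add: calP_def)

text \<open>Reflection sends the edge joining \<open>n\<close> and \<open>n + 1\<close> to the one
  joining \<open>- n - 1\<close> and \<open>- n\<close>, whence the shift in the reflected
  weights.\<close>

lemma formal_solution_reflect:
  assumes "formal_solution (\<lambda>n. lam (- n)) (\<lambda>n. w (- n - 1)) z x"
  shows "formal_solution lam w z (\<lambda>n. x (- n))"
  unfolding formal_solution_def
proof
  fix n
  show "jacobi lam w (\<lambda>n. x (- n)) n = z * x (- n)"
    using assms[unfolded formal_solution_def, rule_format, of "- n"]
    by (simp add: jacobi_def add.commute add.left_commute minus_diff_commute)
qed

text \<open>These assumptions are stable under reflection of the index (see
  \<open>reflected\<close>), so the solution decaying at minus infinity is an instance of the
  construction at plus infinity.\<close>

locale jacobi_data =
  fixes lam w \<gamma> :: "int \<Rightarrow> complex"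
  assumes w_nonzero: "\<And>n. w n \<noteq> 0"
    and gamma: "\<And>n. \<gamma> n * \<gamma> (n + 1) = w n"
    and summability: "\<exists>z0\<in>C0 lam.
      (\<lambda>n. norm ((w n)\<^sup>2 / ((lam n - z0) * (lam (n + 1) - z0)))) summable_on UNIV"
begin

lemma reflected: "jacobi_data (\<lambda>n. lam (- n)) (\<lambda>n. w (- n - 1)) (\<lambda>n. \<gamma> (- n))"
proof
  show "w (- n - 1) \<noteq> 0" for n by (rule w_nonzero)
  show "\<gamma> (- n) * \<gamma> (- (n + 1)) = w (- n - 1)" for n
    using gamma[of "- n - 1"] by (simp add: mult.commute)
  obtain z0 where z0: "z0 \<in> C0 lam"
    "(\<lambda>n. norm ((w n)\<^sup>2 / ((lam n - z0) * (lam (n + 1) - z0)))) summable_on UNIV"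
    using summability by blast
  have "bij (\<lambda>n::int. - n - 1)" by (rule bij_betw_byWitness[of _ "\<lambda>n. - n - 1"]) auto
  from summable_on_reindex_bij_betw[OF this, THEN iffD2, OF z0(2)]
  have "(\<lambda>n. norm ((w (- n - 1))\<^sup>2 / ((lam (- n) - z0) * (lam (- (n + 1)) - z0)))) summable_on UNIV"
    by (simp add: mult.commute)
  moreover have "range (\<lambda>n. lam (- n)) = range lam"
    by (auto simp: image_iff) (metis minus_minus)
  then have "z0 \<in> C0 (\<lambda>n. lam (- n))" using z0(1) by (simp add: C0_def)
  ultimately show "\<exists>z0\<in>C0 (\<lambda>n. lam (- n)).
      (\<lambda>n. norm ((w (- n - 1))\<^sup>2 / ((lam (- n) - z0) * (lam (- (n + 1)) - z0)))) summable_on UNIV"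
    by blast
qed

lemma C0_reflected: "C0 (\<lambda>n. lam (- n)) = C0 lam"
proof -
  have "range (\<lambda>n. lam (- n)) = range lam"
    by (auto simp: image_iff) (metis minus_minus)
  then show ?thesis by (simp add: C0_def)
qed

definition quot :: "complex \<Rightarrow> int \<Rightarrow> complex" where
  "quot z n = (\<gamma> n)\<^sup>2 / (lam n - z)"

lemma quot_product: "quot z k * quot z (k + 1) = (w k)\<^sup>2 / ((lam k - z) * (lam (k + 1) - z))"
  unfolding quot_def gamma[symmetric] by (simp add: power_mult_distrib)

lemma char_fun_eq: "char_fun lam \<gamma> z = frakF_on UNIV (quot z)"
  unfolding char_fun_def frakF_eq[symmetric]
proof (rule frakF_cong)
  fix k
  have "quot z n = - ((\<gamma> n)\<^sup>2 / (z - lam n))" for n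
    by (simp add: quot_def minus_divide_right)
  then show "(\<gamma> k)\<^sup>2 / (z - lam k) * ((\<gamma> (k + 1))\<^sup>2 / (z - lam (k + 1))) = quot z k * quot z (k + 1)"
    by simp
qed

text \<open>Summability at \<open>z0\<close> is transported to a whole disc: moving the parameter
  changes every \<open>lam k - z0\<close> by a factor bounded uniformly in \<open>k\<close>.\<close>

lemma local_domination:
  assumes "\<zeta> \<in> C0 lam"
  obtains r d M where "0 < r" "0 < d" "cball \<zeta> r \<subseteq> C0 lam"
    "\<And>z k. z \<in> cball \<zeta> r \<Longrightarrow> d \<le> norm (z - lam k)"
    "\<And>z. z \<in> cball \<zeta> r \<Longrightarrow> dominated_products (quot z) M"
proof -
  obtain z0 where z0: "z0 \<in> C0 lam"
    "(\<lambda>n. norm ((w n)\<^sup>2 / ((lam n - z0) * (lam (n + 1) - z0)))) summable_on UNIV"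
    using summability by blast
  obtain e where e: "0 < e" "cball \<zeta> e \<subseteq> C0 lam"
    using open_C0 assms by (meson open_contains_cball)
  \<comment> \<open>Halving leaves every diagonal entry at distance at least \<open>r\<close> from
    each point of the smaller disc.\<close>
  define r where "r = e / 2"
  \<comment> \<open>By the triangle inequality \<open>lam k - z0\<close> exceeds
    \<open>lam k - z\<close> in modulus by at most \<open>norm (\<zeta> - z0) + r\<close>, and
    \<open>r\<close> is at most the modulus of \<open>lam k - z\<close>. Two such factors give
    \<open>K\<close> squared in \<open>M\<close>.\<close>
  define K where "K = 1 + (norm (\<zeta> - z0) + r) / r"
  define M where "M n = K\<^sup>2 * norm ((w n)\<^sup>2 / ((lam n - z0) * (lam (n + 1) - z0)))" for n
  have r: "0 < r" using e by (simp add: r_def)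
  have far: "r \<le> norm (z - lam k)" if "z \<in> cball \<zeta> r" for z k
  proof -
    have "lam k \<notin> cball \<zeta> e" using e(2) C0_not_lam[of "lam k" lam k] by blast
    then have "2 * r < dist \<zeta> (lam k)" by (simp add: r_def)
    also have "\<dots> \<le> dist \<zeta> z + dist z (lam k)" by (rule dist_triangle)
    finally show ?thesis using that by (simp add: dist_norm)
  qed
  have K: "norm (lam k - z0) \<le> K * norm (lam k - z)" if "z \<in> cball \<zeta> r" for z k
  proof -
    have "norm (lam k - z0) \<le> norm (lam k - z) + norm (z - z0)"
      using norm_triangle_ineq[of "lam k - z" "z - z0"] by simp
    also have "norm (z - z0) \<le> norm (\<zeta> - z0) + r"
      using norm_triangle_ineq[of "z - \<zeta>" "\<zeta> - z0"] that by (simp add: dist_norm norm_minus_commute)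
    also have "\<dots> = (norm (\<zeta> - z0) + r) / r * r" using r by simp
    also have "\<dots> \<le> (norm (\<zeta> - z0) + r) / r * norm (lam k - z)"
      using far[OF that, of k] r by (intro mult_left_mono) (auto simp: norm_minus_commute)
    finally show ?thesis by (simp add: K_def distrib_right)
  qed
  have "dominated_products (quot z) M" if z: "z \<in> cball \<zeta> r" for z
  proof
    show "M summable_on UNIV" unfolding M_def by (rule summable_on_cmult_right[OF z0(2)])
    fix k
    have pos: "0 < norm (lam n - z)" "0 < norm (lam n - z0)" for n
      using far[OF z, of n] r C0_not_lam[OF z0(1), of n] by (auto simp: norm_minus_commute)
    have K0: "0 < K" using r by (simp add: K_def add_pos_nonneg)
    have "norm (lam k - z0) * norm (lam (k + 1) - z0)
        \<le> (K * norm (lam k - z)) * (K * norm (lam (k + 1) - z))"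
      by (intro mult_mono K z) (use K0 in auto)
    then have "1 / (norm (lam k - z) * norm (lam (k + 1) - z))
        \<le> K\<^sup>2 / (norm (lam k - z0) * norm (lam (k + 1) - z0))"
      using pos[of k] pos[of "k + 1"] by (simp add: divide_le_eq le_divide_eq power2_eq_square mult_ac)
    from mult_left_mono[OF this zero_le_power2[of "norm (w k)"]]
    show "norm (quot z k * quot z (k + 1)) \<le> M k"
      unfolding quot_product M_def norm_divide norm_mult norm_power
      by (simp add: mult.commute[of "K\<^sup>2"])
  qed
  moreover have "cball \<zeta> r \<subseteq> C0 lam" using e by (auto simp: r_def)
  ultimately show thesis using that[OF r r _ far] by blast
qed

lemma dominated:
  assumes "z \<in> C0 lam"
  obtains M where "dominated_products (quot z) M"
  using local_domination[OF assms] by (metis centre_in_cball less_imp_le)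

lemma frakF_on_quot_holomorphic: "(\<lambda>z. frakF_on A (quot z)) holomorphic_on C0 lam"
proof (rule holomorphic_on_openI)
  fix z assume "z \<in> C0 lam"
  then obtain r M where r: "0 < r" "cball z r \<subseteq> C0 lam"
    and M: "\<And>\<xi>. \<xi> \<in> cball z r \<Longrightarrow> dominated_products (quot \<xi>) M"
    using local_domination by metis
  have "(\<lambda>\<xi>. frakF_on A (quot \<xi>)) holomorphic_on ball z r"
  proof (rule frakF_on_holomorphic)
    have "lam k - \<xi> \<noteq> 0" if "\<xi> \<in> ball z r" for \<xi> k
      using that r(2) C0_not_lam[of \<xi> lam k] by (auto simp: subset_iff)
    then show "(\<lambda>\<xi>. quot \<xi> k) holomorphic_on ball z r" for k
      unfolding quot_def by (intro holomorphic_intros)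
    show "dominated_products (quot \<xi>) M" if "\<xi> \<in> ball z r" for \<xi>
      using that by (intro M) auto
  qed simp
  with r show "\<exists>r>0. (\<lambda>\<xi>. frakF_on A (quot \<xi>)) holomorphic_on ball z r" by blast
qed

lemma char_fun_holomorphic: "char_fun lam \<gamma> holomorphic_on C0 lam"
  using frakF_on_quot_holomorphic[of UNIV] by (simp add: char_fun_eq[abs_def])

lemma f_sol_eq: "f_sol lam w \<gamma> n z = calP lam w n z * frakF_on {n + 1..} (quot z)"
  by (simp add: f_sol_def frakF_from_eq quot_def[abs_def])

lemma f_sol_holomorphic: "f_sol lam w \<gamma> n holomorphic_on C0 lam"
proof -
  have "calP lam w n holomorphic_on C0 lam"
    unfolding calP_def[abs_def] using w_nonzero C0_not_lam[of _ lam]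
    by (cases "0 \<le> n") (auto intro!: holomorphic_intros)
  then show ?thesis
    unfolding f_sol_eq[abs_def] by (intro holomorphic_intros frakF_on_quot_holomorphic)
qed

text \<open>After the factor \<open>(z - lam n) * calP lam w n z\<close> is taken out of the
  off-diagonal terms, the equation is the three-term recurrence of the tails of
  \<open>frakF\<close>.\<close>

lemma f_sol_formal_solution:
  assumes z: "z \<in> C0 lam"
  shows "formal_solution lam w z (\<lambda>n. f_sol lam w \<gamma> n z)"
  unfolding formal_solution_def
proof
  fix n
  obtain M where "dominated_products (quot z) M" using dominated[OF z] .
  then interpret dominated_products "quot z" M .
  let ?P = "\<lambda>n. calP lam w n z" and ?F = "\<lambda>n. frakF_on {n..} (quot z)"
  have nz: "z - lam n \<noteq> 0" for n using C0_not_lam[OF z] by simp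
  have 1: "w (n - 1) * ?P (n - 1) = (z - lam n) * ?P n"
    using calP_step[OF w_nonzero, of z lam n] nz[of n] by (simp add: field_simps)
  have "w n * ?P (n + 1) = (w n)\<^sup>2 / (z - lam (n + 1)) * ?P n"
    using calP_step[OF w_nonzero, of z lam "n + 1"] nz[of "n + 1"] by (simp add: power2_eq_square)
  also have "\<dots> = (z - lam n) * (quot z n * quot z (n + 1)) * ?P n"
    unfolding quot_product using nz[of n] nz[of "n + 1"]
    by (simp add: divide_simps) (simp add: algebra_simps)
  finally have 2: "w n * ?P (n + 1) = (z - lam n) * (quot z n * quot z (n + 1)) * ?P n" .
  have F: "?F n + quot z n * quot z (n + 1) * ?F (n + 2) = ?F (n + 1)"
    using frakF_on_recurrence[of n] by simp
  have "jacobi lam w (\<lambda>n. f_sol lam w \<gamma> n z) n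
      = (w (n - 1) * ?P (n - 1)) * ?F n + lam n * ?P n * ?F (n + 1) + (w n * ?P (n + 1)) * ?F (n + 2)"
    by (simp add: jacobi_def f_sol_eq algebra_simps)
  also have "\<dots> = (z - lam n) * ?P n * (?F n + quot z n * quot z (n + 1) * ?F (n + 2)) + lam n * ?P n * ?F (n + 1)"
    unfolding 1 2 by (simp add: algebra_simps)
  also have "\<dots> = z * f_sol lam w \<gamma> n z"
    unfolding F by (simp add: f_sol_eq algebra_simps)
  finally show "jacobi lam w (\<lambda>n. f_sol lam w \<gamma> n z) n = z * f_sol lam w \<gamma> n z" .
qed

text \<open>The prefactor has no zeros and the tails tend to 1. This holds at zeros of
  \<open>char_fun\<close> too, where it makes \<open>f\<close> an eigenvector rather than the zero
  sequence.\<close>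

lemma f_sol_nonzero:
  assumes z: "z \<in> C0 lam"
  shows "\<exists>n. f_sol lam w \<gamma> n z \<noteq> 0"
proof -
  obtain M where "dominated_products (quot z) M" using dominated[OF z] .
  then interpret dominated_products "quot z" M .
  have "\<forall>\<^sub>F n in at_top. frakF_on {n..} (quot z) \<noteq> 0"
    using tendsto_imp_eventually_ne[OF frakF_on_tail_tendsto] by simp
  then obtain N where N: "\<And>n. n \<ge> N \<Longrightarrow> frakF_on {n..} (quot z) \<noteq> 0"
    unfolding eventually_at_top_linorder by blast
  have "calP lam w n z \<noteq> 0" for n
    using w_nonzero C0_not_lam[OF z] by (simp add: calP_def)
  then show ?thesis using N[of "N + 1"] by (intro exI[of _ N]) (simp add: f_sol_eq)
qed

definition g_sol :: "int \<Rightarrow> complex \<Rightarrow> complex" where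
  "g_sol n = f_sol (\<lambda>n. lam (- n)) (\<lambda>n. w (- n - 1)) (\<lambda>n. \<gamma> (- n)) (- n)"

lemma g_sol_holomorphic: "g_sol n holomorphic_on C0 lam"
  using jacobi_data.f_sol_holomorphic[OF reflected] by (simp add: g_sol_def C0_reflected)

lemma g_sol_formal_solution:
  "z \<in> C0 lam \<Longrightarrow> formal_solution lam w z (\<lambda>n. g_sol n z)"
  unfolding g_sol_def using jacobi_data.f_sol_formal_solution[OF reflected, unfolded C0_reflected]
  by (rule formal_solution_reflect)

lemma g_sol_nonzero: "z \<in> C0 lam \<Longrightarrow> \<exists>n. g_sol n z \<noteq> 0"
  using jacobi_data.f_sol_nonzero[OF reflected, unfolded C0_reflected]
  unfolding g_sol_def by (metis minus_minus)

abbreviation calQ :: "int \<Rightarrow> complex \<Rightarrow> complex" where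
  "calQ n z \<equiv> calP (\<lambda>n. lam (- n)) (\<lambda>n. w (- n - 1)) (- n) z"

lemma calQ_step:
  assumes "z \<in> C0 lam"
  shows "calQ n z = calQ (n + 1) z * (w n / (z - lam n))"
  using calP_step[of "\<lambda>n. w (- n - 1)" z "\<lambda>n. lam (- n)" "- n"] w_nonzero C0_not_lam[OF assms] by simp

text \<open>Passing from \<open>n\<close> to \<open>n + 1\<close> multiplies \<open>calP\<close> by
  \<open>w n / (z - lam (n + 1))\<close> and divides \<open>calQ\<close> by
  \<open>w n / (z - lam n)\<close>, so the left side does not depend on \<open>n\<close>; both
  prefactors are 1 at \<open>n = 0\<close>.\<close>

lemma calP_calQ:
  assumes z: "z \<in> C0 lam"
  shows "(z - lam n) * (calP lam w n z * calQ n z) = z - lam 0"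
proof -
  have step: "(z - lam (n + 1)) * (calP lam w (n + 1) z * calQ (n + 1) z)
      = (z - lam n) * (calP lam w n z * calQ n z)" for n
    using calP_step[OF w_nonzero, of z lam "n + 1"] calQ_step[OF z, of n]
      C0_not_lam[OF z, of n] C0_not_lam[OF z, of "n + 1"]
    by simp
  show ?thesis
  proof (induction n rule: int_induct[where k=0])
    case (step1 i) then show ?case using step[of i] by simp
  next
    case (step2 i) then show ?case using step[of "i - 1"] by simp
  qed simp
qed

text \<open>The Wronskian is constant, so it may be computed as \<open>n\<close> tends to minus
  infinity. There the tails for \<open>f\<close> tend to the full function, those for
  \<open>g\<close> tend to 1, and the cross term, a difference of successive tails,
  disappears.\<close>

lemma wronskian_f_g:
  assumes z: "z \<in> C0 lam"
  shows "wronskian w (\<lambda>n. f_sol lam w \<gamma> n z) (\<lambda>n. g_sol n z) m = (z - lam 0) * char_fun lam \<gamma> z"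
proof -
  interpret R: jacobi_data "\<lambda>n. lam (- n)" "\<lambda>n. w (- n - 1)" "\<lambda>n. \<gamma> (- n)" by (rule reflected)
  obtain M where "dominated_products (quot z) M" using dominated[OF z] .
  then interpret dominated_products "quot z" M .
  obtain M' where "dominated_products (R.quot z) M'" using R.dominated z C0_reflected by blast
  then interpret R: dominated_products "R.quot z" M' .
  let ?P = "\<lambda>n. calP lam w n z" and ?Q = "\<lambda>n. calQ n z"
  let ?F = "\<lambda>n. frakF_on {n..} (quot z)" and ?G = "\<lambda>n. frakF_on {n..} (R.quot z)"
  let ?W = "\<lambda>n. (z - lam 0) * (?F (n + 1) * ?G (- n) - (?F (n + 1) - ?F n) * ?G (- n + 1))"
  have nz: "z - lam n \<noteq> 0" for n using C0_not_lam[OF z] by simp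
  have W: "wronskian w (\<lambda>n. f_sol lam w \<gamma> n z) (\<lambda>n. g_sol n z) n = ?W n" for n
  proof -
    have "w n * (?P n * ?Q (n + 1)) = (z - lam n) * (?P n * ?Q n)"
      using calQ_step[OF z, of n] nz[of n] by simp
    then have 1: "w n * (?P n * ?Q (n + 1)) = z - lam 0" by (simp add: calP_calQ[OF z])
    have "w n * (?P (n + 1) * ?Q n) = (w n)\<^sup>2 / (z - lam (n + 1)) * (?P n * ?Q n)"
      using calP_step[OF w_nonzero, of z lam "n + 1"] nz[of "n + 1"] by (simp add: power2_eq_square)
    also have "\<dots> = (quot z n * quot z (n + 1)) * ((z - lam n) * (?P n * ?Q n))"
      unfolding quot_product using nz[of n] nz[of "n + 1"]
      by (simp add: divide_simps) (simp add: algebra_simps)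
    finally have 2: "w n * (?P (n + 1) * ?Q n) = (quot z n * quot z (n + 1)) * (z - lam 0)"
      by (simp add: calP_calQ[OF z])
    have F: "quot z n * quot z (n + 1) * ?F (n + 2) = ?F (n + 1) - ?F n"
      using frakF_on_recurrence[of n] by simp
    have "wronskian w (\<lambda>n. f_sol lam w \<gamma> n z) (\<lambda>n. g_sol n z) n
        = (w n * (?P n * ?Q (n + 1))) * (?F (n + 1) * ?G (- n)) - (w n * (?P (n + 1) * ?Q n)) * ?F (n + 2) * ?G (- n + 1)"
      by (simp add: wronskian_def g_sol_def f_sol_eq R.f_sol_eq algebra_simps)
    also have "\<dots> = (z - lam 0) * (?F (n + 1) * ?G (- n) - (quot z n * quot z (n + 1) * ?F (n + 2)) * ?G (- n + 1))"
      unfolding 1 2 by (simp add: algebra_simps)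
    finally show ?thesis unfolding F .
  qed
  have lims: "(\<lambda>N. ?F (0 - int N + 1)) \<longlonglongrightarrow> frakF_on UNIV (quot z)"
    "(\<lambda>N. ?F (0 - int N)) \<longlonglongrightarrow> frakF_on UNIV (quot z)"
    "(\<lambda>N. ?G (- (0 - int N))) \<longlonglongrightarrow> 1" "(\<lambda>N. ?G (- (0 - int N) + 1)) \<longlonglongrightarrow> 1"
    using filterlim_compose[OF frakF_on_tail_tendsto_UNIV filterlim_minus_int[of 1]]
      filterlim_compose[OF frakF_on_tail_tendsto_UNIV filterlim_minus_int[of 0]]
      filterlim_compose[OF R.frakF_on_tail_tendsto filterlim_plus_int[of 0]]
      filterlim_compose[OF R.frakF_on_tail_tendsto filterlim_plus_int[of 1]]
    by (simp_all add: algebra_simps)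
  have "(\<lambda>N. ?W (0 - int N)) \<longlonglongrightarrow> (z - lam 0) * (frakF_on UNIV (quot z) * 1
      - (frakF_on UNIV (quot z) - frakF_on UNIV (quot z)) * 1)"
    by (intro tendsto_intros lims)
  moreover have "?W (0 - int N) = wronskian w (\<lambda>n. f_sol lam w \<gamma> n z) (\<lambda>n. g_sol n z) m" for N
    unfolding W[symmetric] by (rule wronskian_const[OF f_sol_formal_solution[OF z] g_sol_formal_solution[OF z]])
  ultimately show ?thesis by (simp add: char_fun_eq LIMSEQ_const_iff)
qed

text \<open>Squaring pairs each \<open>w\<close> with both neighbouring denominators, so only the
  products dominated by a summable majorant remain. The boundary denominators on the left are
  bounded below on discs.\<close>

lemma calP_calQ_square:
  assumes z: "z \<in> C0 lam"
  shows "(norm (calP lam w (m + int N) z * calQ m z))\<^sup>2 * (norm (z - lam m) * norm (z - lam (m + int N)))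
    = (norm (z - lam 0))\<^sup>2 * (\<Prod>j<N. norm (quot z (m + int j) * quot z (m + int j + 1)))"
proof (induction N)
  case 0
  show ?case unfolding calP_calQ[OF z, of m, symmetric]
    by (simp add: norm_mult power2_eq_square)
next
  case (Suc N)
  let ?n = "m + int N"
  have nz: "norm (z - lam n) \<noteq> 0" for n using C0_not_lam[OF z] by simp
  have P: "calP lam w (?n + 1) z = calP lam w ?n z * (w ?n / (z - lam (?n + 1)))"
    using calP_step[OF w_nonzero, of z lam "?n + 1"] C0_not_lam[OF z] by simp
  have c: "norm (quot z ?n * quot z (?n + 1)) = (norm (w ?n))\<^sup>2 / (norm (z - lam ?n) * norm (z - lam (?n + 1)))"
    by (simp add: quot_product norm_divide norm_mult norm_power norm_minus_commute)
  have "(norm (calP lam w (?n + 1) z * calQ m z))\<^sup>2 * (norm (z - lam m) * norm (z - lam (?n + 1)))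
      = (norm (calP lam w ?n z * calQ m z))\<^sup>2 * (norm (z - lam m) * norm (z - lam ?n))
        * ((norm (w ?n))\<^sup>2 / (norm (z - lam ?n) * norm (z - lam (?n + 1))))"
    unfolding P norm_mult norm_divide using nz[of ?n] nz[of "?n + 1"]
    by (simp add: power_mult_distrib power_divide power2_eq_square)
  then show ?case unfolding Suc.IH c[symmetric] by (simp add: algebra_simps)
qed

end

text \<open>The bound \<open>t \<le> exp t\<close> turns summability of the factors into geometric decay of
  their products at any prescribed rate.\<close>

lemma (in dominated_products) product_decay:
  "(\<Prod>j<N. norm (x (m + int j) * x (m + int j + 1))) \<le> exp (4 * Msum) * (1/4) ^ N"
proof -
  have "(\<Prod>j<N. norm (x (m + int j) * x (m + int j + 1))) \<le> (\<Prod>j<N. (1/4) * exp (4 * M (m + int j)))"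
  proof (rule prod_mono)
    fix j
    have "4 * M (m + int j) \<le> exp (4 * M (m + int j))"
      using exp_ge_add_one_self[of "4 * M (m + int j)"] by linarith
    then show "0 \<le> norm (x (m + int j) * x (m + int j + 1)) \<and>
        norm (x (m + int j) * x (m + int j + 1)) \<le> (1/4) * exp (4 * M (m + int j))"
      using product_le[of "m + int j"] by simp
  qed
  also have "\<dots> = (1/4) ^ N * exp (4 * (\<Sum>j<N. M (m + int j)))"
    by (simp only: prod.distrib prod_constant card_lessThan sum_distrib_left exp_sum finite_lessThan)
  also have "(\<Sum>j<N. M (m + int j)) = (\<Sum>k\<in>(\<lambda>j. m + int j) ` {..<N}. M k)"
    by (subst sum.reindex) (auto simp: inj_on_def)
  also have "(1/4) ^ N * exp (4 * \<dots>) \<le> (1/4) ^ N * exp (4 * Msum)"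
    using finite_sum_le_infsum[OF M_summable, of "(\<lambda>j. m + int j) ` {..<N}"] M_nonneg by simp
  finally show ?thesis by (simp add: mult.commute)
qed

section \<open>Uniform decay of the two solutions and the Green kernel\<close>

context jacobi_data
begin

text \<open>Only the product with \<open>m \<le> n\<close> can be expected to decay, since
  \<open>f\<close> may grow to the left and \<open>g\<close> to the right. One constant serves the
  whole disc; the resolvent bound and the Cauchy estimates rely on that.\<close>

lemma local_decay:
  assumes "\<zeta> \<in> C0 lam"
  obtains r C where "0 < r" "0 < C" "cball \<zeta> r \<subseteq> C0 lam"
    "\<And>z n m. z \<in> cball \<zeta> r \<Longrightarrow> m \<le> n \<Longrightarrow> norm (f_sol lam w \<gamma> n z * g_sol m z) \<le> C * (1/2) ^ nat (n - m)"
    "\<And>z n. z \<in> cball \<zeta> r \<Longrightarrow> 0 \<le> n \<Longrightarrow> norm (f_sol lam w \<gamma> n z) \<le> C * (1/2) ^ nat n"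
    "\<And>z n. z \<in> cball \<zeta> r \<Longrightarrow> n \<le> 0 \<Longrightarrow> norm (g_sol n z) \<le> C * (1/2) ^ nat (- n)"
proof -
  interpret R: jacobi_data "\<lambda>n. lam (- n)" "\<lambda>n. w (- n - 1)" "\<lambda>n. \<gamma> (- n)" by (rule reflected)
  obtain r1 d M where 1: "0 < r1" "0 < d" "cball \<zeta> r1 \<subseteq> C0 lam"
    "\<And>z k. z \<in> cball \<zeta> r1 \<Longrightarrow> d \<le> norm (z - lam k)"
    "\<And>z. z \<in> cball \<zeta> r1 \<Longrightarrow> dominated_products (quot z) M"
    using local_domination[OF assms] by metis
  obtain r2 M' where 2: "0 < r2" "\<And>z. z \<in> cball \<zeta> r2 \<Longrightarrow> dominated_products (R.quot z) M'"
    using R.local_domination[unfolded C0_reflected, OF assms] by metis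
  define r where "r = min r1 r2"
  define S S' where "S = infsum M UNIV" and "S' = infsum M' UNIV"
  \<comment> \<open>\<open>exp (2 * S)\<close> and the rate 1/2 are the square roots of the constant
    and the rate in \<open>product_decay\<close>; the quotient bounds \<open>z - lam 0\<close> from
    above and the two boundary denominators from below by \<open>d\<close>.\<close>
  define B where "B = (norm (\<zeta> - lam 0) + r) / d * exp (2 * S)"
  define K K' where "K = 1 + S * exp S" and "K' = 1 + S' * exp S'"
  have r: "0 < r" using 1 2 by (simp add: r_def)
  have dom: "dominated_products (quot z) M" "dominated_products (R.quot z) M'"
    "\<And>k. d \<le> norm (z - lam k)" "z \<in> C0 lam" if "z \<in> cball \<zeta> r" for z
    using that 1(3) by (auto simp: r_def intro!: 1(4,5) 2(2))
  have zeta: "\<zeta> \<in> cball \<zeta> r" using r by simp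
  have "0 \<le> S" "0 \<le> S'"
    unfolding S_def S'_def using dominated_products.M_infsum_nonneg[OF dom(1)[OF zeta]]
      dominated_products.M_infsum_nonneg[OF dom(2)[OF zeta]] by auto
  then have K: "1 \<le> K" "1 \<le> K'" by (auto simp: K_def K'_def)
  have B0: "0 < B" using r 1(2) by (simp add: B_def add_nonneg_pos)
  have PQ: "norm (calP lam w n z * calQ m z) \<le> B * (1/2) ^ nat (n - m)" if z: "z \<in> cball \<zeta> r" and "m \<le> n" for z n m
  proof -
    interpret dominated_products "quot z" M by (rule dom(1)[OF z])
    define N where "N = nat (n - m)"
    have n: "n = m + int N" using that by (simp add: N_def)
    have "(norm (calP lam w n z * calQ m z))\<^sup>2 * (d * d)
        \<le> (norm (calP lam w n z * calQ m z))\<^sup>2 * (norm (z - lam m) * norm (z - lam n))"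
      by (intro mult_left_mono mult_mono dom(3)[OF z]) (use 1(2) in auto)
    also have "\<dots> \<le> (norm (z - lam 0))\<^sup>2 * (exp (4 * S) * (1/4) ^ N)"
      unfolding n calP_calQ_square[OF dom(4)[OF z]] S_def by (intro mult_left_mono product_decay) simp
    also have "\<dots> \<le> (norm (\<zeta> - lam 0) + r)\<^sup>2 * (exp (4 * S) * (1/4) ^ N)"
    proof (intro mult_right_mono power_mono)
      show "norm (z - lam 0) \<le> norm (\<zeta> - lam 0) + r"
        using norm_triangle_ineq[of "z - \<zeta>" "\<zeta> - lam 0"] z by (simp add: dist_norm norm_minus_commute)
    qed auto
    also have "\<dots> = (B * (1/2) ^ N)\<^sup>2 * (d * d)"
    proof -
      have "exp (4 * S) = (exp (2 * S))\<^sup>2" by (simp add: power2_eq_square flip: exp_add)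
      moreover have "(1/4::real) ^ N = ((1/2) ^ N)\<^sup>2" by (simp add: power2_eq_square flip: power_mult_distrib)
      ultimately show ?thesis
        using 1(2) by (simp add: B_def power_mult_distrib power_divide) (simp add: power2_eq_square)
    qed
    finally have "(norm (calP lam w n z * calQ m z))\<^sup>2 \<le> (B * (1/2) ^ N)\<^sup>2"
      using 1(2) by (simp add: mult_le_cancel_right)
    then show ?thesis
      unfolding N_def[symmetric] by (rule power2_le_imp_le) (use B0 in auto)
  qed
  have F: "norm (frakF_on {n..} (quot z)) \<le> K" "norm (frakF_on {n..} (R.quot z)) \<le> K'" if "z \<in> cball \<zeta> r" for z n
    using dominated_products.frakF_on_le[OF dom(1)[OF that]] dominated_products.frakF_on_le[OF dom(2)[OF that]]
    by (auto simp: K_def K'_def S_def S'_def)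
  have p0: "0 \<le> B * (1/2) ^ k" for k using B0 by simp
  show thesis
  proof (rule that[of r "B * (K * K')"])
    show "0 < r" "0 < B * (K * K')" "cball \<zeta> r \<subseteq> C0 lam"
      using r B0 K dom(4) by (auto simp: subset_iff)
  next
    fix z n m assume z: "z \<in> cball \<zeta> r" and "m \<le> (n :: int)"
    have "f_sol lam w \<gamma> n z * g_sol m z
        = (calP lam w n z * calQ m z) * (frakF_on {n + 1..} (quot z) * frakF_on {- m + 1..} (R.quot z))"
      by (simp add: f_sol_eq g_sol_def R.f_sol_eq)
    moreover have "norm \<dots> \<le> (B * (1/2) ^ nat (n - m)) * (K * K')"
      unfolding norm_mult[of "_ * _" "_ * _"] norm_mult[of "frakF_on _ _"]
      by (intro mult_mono PQ F z \<open>m \<le> n\<close> p0 norm_ge_zero mult_nonneg_nonneg) (use K in auto)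
    ultimately show "norm (f_sol lam w \<gamma> n z * g_sol m z) \<le> B * (K * K') * (1/2) ^ nat (n - m)"
      by (simp add: mult_ac)
  next
    fix z and n :: int assume z: "z \<in> cball \<zeta> r" and "0 \<le> n"
    \<comment> \<open>\<open>PQ\<close> with second index 0, where \<open>calQ\<close> equals 1; the
      bound for \<open>g_sol\<close> is the mirror instance.\<close>
    have "norm (f_sol lam w \<gamma> n z) \<le> (B * (1/2) ^ nat n) * K"
      unfolding f_sol_eq norm_mult using PQ[OF z \<open>0 \<le> n\<close>] by (intro mult_mono F z p0 norm_ge_zero) simp
    also have "\<dots> \<le> (B * (1/2) ^ nat n) * (K * K')"
      by (intro mult_left_mono p0) (use K in auto)
    finally show "norm (f_sol lam w \<gamma> n z) \<le> B * (K * K') * (1/2) ^ nat n"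
      by (simp add: mult_ac)
  next
    fix z and n :: int assume z: "z \<in> cball \<zeta> r" and "n \<le> 0"
    have "norm (g_sol n z) \<le> (B * (1/2) ^ nat (- n)) * K'"
      unfolding g_sol_def R.f_sol_eq norm_mult using PQ[OF z \<open>n \<le> 0\<close>]
      by (intro mult_mono F z p0 norm_ge_zero) simp
    also have "\<dots> \<le> (B * (1/2) ^ nat (- n)) * (K * K')"
      by (intro mult_left_mono p0) (use K in auto)
    finally show "norm (g_sol n z) \<le> B * (K * K') * (1/2) ^ nat (- n)"
      by (simp add: mult_ac)
  qed
qed

text \<open>Not divided by the Wronskian, so that it stays bounded across zeros of
  \<open>char_fun\<close>. The sign makes \<open>J - z\<close> produce plus the Wronskian on the
  diagonal.\<close>

definition green :: "complex \<Rightarrow> int \<Rightarrow> int \<Rightarrow> complex" where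
  "green z n m = - (f_sol lam w \<gamma> (max n m) z * g_sol (min n m) z)"

text \<open>Off the diagonal one factor is frozen and the other solves the equation. At
  \<open>n = m\<close> the right neighbour uses the other solution, and the mismatch is exactly the
  Wronskian.\<close>

lemma green_equation:
  assumes z: "z \<in> C0 lam"
  shows "w (n - 1) * green z (n - 1) m + lam n * green z n m + w n * green z (n + 1) m - z * green z n m
    = (if n = m then (z - lam 0) * char_fun lam \<gamma> z else 0)"
proof -
  let ?f = "\<lambda>n. f_sol lam w \<gamma> n z" and ?g = "\<lambda>n. g_sol n z"
  have f: "w (n - 1) * ?f (n - 1) + lam n * ?f n + w n * ?f (n + 1) = z * ?f n" for n
    using f_sol_formal_solution[OF z] by (simp add: formal_solution_def jacobi_def)
  have g: "w (n - 1) * ?g (n - 1) + lam n * ?g n + w n * ?g (n + 1) = z * ?g n" for n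
    using g_sol_formal_solution[OF z] by (simp add: formal_solution_def jacobi_def)
  consider "n < m" | "n = m" | "m < n" by linarith
  then show ?thesis
  proof cases
    case 1
    then have "green z (n - 1) m = - ?f m * ?g (n - 1)" "green z n m = - ?f m * ?g n"
      "green z (n + 1) m = - ?f m * ?g (n + 1)" by (auto simp: green_def max_def min_def)
    moreover have "- ?f m * (w (n - 1) * ?g (n - 1) + lam n * ?g n + w n * ?g (n + 1) - z * ?g n) = 0"
      by (simp add: g)
    ultimately show ?thesis using 1 by (simp add: algebra_simps)
  next
    case 2
    then have e: "green z (n - 1) m = - ?f n * ?g (n - 1)" "green z n m = - ?f n * ?g n"
      "green z (n + 1) m = - ?g n * ?f (n + 1)" by (auto simp: green_def max_def min_def)
    have "w (n - 1) * green z (n - 1) m + lam n * green z n m + w n * green z (n + 1) m - z * green z n m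
        = w n * (?f n * ?g (n + 1) - ?f (n + 1) * ?g n)
          - ?f n * (w (n - 1) * ?g (n - 1) + lam n * ?g n + w n * ?g (n + 1) - z * ?g n)"
      unfolding e by (simp add: algebra_simps)
    also have "\<dots> = wronskian w ?f ?g n" by (simp add: g wronskian_def)
    finally show ?thesis using 2 by (simp add: wronskian_f_g[OF z])
  next
    case 3
    then have "n - 1 = m \<or> m < n - 1" by linarith
    then have "green z (n - 1) m = - ?g m * ?f (n - 1)" "green z n m = - ?g m * ?f n"
      "green z (n + 1) m = - ?g m * ?f (n + 1)" by (auto simp: green_def max_def min_def)
    moreover have "- ?g m * (w (n - 1) * ?f (n - 1) + lam n * ?f n + w n * ?f (n + 1) - z * ?f n) = 0"
      by (simp add: f)
    ultimately show ?thesis using 3 by (simp add: algebra_simps)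
  qed
qed

lemma green_operator:
  assumes z: "z \<in> C0 lam" and le: "\<And>n m. norm (green z n m) \<le> C * (1/2) ^ nat \<bar>n - m\<bar>"
  obtains K :: "ell2 \<Rightarrow>\<^sub>L ell2" where "norm K \<le> 4 * C"
    "\<And>y. (blinfun_apply K y, ((z - lam 0) * char_fun lam \<gamma> z) *\<^sub>C y + z *\<^sub>C blinfun_apply K y) \<in> J_max lam w"
proof -
  obtain K :: "ell2 \<Rightarrow>\<^sub>L ell2" where K: "\<And>y. seq_of (blinfun_apply K y) = kernel_apply (green z) y" "norm K \<le> 4 * C"
    using kernel_operator[OF le] by metis
  have "jacobi lam w (seq_of (blinfun_apply K y)) n
      = (z - lam 0) * char_fun lam \<gamma> z * seq_of y n + z * seq_of (blinfun_apply K y) n" for y n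
  proof -
    let ?u = "\<lambda>n m. green z n m * seq_of y m"
    note s = kernel_apply_summable[OF le, where y=y]
    have hs: "((\<lambda>m. c * ?u k m) has_sum c * kernel_apply (green z) y k) UNIV" for c k
      unfolding kernel_apply_def by (intro has_sum_cmult_right has_sum_infsum s)
    have "((\<lambda>m. (w (n - 1) * ?u (n - 1) m + lam n * ?u n m + w n * ?u (n + 1) m) + (- z) * ?u n m) has_sum
        (jacobi lam w (kernel_apply (green z) y) n + (- z) * kernel_apply (green z) y n)) UNIV"
      unfolding jacobi_def by (intro has_sum_add hs)
    also have "(\<lambda>m. (w (n - 1) * ?u (n - 1) m + lam n * ?u n m + w n * ?u (n + 1) m) + (- z) * ?u n m)
        = (\<lambda>m. (if n = m then (z - lam 0) * char_fun lam \<gamma> z else 0) * seq_of y m)"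
      unfolding green_equation[OF z, symmetric] by (simp add: algebra_simps fun_eq_iff)
    finally have "((\<lambda>m. (if n = m then (z - lam 0) * char_fun lam \<gamma> z else 0) * seq_of y m) has_sum
        (jacobi lam w (kernel_apply (green z) y) n - z * kernel_apply (green z) y n)) UNIV" by simp
    moreover have "((\<lambda>m. (if n = m then (z - lam 0) * char_fun lam \<gamma> z else 0) * seq_of y m) has_sum
        ((z - lam 0) * char_fun lam \<gamma> z * seq_of y n)) UNIV"
      by (rule has_sum_finite_neutralI[of "{n}"]) auto
    ultimately have "jacobi lam w (kernel_apply (green z) y) n - z * kernel_apply (green z) y n
        = (z - lam 0) * char_fun lam \<gamma> z * seq_of y n"
      by (rule has_sum_unique)
    then show ?thesis by (simp add: K(1) algebra_simps)
  qed
  then show thesis by (intro that[of K] K(2)) (simp add: J_max_iff fun_eq_iff)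
qed

end

lemma blinfun_cscale_apply [simp]: "blinfun_apply (blinfun_cscale c A) x = c *\<^sub>C blinfun_apply A x"
  unfolding blinfun_cscale_def
  by (subst bounded_linear_Blinfun_apply)
    (intro bounded_linear_compose[OF bounded_bilinear.bounded_linear_right[OF bounded_bilinear_cscale]]
      blinfun.bounded_linear_right, rule refl)

lemma norm_blinfun_cscale_le: "norm (blinfun_cscale c A) \<le> norm c * norm A"
  by (rule norm_blinfun_bound) (auto simp: mult.assoc intro!: mult_left_mono norm_blinfun)

lemma is_resolvent_iff:
  "is_resolvent J z R \<longleftrightarrow> (\<forall>x y. (x, y + z *\<^sub>C x) \<in> J \<longleftrightarrow> x = blinfun_apply R y)"
  unfolding is_resolvent_def by (auto simp: set_eq_iff shift_iff)

lemma is_resolvent_unique: "is_resolvent J z R \<Longrightarrow> is_resolvent J z R' \<Longrightarrow> R = R'"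
  by (rule blinfun_eqI) (auto simp: is_resolvent_iff)

lemma resolvent_eq: "is_resolvent J z R \<Longrightarrow> resolvent J z = R"
  unfolding resolvent_def using is_resolvent_unique by blast

lemma is_resolvent_resolvent: "z \<in> resolvent_set J \<Longrightarrow> is_resolvent J z (resolvent J z)"
  unfolding resolvent_set_def using resolvent_eq by auto

text \<open>One differentiation turns \<open>h * (\<xi> - z) ^ \<nu>\<close> into a function of the
  same shape with exponent lowered by one, so induction on \<open>j\<close> runs over all
  \<open>h\<close>.\<close>

lemma higher_deriv_eq_0:
  assumes "open S" "z \<in> S" "h holomorphic_on S" "j < \<nu>"
  shows "(deriv ^^ j) (\<lambda>\<xi>. h \<xi> * (\<xi> - z) ^ \<nu>) z = 0"
  using assms(3,4)
proof (induction j arbitrary: h \<nu>)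
  case 0
  then show ?case by simp
next
  case (Suc j)
  obtain \<mu> where \<nu>: "\<nu> = Suc \<mu>" using Suc.prems(2) by (cases \<nu>) auto
  let ?k = "\<lambda>\<xi>. deriv h \<xi> * (\<xi> - z) + of_nat \<nu> * h \<xi>"
  have k: "?k holomorphic_on S"
    by (intro holomorphic_intros holomorphic_deriv Suc.prems assms)
  have "(deriv ^^ j) (deriv (\<lambda>\<xi>. h \<xi> * (\<xi> - z) ^ \<nu>)) z = (deriv ^^ j) (\<lambda>\<xi>. ?k \<xi> * (\<xi> - z) ^ \<mu>) z"
  proof (rule higher_deriv_transform_within_open)
    show "deriv (\<lambda>\<xi>. h \<xi> * (\<xi> - z) ^ \<nu>) holomorphic_on S"
      by (intro holomorphic_deriv holomorphic_intros Suc.prems assms)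
    show "(\<lambda>\<xi>. ?k \<xi> * (\<xi> - z) ^ \<mu>) holomorphic_on S" by (intro holomorphic_intros k)
    fix \<xi> assume "\<xi> \<in> S"
    then have h: "(h has_field_derivative deriv h \<xi>) (at \<xi>)"
      using Suc.prems(1) assms(1) holomorphic_derivI by blast
    have "((\<lambda>\<xi>. h \<xi> * (\<xi> - z) ^ \<nu>) has_field_derivative ?k \<xi> * (\<xi> - z) ^ \<mu>) (at \<xi>)"
    proof -
      have "((\<lambda>\<xi>. \<xi> - z) has_field_derivative 1) (at \<xi>)" by (auto intro!: derivative_eq_intros)
      from DERIV_mult[OF h DERIV_power[OF this, of \<nu>]]
      show ?thesis by (rule DERIV_cong) (simp add: \<nu> algebra_simps del: of_nat_Suc)
    qed
    then show "deriv (\<lambda>\<xi>. h \<xi> * (\<xi> - z) ^ \<nu>) \<xi> = ?k \<xi> * (\<xi> - z) ^ \<mu>" by (rule DERIV_imp_deriv)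
  qed (use assms in auto)
  also have "\<dots> = 0" using Suc.prems \<nu> by (intro Suc.IH k) simp
  finally show ?case by (simp add: funpow_Suc_right del: funpow.simps)
qed

section \<open>The resolvent near zeros of the characteristic function, and derivatives of the
  solution \<open>f\<close>\<close>

context jacobi_data
begin

text \<open>A nonzero \<open>u\<close> would force both \<open>f\<close> and \<open>g\<close> to be
  multiples of it, hence their Wronskian to vanish, although it equals
  \<open>(z - lam 0) * char_fun lam \<gamma> z\<close>.\<close>

lemma kernel_trivial:
  assumes J: "J_min lam w = J_max lam w" and z: "z \<in> C0 lam" and F: "char_fun lam \<gamma> z \<noteq> 0"
    and u: "(u, z *\<^sub>C u) \<in> J_max lam w"
  shows "u = 0"
proof (rule ccontr)
  assume "u \<noteq> 0"
  then obtain k where k: "seq_of u k \<noteq> 0" using ell2_eqI[of u 0] by auto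
  let ?f = "\<lambda>n. f_sol lam w \<gamma> n z" and ?g = "\<lambda>n. g_sol n z"
  note fs = f_sol_formal_solution[OF z] and gs = g_sol_formal_solution[OF z]
  have us: "formal_solution lam w z (seq_of u)" using u by (simp add: formal_solution_J_max)
  obtain r C where r: "0 < r" "0 < C"
    and "\<And>\<xi> n. \<xi> \<in> cball z r \<Longrightarrow> 0 \<le> n \<Longrightarrow> norm (f_sol lam w \<gamma> n \<xi>) \<le> C * (1/2) ^ nat n"
    and "\<And>\<xi> n. \<xi> \<in> cball z r \<Longrightarrow> n \<le> 0 \<Longrightarrow> norm (g_sol n \<xi>) \<le> C * (1/2) ^ nat (- n)"
    using local_decay[OF z] by metis
  then have f: "\<And>n. 0 \<le> n \<Longrightarrow> norm (?f n) \<le> C * (1/2) ^ nat n"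
    and g: "\<And>n. n \<le> 0 \<Longrightarrow> norm (?g n) \<le> C * (1/2) ^ nat (- n)" by auto
  have "wronskian w ?f (seq_of u) 0 = 0"
  proof (rule wronskian_right_solution[OF J u fs geometric_in_ell2])
    show "norm (if n \<ge> 1 then ?f n else 0) \<le> C * (1/2) ^ nat \<bar>n\<bar>" for n
      using f[of n] r(2) by auto
  qed
  note f_u = wronskian_eq_0_imp_proportional[OF w_nonzero fs us this k]
  have "wronskian w ?g (seq_of u) 0 = 0"
  proof (rule wronskian_left_solution[OF J u gs geometric_in_ell2])
    show "norm (if n \<le> 0 then ?g n else 0) \<le> C * (1/2) ^ nat \<bar>n\<bar>" for n
      using g[of n] r(2) by auto
  qed
  note g_u = wronskian_eq_0_imp_proportional[OF w_nonzero gs us this k]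
  define a b where "a = ?f k / seq_of u k" and "b = ?g k / seq_of u k"
  have "?f n = a * seq_of u n" "?g n = b * seq_of u n" for n
    unfolding a_def b_def by (rule f_u, rule g_u)
  then have "wronskian w ?f ?g 0 = 0" by (simp add: wronskian_def)
  then show False using F C0_not_lam[OF z, of 0] by (simp add: wronskian_f_g[OF z])
qed

text \<open>The Green operator divided by the Wronskian is a right inverse, and
  \<open>kernel_trivial\<close> makes it two-sided. The centre may itself be a zero of
  \<open>char_fun\<close>: the constant does not see how close \<open>z\<close> is to it.\<close>

lemma resolvent_local_bound:
  assumes J: "J_min lam w = J_max lam w" and \<zeta>: "\<zeta> \<in> C0 lam"
  obtains r C where "0 < r" "cball \<zeta> r \<subseteq> C0 lam"
    "\<And>z. z \<in> cball \<zeta> r \<Longrightarrow> char_fun lam \<gamma> z \<noteq> 0 \<Longrightarrow>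
      \<exists>R. is_resolvent (J_max lam w) z R \<and> norm (char_fun lam \<gamma> z) * norm R \<le> C"
proof -
  obtain r C where r: "0 < r" "0 < C" "cball \<zeta> r \<subseteq> C0 lam"
    and le: "\<And>z n m. z \<in> cball \<zeta> r \<Longrightarrow> m \<le> n \<Longrightarrow> norm (f_sol lam w \<gamma> n z * g_sol m z) \<le> C * (1/2) ^ nat (n - m)"
    using local_decay[OF \<zeta>] by metis
  have "\<exists>R. is_resolvent (J_max lam w) z R \<and> norm (char_fun lam \<gamma> z) * norm R \<le> 4 * C / (r/2)"
    if z: "z \<in> cball \<zeta> (r/2)" and F: "char_fun lam \<gamma> z \<noteq> 0" for z
  proof -
    have zr: "z \<in> cball \<zeta> r" using z r by auto
    then have zC: "z \<in> C0 lam" using r by auto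
    \<comment> \<open>Shrinking to half the radius keeps \<open>z - lam 0\<close>, the harmless
      factor of the Wronskian, bounded away from 0.\<close>
    have "lam 0 \<notin> cball \<zeta> r" using r(3) C0_not_lam[of "lam 0" lam 0] by blast
    then have "r < dist \<zeta> (lam 0)" by simp
    also have "\<dots> \<le> dist \<zeta> z + dist z (lam 0)" by (rule dist_triangle)
    finally have d: "r/2 < norm (z - lam 0)" using z by (simp add: dist_norm)
    let ?W = "(z - lam 0) * char_fun lam \<gamma> z"
    have W: "?W \<noteq> 0" using F d r(1) by auto
    have "norm (green z n m) \<le> C * (1/2) ^ nat \<bar>n - m\<bar>" for n m
      using le[OF zr, of "min n m" "max n m"] by (auto simp: green_def max_def min_def norm_mult abs_if)
    then obtain K :: "ell2 \<Rightarrow>\<^sub>L ell2" where K: "norm K \<le> 4 * C"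
      "\<And>y. (blinfun_apply K y, ?W *\<^sub>C y + z *\<^sub>C blinfun_apply K y) \<in> J_max lam w"
      using green_operator[OF zC] by metis
    let ?R = "blinfun_cscale (1 / ?W) K"
    have R: "(blinfun_apply ?R y, y + z *\<^sub>C blinfun_apply ?R y) \<in> J_max lam w" for y
      using J_max_cscale[OF K(2)[of y], of "1 / ?W"] W
      by (simp add: cell2.scale_right_distrib mult.commute)
    have "is_resolvent (J_max lam w) z ?R"
      unfolding is_resolvent_iff
    proof (intro allI iffI)
      fix x y assume "(x, y + z *\<^sub>C x) \<in> J_max lam w"
      from J_max_add[OF this J_max_cscale[OF R[of y], of "-1"]]
      have "(x - blinfun_apply ?R y, z *\<^sub>C (x - blinfun_apply ?R y)) \<in> J_max lam w"
        by (simp add: J_max_iff fun_eq_iff algebra_simps)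
      from kernel_trivial[OF J zC F this] show "x = blinfun_apply ?R y" by simp
    qed (use R in auto)
    moreover have "norm (char_fun lam \<gamma> z) * norm ?R \<le> norm (char_fun lam \<gamma> z) * (norm (1 / ?W) * (4 * C))"
      by (intro mult_left_mono order_trans[OF norm_blinfun_cscale_le] K) auto
    then have "norm (char_fun lam \<gamma> z) * norm ?R \<le> 4 * C / norm (z - lam 0)"
      using F by (simp add: norm_divide norm_mult)
    then have "norm (char_fun lam \<gamma> z) * norm ?R \<le> 4 * C / (r/2)"
      using d r by (elim order_trans) (intro divide_left_mono mult_pos_pos, auto)
    ultimately show ?thesis by blast
  qed
  note bound = this
  show thesis
  proof (rule that[of "r/2"])
    show "0 < r/2" "cball \<zeta> (r/2) \<subseteq> C0 lam" using r by auto
  qed (fact bound)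
qed

text \<open>The formal equation is differentiated in \<open>\<xi>\<close> entry by entry. For
  \<open>j = 0\<close> the truncated \<open>j - 1\<close> does no harm, as its coefficient is
  0.\<close>

lemma f_deriv_recurrence:
  assumes "\<xi> \<in> C0 lam"
  shows "jacobi lam w (f_deriv lam w \<gamma> j \<xi>) n = \<xi> * f_deriv lam w \<gamma> j \<xi> n + of_nat j * f_deriv lam w \<gamma> (j - 1) \<xi> n"
  using assms
proof (induction j arbitrary: \<xi>)
  case 0
  then show ?case
    using f_sol_formal_solution by (simp add: f_deriv_def formal_solution_def)
next
  case (Suc j)
  let ?D = "\<lambda>j n \<xi>. f_deriv lam w \<gamma> j \<xi> n"
  have D: "(?D j n has_field_derivative ?D (Suc j) n \<xi>) (at \<xi>)" for j n
    using holomorphic_derivI[OF holomorphic_higher_deriv[OF f_sol_holomorphic open_C0] open_C0 Suc.prems, of j n]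
    by (simp add: f_deriv_def)
  have "((\<lambda>\<xi>. jacobi lam w (f_deriv lam w \<gamma> j \<xi>) n) has_field_derivative
      jacobi lam w (f_deriv lam w \<gamma> (Suc j) \<xi>) n) (at \<xi>)"
    unfolding jacobi_def by (auto intro!: derivative_eq_intros D)
  moreover have "((\<lambda>\<xi>. \<xi> * ?D j n \<xi> + of_nat j * ?D (j - 1) n \<xi>) has_field_derivative
      \<xi> * ?D (Suc j) n \<xi> + of_nat (Suc j) * ?D j n \<xi>) (at \<xi>)"
    by (cases j) (auto intro!: derivative_eq_intros D simp: algebra_simps)
  then have "((\<lambda>\<xi>. jacobi lam w (f_deriv lam w \<gamma> j \<xi>) n) has_field_derivative
      \<xi> * ?D (Suc j) n \<xi> + of_nat (Suc j) * ?D j n \<xi>) (at \<xi>)"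
    by (rule has_field_derivative_transform_within_open[OF _ open_C0 Suc.prems]) (simp add: Suc.IH)
  ultimately show ?case using DERIV_unique by fastforce
qed

text \<open>Near a zero of order \<open>\<nu>\<close> of the characteristic function the two Weyl solutions are
  proportional up to terms of order \<open>\<nu>\<close>, so the derivatives of order below \<open>\<nu>\<close> of the solution
  \<open>f\<close> inherit the decay of \<open>g\<close> at minus infinity.\<close>

lemma f_deriv_in_ell2:
  assumes z: "z \<in> C0 lam" and \<rho>: "0 < \<rho>" and h: "h holomorphic_on ball z \<rho>"
    and F: "\<And>\<xi>. \<xi> \<in> ball z \<rho> \<Longrightarrow> char_fun lam \<gamma> \<xi> = h \<xi> * (\<xi> - z) ^ \<nu>" and j: "j < \<nu>"
  shows "f_deriv lam w \<gamma> j z \<in> range seq_of"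
proof -
  obtain r C where r: "0 < r" "0 < C" "cball z r \<subseteq> C0 lam"
    and f: "\<And>\<xi> n. \<xi> \<in> cball z r \<Longrightarrow> 0 \<le> n \<Longrightarrow> norm (f_sol lam w \<gamma> n \<xi>) \<le> C * (1/2) ^ nat n"
    and g: "\<And>\<xi> n. \<xi> \<in> cball z r \<Longrightarrow> n \<le> 0 \<Longrightarrow> norm (g_sol n \<xi>) \<le> C * (1/2) ^ nat (- n)"
    using local_decay[OF z] by metis
  obtain k where k: "g_sol k z \<noteq> 0" using g_sol_nonzero[OF z] by blast
  have "isCont (g_sol k) z"
    using g_sol_holomorphic open_C0 z
    by (meson continuous_on_eq_continuous_at holomorphic_on_imp_continuous_on)
  then obtain s where s: "0 < s" "\<And>\<xi>. \<xi> \<in> ball z s \<Longrightarrow> g_sol k \<xi> \<noteq> 0"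
    using continuous_at_avoid[of z "g_sol k" 0] k by (auto simp: dist_commute)
  define t where "t = min \<rho> (min r s)"
  define e where "e = t / 2"
  have t: "0 < t" "ball z t \<subseteq> ball z \<rho>" "ball z t \<subseteq> cball z r" "ball z t \<subseteq> ball z s"
    using \<rho> r s by (auto simp: t_def)
  have e: "0 < e" "cball z e \<subseteq> ball z t" "ball z e \<subseteq> ball z t" using t(1) by (auto simp: e_def)
  have tC: "ball z t \<subseteq> C0 lam" using t(3) r(3) by blast
  \<comment> \<open>The proportionality factor is read off at one index \<open>k\<close> with
    \<open>g_sol k\<close> nonzero near \<open>z\<close>. The error \<open>E\<close> is then a
    formal solution that vanishes identically at \<open>k\<close>.\<close>
  define A where "A \<xi> = f_sol lam w \<gamma> k \<xi> / g_sol k \<xi>" for \<xi>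
  define E where "E n \<xi> = f_sol lam w \<gamma> n \<xi> - A \<xi> * g_sol n \<xi>" for n \<xi>
  have hol: "f_sol lam w \<gamma> n holomorphic_on ball z t" "g_sol n holomorphic_on ball z t" "h holomorphic_on ball z t" for n
    using holomorphic_on_subset[OF f_sol_holomorphic tC] holomorphic_on_subset[OF g_sol_holomorphic tC]
      holomorphic_on_subset[OF h t(2)] by auto
  have gk: "g_sol k \<xi> \<noteq> 0" if "\<xi> \<in> ball z t" for \<xi> using s(2) t(4) that by blast
  have A: "A holomorphic_on ball z t"
    unfolding A_def by (intro holomorphic_intros hol gk)
  have solE: "formal_solution lam w \<xi> (\<lambda>n. E n \<xi>)" if "\<xi> \<in> ball z t" for \<xi>
    unfolding E_def using that tC
    by (intro formal_solution_diff_scale f_sol_formal_solution g_sol_formal_solution) auto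
  \<comment> \<open>Divisibility by \<open>(\<xi> - z) ^ \<nu>\<close> spreads from the pair
    \<open>k\<close>, \<open>k + 1\<close> in both directions through the recurrence, whose
    coefficients are polynomial in \<open>\<xi>\<close>.\<close>
  have "(\<exists>q. q holomorphic_on ball z t \<and> (\<forall>\<xi>\<in>ball z t. E n \<xi> = q \<xi> * (\<xi> - z) ^ \<nu>)) \<and>
      (\<exists>q. q holomorphic_on ball z t \<and> (\<forall>\<xi>\<in>ball z t. E (n + 1) \<xi> = q \<xi> * (\<xi> - z) ^ \<nu>))" for n
  proof (induction n rule: int_induct[where k=k])
    case base
    have 1: "E k \<xi> = 0 * (\<xi> - z) ^ \<nu>" if "\<xi> \<in> ball z t" for \<xi>
      using gk[OF that] by (simp add: E_def A_def)
    \<comment> \<open>The Wronskian at \<open>k\<close> is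
      \<open>- w k * g_sol k \<xi> * E (k + 1) \<xi>\<close>; equating it with
      \<open>(\<xi> - lam 0)\<close> times \<open>char_fun\<close> and solving gives
      \<open>?q\<close>.\<close>
    let ?q = "\<lambda>\<xi>. - ((\<xi> - lam 0) * h \<xi>) / (w k * g_sol k \<xi>)"
    have 2: "E (k + 1) \<xi> = ?q \<xi> * (\<xi> - z) ^ \<nu>" if \<xi>: "\<xi> \<in> ball z t" for \<xi>
    proof -
      have "(\<xi> - lam 0) * (h \<xi> * (\<xi> - z) ^ \<nu>) = (\<xi> - lam 0) * char_fun lam \<gamma> \<xi>"
        using F t(2) \<xi> by auto
      also have "\<dots> = w k * (f_sol lam w \<gamma> k \<xi> * g_sol (k + 1) \<xi> - f_sol lam w \<gamma> (k + 1) \<xi> * g_sol k \<xi>)"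
        using wronskian_f_g[of \<xi> k] tC \<xi> by (auto simp: wronskian_def)
      also have "\<dots> = - (w k * g_sol k \<xi>) * E (k + 1) \<xi>"
        using gk[OF \<xi>] by (simp add: E_def A_def field_simps)
      finally show ?thesis using gk[OF \<xi>] w_nonzero[of k] by (simp add: field_simps)
    qed
    show ?case
    proof (intro conjI exI ballI)
      show "(\<lambda>_. 0) holomorphic_on ball z t" by (rule holomorphic_on_const)
      show "?q holomorphic_on ball z t"
        using w_nonzero gk by (intro holomorphic_intros hol) auto
    qed (fact 1 2)+
  next
    case (step1 i)
    then obtain p q where p: "p holomorphic_on ball z t" "\<And>\<xi>. \<xi> \<in> ball z t \<Longrightarrow> E i \<xi> = p \<xi> * (\<xi> - z) ^ \<nu>"
      and q: "q holomorphic_on ball z t" "\<And>\<xi>. \<xi> \<in> ball z t \<Longrightarrow> E (i + 1) \<xi> = q \<xi> * (\<xi> - z) ^ \<nu>" by blast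
    let ?s = "\<lambda>\<xi>. ((\<xi> - lam (i + 1)) * q \<xi> - w i * p \<xi>) / w (i + 1)"
    have "E (i + 1 + 1) \<xi> = ?s \<xi> * (\<xi> - z) ^ \<nu>" if \<xi>: "\<xi> \<in> ball z t" for \<xi>
    proof -
      have "w (i + 1) * E (i + 1 + 1) \<xi> = (\<xi> - lam (i + 1)) * E (i + 1) \<xi> - w i * E i \<xi>"
        using solE[OF \<xi>, unfolded formal_solution_def jacobi_def, rule_format, of "i + 1"]
        by (simp add: algebra_simps)
      then show ?thesis using w_nonzero[of "i + 1"] unfolding p(2)[OF \<xi>] q(2)[OF \<xi>]
        by (simp add: field_simps)
    qed
    moreover have "?s holomorphic_on ball z t"
      using w_nonzero by (intro holomorphic_intros p q) auto
    ultimately show ?case using q by blast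
  next
    case (step2 i)
    then obtain p q where p: "p holomorphic_on ball z t" "\<And>\<xi>. \<xi> \<in> ball z t \<Longrightarrow> E i \<xi> = p \<xi> * (\<xi> - z) ^ \<nu>"
      and q: "q holomorphic_on ball z t" "\<And>\<xi>. \<xi> \<in> ball z t \<Longrightarrow> E (i + 1) \<xi> = q \<xi> * (\<xi> - z) ^ \<nu>" by blast
    let ?s = "\<lambda>\<xi>. ((\<xi> - lam i) * p \<xi> - w i * q \<xi>) / w (i - 1)"
    have "E (i - 1) \<xi> = ?s \<xi> * (\<xi> - z) ^ \<nu>" if \<xi>: "\<xi> \<in> ball z t" for \<xi>
    proof -
      have "w (i - 1) * E (i - 1) \<xi> = (\<xi> - lam i) * E i \<xi> - w i * E (i + 1) \<xi>"
        using solE[OF \<xi>, unfolded formal_solution_def jacobi_def, rule_format, of i]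
        by (simp add: algebra_simps)
      then show ?thesis using w_nonzero[of "i - 1"] unfolding p(2)[OF \<xi>] q(2)[OF \<xi>]
        by (simp add: field_simps)
    qed
    moreover have "?s holomorphic_on ball z t"
      using w_nonzero by (intro holomorphic_intros p q) auto
    moreover have "\<forall>\<xi>\<in>ball z t. E (i - 1 + 1) \<xi> = p \<xi> * (\<xi> - z) ^ \<nu>" using p by simp
    ultimately show ?case using p(1) by blast
  qed
  then have E: "\<exists>q. q holomorphic_on ball z t \<and> (\<forall>\<xi>\<in>ball z t. E n \<xi> = q \<xi> * (\<xi> - z) ^ \<nu>)" for n
    by blast
  have zt: "z \<in> ball z t" using t by simp
  have E0: "(deriv ^^ j) (E n) z = 0" for n
  proof -
    obtain q where q: "q holomorphic_on ball z t" "\<And>\<xi>. \<xi> \<in> ball z t \<Longrightarrow> E n \<xi> = q \<xi> * (\<xi> - z) ^ \<nu>"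
      using E by blast
    have "(deriv ^^ j) (E n) z = (deriv ^^ j) (\<lambda>\<xi>. q \<xi> * (\<xi> - z) ^ \<nu>) z"
    proof (rule higher_deriv_transform_within_open)
      show "E n holomorphic_on ball z t"
        unfolding E_def by (intro holomorphic_intros hol A)
      show "(\<lambda>\<xi>. q \<xi> * (\<xi> - z) ^ \<nu>) holomorphic_on ball z t"
        by (intro holomorphic_intros q(1))
    qed (use zt q(2) in auto)
    also have "\<dots> = 0" by (rule higher_deriv_eq_0[OF open_ball zt q(1) j])
    finally show ?thesis .
  qed
  have Ag: "f_deriv lam w \<gamma> j z n = (deriv ^^ j) (\<lambda>\<xi>. A \<xi> * g_sol n \<xi>) z" for n
  proof -
    have "(deriv ^^ j) (E n) z = (deriv ^^ j) (f_sol lam w \<gamma> n) z - (deriv ^^ j) (\<lambda>\<xi>. A \<xi> * g_sol n \<xi>) z"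
      unfolding E_def by (rule higher_deriv_diff[of _ "ball z t"]) (auto intro!: holomorphic_intros hol A t(1))
    then show ?thesis by (simp add: E0 f_deriv_def)
  qed
  have "compact (A ` cball z e)"
    by (intro compact_continuous_image holomorphic_on_imp_continuous_on
        holomorphic_on_subset[OF A e(2)]) simp
  then obtain B where B: "0 < B" "\<And>\<xi>. \<xi> \<in> cball z e \<Longrightarrow> norm (A \<xi>) \<le> B"
    using compact_imp_bounded bounded_pos by (metis imageI)
  have cauchy: "norm ((deriv ^^ j) \<phi> z) \<le> fact j * K / e ^ j"
    if "\<phi> holomorphic_on ball z t" "\<And>\<xi>. \<xi> \<in> cball z e \<Longrightarrow> norm (\<phi> \<xi>) \<le> K" for \<phi> K
    by (rule Cauchy_inequality[OF holomorphic_on_subset[OF that(1) e(3)]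
          holomorphic_on_imp_continuous_on[OF holomorphic_on_subset[OF that(1) e(2)]] e(1)])
      (auto intro!: that(2) simp: dist_norm)
  have er: "cball z e \<subseteq> cball z r" using e(2) t(3) by blast
  \<comment> \<open>\<open>1 + B\<close> covers both ends: factor 1 for \<open>f\<close> itself on
    the right, factor \<open>B\<close> for \<open>A\<close> times \<open>g\<close> on the
    left.\<close>
  define K where "K = fact j * ((1 + B) * C) / e ^ j"
  show ?thesis
  proof (rule geometric_in_ell2)
    fix n
    show "norm (f_deriv lam w \<gamma> j z n) \<le> K * (1/2) ^ nat \<bar>n\<bar>"
    proof (cases "0 \<le> n")
      case True
      have "norm (f_deriv lam w \<gamma> j z n) \<le> fact j * ((1 + B) * C * (1/2) ^ nat n) / e ^ j"
        unfolding f_deriv_def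
      proof (rule cauchy[OF hol(1)])
        fix \<xi> assume "\<xi> \<in> cball z e"
        then have "norm (f_sol lam w \<gamma> n \<xi>) \<le> 1 * C * (1/2) ^ nat n" using f True er by auto
        also have "\<dots> \<le> (1 + B) * C * (1/2) ^ nat n" by (intro mult_right_mono) (use B r in auto)
        finally show "norm (f_sol lam w \<gamma> n \<xi>) \<le> (1 + B) * C * (1/2) ^ nat n" .
      qed
      then show ?thesis using True by (simp add: K_def mult_ac)
    next
      case False
      have "norm (f_deriv lam w \<gamma> j z n) \<le> fact j * ((1 + B) * C * (1/2) ^ nat (- n)) / e ^ j"
        unfolding Ag
      proof (rule cauchy)
        show "(\<lambda>\<xi>. A \<xi> * g_sol n \<xi>) holomorphic_on ball z t" by (intro holomorphic_intros A hol)
        fix \<xi> assume \<xi>: "\<xi> \<in> cball z e"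
        then have "norm (A \<xi> * g_sol n \<xi>) \<le> B * (C * (1/2) ^ nat (- n))"
          unfolding norm_mult using B False er by (intro mult_mono g) auto
        also have "\<dots> \<le> (1 + B) * (C * (1/2) ^ nat (- n))" by (intro mult_right_mono) (use r in auto)
        finally show "norm (A \<xi> * g_sol n \<xi>) \<le> (1 + B) * C * (1/2) ^ nat (- n)" by (simp add: mult_ac)
      qed
      then show ?thesis using False by (simp add: K_def mult_ac)
    qed
  qed
qed

end

section \<open>Resolvents and their contour integrals\<close>

lemma bounded_bilinear_blinfun_cscale: "bounded_bilinear blinfun_cscale"
proof
  show "\<exists>K. \<forall>a b. norm (blinfun_cscale a b) \<le> norm a * norm b * K"
    by (rule exI[of _ 1]) (simp add: norm_blinfun_cscale_le)
qed (auto intro!: blinfun_eqI ell2_eqI simp: blinfun.bilinear_simps algebra_simps scaleR_conv_of_real)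

locale linear_operator =
  fixes J :: operator
  assumes J_add: "(x, y) \<in> J \<Longrightarrow> (x', y') \<in> J \<Longrightarrow> (x + x', y + y') \<in> J"
    and J_cscale: "(x, y) \<in> J \<Longrightarrow> (c *\<^sub>C x, c *\<^sub>C y) \<in> J"
begin

abbreviation "R \<equiv> resolvent J"

lemma resolvent_in: "z \<in> resolvent_set J \<Longrightarrow> (blinfun_apply (R z) y, y + z *\<^sub>C blinfun_apply (R z) y) \<in> J"
  using is_resolvent_resolvent by (simp add: is_resolvent_iff)

lemma resolvent_eqI: "z \<in> resolvent_set J \<Longrightarrow> (x, y + z *\<^sub>C x) \<in> J \<Longrightarrow> blinfun_apply (R z) y = x"
  using is_resolvent_resolvent by (simp add: is_resolvent_iff)

text \<open>Bounded linear maps are only real-linear by their type; complex linearity has to be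
  recovered from the graph.\<close>

lemma resolvent_cscale:
  assumes "z \<in> resolvent_set J"
  shows "blinfun_apply (R z) (c *\<^sub>C y) = c *\<^sub>C blinfun_apply (R z) y"
  using J_cscale[OF resolvent_in[OF assms], of c y]
  by (intro resolvent_eqI[OF assms]) (simp add: cell2.scale_right_distrib mult.commute)

lemma resolvent_identity:
  assumes "a \<in> resolvent_set J" "b \<in> resolvent_set J"
  shows "R b = R a + blinfun_cscale (b - a) (R a o\<^sub>L R b)"
proof (rule blinfun_eqI)
  fix y
  let ?x = "blinfun_apply (R b) y"
  have "(?x, (y + (b - a) *\<^sub>C ?x) + a *\<^sub>C ?x) \<in> J"
    using resolvent_in[OF assms(2), of y] by (simp add: cell2.scale_left_diff_distrib)
  from resolvent_eqI[OF assms(1) this]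
  show "?x = blinfun_apply (R a + blinfun_cscale (b - a) (R a o\<^sub>L R b)) y"
    by (simp add: blinfun.bilinear_simps resolvent_cscale[OF assms(1)])
qed

text \<open>The Neumann series appears as the fixed point of a contraction on bounded operators.
  Uniqueness of preimages follows from the same smallness: a difference \<open>d\<close> satisfies
  \<open>d = (b - a) *\<^sub>C blinfun_apply (R a) d\<close>.\<close>

lemma is_resolvent_near:
  assumes a: "a \<in> resolvent_set J" and small: "norm (b - a) * norm (R a) < 1"
  shows "b \<in> resolvent_set J"
proof -
  let ?f = "\<lambda>S. R a + blinfun_cscale (b - a) (R a o\<^sub>L S)"
  interpret bounded_bilinear blinfun_cscale by (rule bounded_bilinear_blinfun_cscale)
  have "dist (?f S) (?f S') \<le> norm (b - a) * norm (R a) * dist S S'" for S S'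
  proof -
    have "?f S - ?f S' = blinfun_cscale (b - a) (R a o\<^sub>L (S - S'))"
      by (rule blinfun_eqI) (simp add: blinfun.bilinear_simps ell2_eqI algebra_simps)
    moreover have "norm \<dots> \<le> norm (b - a) * (norm (R a) * norm (S - S'))"
      by (intro order_trans[OF norm_blinfun_cscale_le] mult_left_mono norm_blinfun_compose) simp
    ultimately show ?thesis by (simp add: dist_norm mult.assoc)
  qed
  then obtain S where S: "?f S = S"
    using banach_fix_type[of "norm (b - a) * norm (R a)" ?f] small by auto
  have Sy: "blinfun_apply S y = blinfun_apply (R a) (y + (b - a) *\<^sub>C blinfun_apply S y)" for y
    by (subst S[symmetric])
      (simp add: blinfun.add_left blinfun.add_right resolvent_cscale[OF a])
  have "is_resolvent J b S"
    unfolding is_resolvent_iff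
  proof (intro allI iffI)
    fix x y assume "x = blinfun_apply S y"
    then have x: "x = blinfun_apply (R a) (y + (b - a) *\<^sub>C x)" using Sy by simp
    have "(x, (y + (b - a) *\<^sub>C x) + a *\<^sub>C x) \<in> J"
      using resolvent_in[OF a, of "y + (b - a) *\<^sub>C x"] unfolding x[symmetric] .
    then show "(x, y + b *\<^sub>C x) \<in> J" by (simp add: cell2.scale_left_diff_distrib)
  next
    fix x y assume "(x, y + b *\<^sub>C x) \<in> J"
    then have "(x, (y + (b - a) *\<^sub>C x) + a *\<^sub>C x) \<in> J" by (simp add: cell2.scale_left_diff_distrib)
    from resolvent_eqI[OF a this]
    have x: "x = blinfun_apply (R a) (y + (b - a) *\<^sub>C x)" by simp
    define d where "d = x - blinfun_apply S y"
    have "d = blinfun_apply (R a) (y + (b - a) *\<^sub>C x) - blinfun_apply (R a) (y + (b - a) *\<^sub>C blinfun_apply S y)"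
      unfolding d_def x[symmetric] Sy[symmetric] ..
    also have "\<dots> = blinfun_apply (R a) ((b - a) *\<^sub>C d)"
      unfolding blinfun.diff_right[symmetric] d_def by (simp add: cell2.scale_right_diff_distrib)
    finally have "d = (b - a) *\<^sub>C blinfun_apply (R a) d" unfolding resolvent_cscale[OF a] .
    then have "norm d \<le> norm (b - a) * norm (R a) * norm d"
      using norm_blinfun[of "R a" d] by (metis mult.assoc mult_left_mono norm_cscale norm_ge_zero)
    then have "(1 - norm (b - a) * norm (R a)) * norm d \<le> 0" by (simp add: algebra_simps)
    with small have "d = 0" by (simp add: mult_le_0_iff)
    then show "x = blinfun_apply S y" by (simp add: d_def)
  qed
  then show ?thesis by (auto simp: resolvent_set_def)
qed

lemma open_resolvent_set: "open (resolvent_set J)"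
  unfolding open_contains_ball
proof
  fix a assume a: "a \<in> resolvent_set J"
  have "norm (b - a) * norm (R a) < 1" if "b \<in> ball a (1 / (norm (R a) + 1))" for b
  proof -
    have "norm (b - a) * norm (R a) \<le> norm (b - a) * (norm (R a) + 1)"
      by (intro mult_left_mono) auto
    also have "\<dots> < 1"
      using that by (simp add: dist_norm norm_minus_commute pos_less_divide_eq add_nonneg_pos)
    finally show ?thesis .
  qed
  then show "\<exists>e>0. ball a e \<subseteq> resolvent_set J"
    using is_resolvent_near[OF a] by (intro exI[of _ "1 / (norm (R a) + 1)"]) (auto simp: add_nonneg_pos)
qed

lemma norm_resolvent_near:
  assumes a: "a \<in> resolvent_set J" and small: "norm (b - a) * norm (R a) \<le> 1/2"
  shows "norm (R b) \<le> 2 * norm (R a)"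
proof -
  have b: "b \<in> resolvent_set J" using is_resolvent_near[OF a, of b] small by simp
  have "norm (R b) \<le> norm (R a) + norm (blinfun_cscale (b - a) (R a o\<^sub>L R b))"
    by (subst resolvent_identity[OF a b]) (rule norm_triangle_ineq)
  also have "norm (blinfun_cscale (b - a) (R a o\<^sub>L R b)) \<le> norm (b - a) * (norm (R a) * norm (R b))"
    by (intro order_trans[OF norm_blinfun_cscale_le] mult_left_mono norm_blinfun_compose) simp
  also have "\<dots> \<le> 1/2 * norm (R b)"
    unfolding mult.assoc[symmetric] by (rule mult_right_mono[OF small]) simp
  finally show ?thesis by simp
qed

lemma resolvent_compose_cscale:
  "a \<in> resolvent_set J \<Longrightarrow> R a o\<^sub>L blinfun_cscale c X = blinfun_cscale c (R a o\<^sub>L X)"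
  by (rule blinfun_eqI) (simp add: resolvent_cscale)

text \<open>The resolvent identity iterated \<open>n\<close> times. The iterate of composition with
  index \<open>i\<close> is the power \<open>i + 1\<close> of \<open>R a\<close>; the remainder
  contains \<open>R b\<close> itself, so no convergence is involved yet.\<close>

lemma resolvent_expansion:
  assumes a: "a \<in> resolvent_set J" and b: "b \<in> resolvent_set J"
  shows "R b = (\<Sum>i<n. blinfun_cscale ((b - a) ^ i) (((o\<^sub>L) (R a) ^^ i) (R a)))
    + blinfun_cscale ((b - a) ^ n) (((o\<^sub>L) (R a) ^^ n) (R b))"
proof (induction n)
  case 0
  show ?case by (rule blinfun_eqI) simp
next
  case (Suc n)
  interpret cs: bounded_bilinear blinfun_cscale by (rule bounded_bilinear_blinfun_cscale)
  interpret co: bounded_bilinear "(o\<^sub>L) :: (ell2 \<Rightarrow>\<^sub>L ell2) \<Rightarrow> (ell2 \<Rightarrow>\<^sub>L ell2) \<Rightarrow> ell2 \<Rightarrow>\<^sub>L ell2"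
    by (rule bounded_bilinear_blinfun_compose)
  have cc: "blinfun_cscale c (blinfun_cscale d X) = blinfun_cscale (c * d) X" for c d X
    by (rule blinfun_eqI) simp
  let ?T = "\<lambda>i. ((o\<^sub>L) (R a) ^^ i) (R a)"
  have "R b = R a + blinfun_cscale (b - a) (R a o\<^sub>L
      ((\<Sum>i<n. blinfun_cscale ((b - a) ^ i) (?T i)) + blinfun_cscale ((b - a) ^ n) (((o\<^sub>L) (R a) ^^ n) (R b))))"
    using resolvent_identity[OF a b] Suc.IH by simp
  also have "\<dots> = R a + (\<Sum>i<n. blinfun_cscale ((b - a) ^ Suc i) (?T (Suc i)))
      + blinfun_cscale ((b - a) ^ Suc n) (((o\<^sub>L) (R a) ^^ Suc n) (R b))"
    by (simp add: co.add_right co.sum_right cs.add_right cs.sum_right resolvent_compose_cscale[OF a] cc)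
  finally have *: "R b = \<dots>" .
  have "blinfun_cscale ((b - a) ^ 0) (?T 0) = R a" by (rule blinfun_eqI) simp
  then show ?case unfolding sum.lessThan_Suc_shift by (subst *) simp
qed

lemma resolvent_power_norm: "norm (((o\<^sub>L) (R a) ^^ n) X) \<le> norm (R a) ^ n * norm X"
proof (induction n)
  case (Suc n)
  have "norm (((o\<^sub>L) (R a) ^^ Suc n) X) \<le> norm (R a) * norm (((o\<^sub>L) (R a) ^^ n) X)"
    by (simp add: norm_blinfun_compose)
  also have "\<dots> \<le> norm (R a) * (norm (R a) ^ n * norm X)"
    by (rule mult_left_mono[OF Suc.IH]) simp
  finally show ?case by (simp add: mult.assoc)
qed simp

text \<open>A contour may have an unbounded derivative, so the integral of the resolvent along it is
  obtained from local primitives of \<open>\<phi> R\<close>; these come from termwise integration of the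
  Neumann series.\<close>

lemma resolvent_local_primitive:
  assumes a: "a \<in> resolvent_set J" and \<phi>: "\<phi> holomorphic_on UNIV"
  obtains r \<Psi> where "0 < r" "ball a r \<subseteq> resolvent_set J"
    "\<And>\<xi>. \<xi> \<in> ball a r \<Longrightarrow> (\<Psi> has_derivative (\<lambda>h. blinfun_cscale (h * \<phi> \<xi>) (R \<xi>))) (at \<xi>)"
proof -
  interpret cs: bounded_bilinear blinfun_cscale by (rule bounded_bilinear_blinfun_cscale)
  \<comment> \<open>Makes \<open>norm (\<xi> - a) * norm (R a)\<close> at most 1/2, so the Neumann
    remainder decays like \<open>(1/2) ^ n\<close> and \<open>norm (R \<xi>)\<close> is at most
    twice \<open>norm (R a)\<close>.\<close>
  define r where "r = 1 / (2 * (norm (R a) + 1))"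
  have r: "0 < r" by (simp add: r_def add_nonneg_pos)
  have small: "norm (\<xi> - a) * norm (R a) \<le> 1/2" if "\<xi> \<in> ball a r" for \<xi>
  proof -
    have "norm (\<xi> - a) * norm (R a) \<le> r * (norm (R a) + 1)"
      using that r by (intro mult_mono) (auto simp: dist_norm norm_minus_commute)
    also have "norm (R a) + 1 \<noteq> 0" using norm_ge_zero[of "R a"] by linarith
    then have "r * (norm (R a) + 1) = 1/2" by (simp add: r_def)
    finally show ?thesis .
  qed
  have \<rho>: "\<xi> \<in> resolvent_set J" if "\<xi> \<in> ball a r" for \<xi>
    using is_resolvent_near[OF a, of \<xi>] small[OF that] by simp
  have "compact (\<phi> ` cball a r)"
    by (intro compact_continuous_image holomorphic_on_imp_continuous_on holomorphic_on_subset[OF \<phi>]) auto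
  then obtain B where B: "0 < B" "\<And>\<xi>. \<xi> \<in> cball a r \<Longrightarrow> norm (\<phi> \<xi>) \<le> B"
    using compact_imp_bounded bounded_pos by (metis imageI)
  have "\<exists>\<alpha>. \<forall>\<xi>\<in>ball a r. (\<alpha> has_field_derivative \<phi> \<xi> * (\<xi> - a) ^ i) (at \<xi>)" for i
  proof -
    have "(\<lambda>\<xi>. \<phi> \<xi> * (\<xi> - a) ^ i) holomorphic_on ball a r"
      by (intro holomorphic_intros holomorphic_on_subset[OF \<phi>] subset_UNIV)
    then obtain \<alpha> where
      "\<And>\<xi>. \<xi> \<in> ball a r \<Longrightarrow> (\<alpha> has_field_derivative \<phi> \<xi> * (\<xi> - a) ^ i) (at \<xi> within ball a r)"
      using holomorphic_convex_primitive'[OF convex_ball open_ball] by blast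
    then show ?thesis by (metis at_within_open open_ball)
  qed
  then obtain \<alpha> where \<alpha>: "\<And>i \<xi>. \<xi> \<in> ball a r \<Longrightarrow> (\<alpha> i has_field_derivative \<phi> \<xi> * (\<xi> - a) ^ i) (at \<xi>)"
    by metis
  let ?T = "\<lambda>i. ((o\<^sub>L) (R a) ^^ i) (R a)"
  \<comment> \<open>Subtracting \<open>\<alpha> i a\<close> makes every term vanish at
    \<open>a\<close>; termwise differentiation needs convergence at one point, here trivial.\<close>
  let ?f = "\<lambda>i \<xi>. blinfun_cscale (\<alpha> i \<xi> - \<alpha> i a) (?T i)"
  let ?f' = "\<lambda>i \<xi> h. blinfun_cscale (h * (\<phi> \<xi> * (\<xi> - a) ^ i)) (?T i)"
  let ?g' = "\<lambda>\<xi> h. blinfun_cscale (h * \<phi> \<xi>) (R \<xi>)"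
  have der: "(?f i has_derivative ?f' i \<xi>) (at \<xi> within ball a r)" if "\<xi> \<in> ball a r" for i \<xi>
  proof -
    have "((\<lambda>\<xi>. \<alpha> i \<xi> - \<alpha> i a) has_derivative (\<lambda>h. h * (\<phi> \<xi> * (\<xi> - a) ^ i))) (at \<xi>)"
      using \<alpha>[OF that, of i] unfolding has_field_derivative_def
      by (auto intro!: derivative_eq_intros simp: fun_eq_iff)
    from bounded_linear.has_derivative[OF cs.bounded_linear_left this]
    show ?thesis by (rule has_derivative_at_withinI)
  qed
  have conv: "\<forall>\<^sub>F n in sequentially. \<forall>\<xi>\<in>ball a r. \<forall>h. norm ((\<Sum>i<n. ?f' i \<xi> h) - ?g' \<xi> h) \<le> e * norm h"
    if "0 < e" for e
  proof -
    have "(\<lambda>n. B * (2 * norm (R a)) * (1/2) ^ n) \<longlonglongrightarrow> B * (2 * norm (R a)) * 0"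
      by (intro tendsto_intros LIMSEQ_power_zero) simp
    then have "\<forall>\<^sub>F n in sequentially. B * (2 * norm (R a)) * (1/2) ^ n < e"
      using order_tendstoD(2) that by fastforce
    then show ?thesis
    proof eventually_elim
      case (elim n)
      show ?case
      proof (intro ballI allI)
        fix \<xi> h assume \<xi>: "\<xi> \<in> ball a r"
        have f': "?f' i \<xi> h = blinfun_cscale (h * \<phi> \<xi>) (blinfun_cscale ((\<xi> - a) ^ i) (?T i))" for i
          by (rule blinfun_eqI) (simp add: mult.assoc)
        have "(\<Sum>i<n. ?f' i \<xi> h) - ?g' \<xi> h
            = blinfun_cscale (h * \<phi> \<xi>) ((\<Sum>i<n. blinfun_cscale ((\<xi> - a) ^ i) (?T i)) - R \<xi>)"
          unfolding f' by (simp add: cs.sum_right cs.diff_right)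
        also have "(\<Sum>i<n. blinfun_cscale ((\<xi> - a) ^ i) (?T i)) - R \<xi>
            = - blinfun_cscale ((\<xi> - a) ^ n) (((o\<^sub>L) (R a) ^^ n) (R \<xi>))"
          using resolvent_expansion[OF a \<rho>[OF \<xi>], of n] by (simp add: algebra_simps)
        also have "norm (blinfun_cscale (h * \<phi> \<xi>) (- blinfun_cscale ((\<xi> - a) ^ n) (((o\<^sub>L) (R a) ^^ n) (R \<xi>))))
            \<le> (norm h * B) * ((norm (\<xi> - a)) ^ n * (norm (R a) ^ n * (2 * norm (R a))))"
        proof (intro order_trans[OF norm_blinfun_cscale_le] mult_mono)
          show "norm (h * \<phi> \<xi>) \<le> norm h * B"
            unfolding norm_mult using \<xi> by (intro mult_left_mono B) auto
          have "norm (((o\<^sub>L) (R a) ^^ n) (R \<xi>)) \<le> norm (R a) ^ n * (2 * norm (R a))"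
            by (intro order_trans[OF resolvent_power_norm] mult_left_mono norm_resolvent_near[OF a] small \<xi>) simp
          then show "norm (- blinfun_cscale ((\<xi> - a) ^ n) (((o\<^sub>L) (R a) ^^ n) (R \<xi>)))
              \<le> norm (\<xi> - a) ^ n * (norm (R a) ^ n * (2 * norm (R a)))"
            unfolding norm_minus_cancel
            by (intro order_trans[OF norm_blinfun_cscale_le]) (simp add: norm_power mult_left_mono)
        qed (use B in auto)
        also have "\<dots> = norm h * (B * (2 * norm (R a)) * (norm (\<xi> - a) * norm (R a)) ^ n)"
          by (simp add: power_mult_distrib mult_ac)
        also have "\<dots> \<le> norm h * (B * (2 * norm (R a)) * (1/2) ^ n)"
          by (intro mult_left_mono power_mono small \<xi>) (use B in auto)
        also have "\<dots> \<le> norm h * e" by (intro mult_left_mono) (use elim in auto)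
        finally show "norm ((\<Sum>i<n. ?f' i \<xi> h) - ?g' \<xi> h) \<le> e * norm h" by (simp add: mult.commute)
      qed
    qed
  qed
  have "?f i a = 0" for i by (rule blinfun_eqI) simp
  then have "(\<lambda>i. ?f i a) sums 0" by simp
  then have "\<exists>\<Psi>. \<forall>\<xi>\<in>ball a r. (\<lambda>i. ?f i \<xi>) sums \<Psi> \<xi> \<and> (\<Psi> has_derivative ?g' \<xi>) (at \<xi> within ball a r)"
    by (intro has_derivative_series[OF convex_ball der conv, of a]) (use r in auto)
  then obtain \<Psi> where \<Psi>: "\<And>\<xi>. \<xi> \<in> ball a r \<Longrightarrow> (\<Psi> has_derivative ?g' \<xi>) (at \<xi> within ball a r)"
    by blast
  show thesis
  proof (rule that[OF r])
    show "ball a r \<subseteq> resolvent_set J" using \<rho> by blast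
    show "(\<Psi> has_derivative ?g' \<xi>) (at \<xi>)" if "\<xi> \<in> ball a r" for \<xi>
      using \<Psi>[OF that] at_within_open[OF that open_ball] by simp
  qed
qed

lemma bounded_linear_entry: "bounded_linear (\<lambda>A. seq_of (blinfun_apply A y) n)"
  by (rule bounded_linear_compose[OF bounded_linear_seq_of blinfun.bounded_linear_left])

text \<open>Entries of a local primitive are complex differentiable on a ball, hence holomorphic,
  and resolvent entries are their derivatives.\<close>

lemma resolvent_entry_holomorphic: "(\<lambda>\<xi>. seq_of (blinfun_apply (R \<xi>) y) n) holomorphic_on resolvent_set J"
proof (rule holomorphic_on_openI)
  fix a assume "a \<in> resolvent_set J"
  then obtain r \<Psi> where r: "0 < r"
    and \<Psi>: "\<And>\<xi>. \<xi> \<in> ball a r \<Longrightarrow> (\<Psi> has_derivative (\<lambda>h. blinfun_cscale (h * 1) (R \<xi>))) (at \<xi>)"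
    using resolvent_local_primitive[of a "\<lambda>_. 1"] holomorphic_on_const by metis
  have D: "((\<lambda>\<xi>. seq_of (blinfun_apply (\<Psi> \<xi>) y) n) has_field_derivative seq_of (blinfun_apply (R \<xi>) y) n) (at \<xi>)"
    if "\<xi> \<in> ball a r" for \<xi>
    using bounded_linear.has_derivative[OF bounded_linear_entry[of y n] \<Psi>[OF that]]
    unfolding has_field_derivative_def by (simp add: mult_commute_abs)
  then have "(\<lambda>\<xi>. seq_of (blinfun_apply (\<Psi> \<xi>) y) n) holomorphic_on ball a r"
    unfolding holomorphic_on_open[OF open_ball] by blast
  from holomorphic_deriv[OF this open_ball]
  have "(\<lambda>\<xi>. seq_of (blinfun_apply (R \<xi>) y) n) holomorphic_on ball a r"
    by (rule holomorphic_transform) (rule DERIV_imp_deriv[OF D])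
  with r show "\<exists>r>0. (\<lambda>\<xi>. seq_of (blinfun_apply (R \<xi>) y) n) holomorphic_on ball a r" by blast
qed

text \<open>For \<open>\<phi> \<xi> = (\<xi> - z) ^ k\<close> this is, up to a constant, the Laurent
  coefficient of the resolvent at exponent \<open>- k - 1\<close>; \<open>k = 0\<close> gives the
  Riesz projection.\<close>

definition contour_op :: "(complex \<Rightarrow> complex) \<Rightarrow> (real \<Rightarrow> complex) \<Rightarrow> ell2 \<Rightarrow>\<^sub>L ell2" where
  "contour_op \<phi> g = integral {0..1} (\<lambda>t. blinfun_cscale (vector_derivative g (at t) * \<phi> (g t)) (R (g t)))"

text \<open>On a short parameter interval a local primitive composed with \<open>g\<close> is
  continuous and an antiderivative of the integrand off finitely many points, so the strong
  fundamental theorem gives integrability there; the short intervals are then patched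
  together.\<close>

lemma contour_op_integrable:
  assumes g: "valid_path g" "path_image g \<subseteq> resolvent_set J" and \<phi>: "\<phi> holomorphic_on UNIV"
  shows "(\<lambda>t. blinfun_cscale (vector_derivative g (at t) * \<phi> (g t)) (R (g t))) integrable_on {0..1}"
proof -
  obtain K where K: "finite K" "continuous_on {0..1} g" "g C1_differentiable_on {0..1} - K"
    using g(1) unfolding valid_path_def piecewise_C1_differentiable_on_def by blast
  have g': "(g has_vector_derivative vector_derivative g (at t)) (at t)" if "t \<in> {0..1} - K" for t
    using K(3) that by (auto simp: C1_differentiable_on_eq vector_derivative_works)
  let ?F = "\<lambda>t. blinfun_cscale (vector_derivative g (at t) * \<phi> (g t)) (R (g t))"
  have "\<exists>d>0. \<forall>u v. x \<in> cbox u v \<and> cbox u v \<subseteq> ball x d \<and> cbox u v \<subseteq> cbox 0 1 \<longrightarrow> ?F integrable_on cbox u v"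
    if x: "x \<in> cbox 0 1" for x :: real
  proof -
    have "g x \<in> resolvent_set J" using g(2) x by (auto simp: path_image_def)
    then obtain r \<Psi> where r: "0 < r" and
      \<Psi>: "\<And>\<xi>. \<xi> \<in> ball (g x) r \<Longrightarrow> (\<Psi> has_derivative (\<lambda>h. blinfun_cscale (h * \<phi> \<xi>) (R \<xi>))) (at \<xi>)"
      using resolvent_local_primitive[OF _ \<phi>] by metis
    obtain d where d: "0 < d" "\<And>t. t \<in> {0..1} \<Longrightarrow> dist t x < d \<Longrightarrow> dist (g t) (g x) < r"
      using K(2) r x unfolding continuous_on_iff by (metis cbox_interval)
    have "?F integrable_on {u..v}" if uv: "x \<in> {u..v}" "{u..v} \<subseteq> ball x d" "{u..v} \<subseteq> {0..1}" for u v
    proof -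
      have near: "g t \<in> ball (g x) r" if "t \<in> {u..v}" for t
        using d(2)[of t] uv that by (auto simp: dist_commute subset_iff)
      have "(?F has_integral (\<Psi> (g v) - \<Psi> (g u))) {u..v}"
      proof (rule fundamental_theorem_of_calculus_strong[OF K(1)])
        show "u \<le> v" using uv(1) by simp
        show "((\<lambda>t. \<Psi> (g t)) has_vector_derivative ?F t) (at t)" if t: "t \<in> {u..v} - K" for t
        proof -
          have "t \<in> {0..1} - K" using t uv(3) by blast
          from has_derivative_compose[OF g'[OF this, unfolded has_vector_derivative_def] \<Psi>[OF near]] t
          have "((\<lambda>t. \<Psi> (g t)) has_derivative
              (\<lambda>h. blinfun_cscale (h *\<^sub>R vector_derivative g (at t) * \<phi> (g t)) (R (g t)))) (at t)" by blast
          moreover have "blinfun_cscale (h *\<^sub>R vector_derivative g (at t) * \<phi> (g t)) (R (g t)) = h *\<^sub>R ?F t" for h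
            by (intro blinfun_eqI ell2_eqI) (simp add: blinfun.bilinear_simps scaleR_conv_of_real)
          ultimately show ?thesis by (simp add: has_vector_derivative_def)
        qed
        show "continuous_on {u..v} (\<lambda>t. \<Psi> (g t))"
        proof (rule continuous_on_compose2[of "ball (g x) r" \<Psi>])
          show "continuous_on (ball (g x) r) \<Psi>"
            by (rule has_derivative_continuous_on) (use \<Psi> in \<open>blast intro: has_derivative_at_withinI\<close>)
          show "continuous_on {u..v} g" by (rule continuous_on_subset[OF K(2) uv(3)])
        qed (use near in auto)
      qed
      then show ?thesis by (rule has_integral_integrable)
    qed
    then show ?thesis using d(1) by (auto simp: cbox_interval)
  qed
  then show ?thesis
    using integrable_on_little_subintervals[of 0 "1::real" ?F] by (simp add: cbox_interval)
qed

lemma contour_op_entry: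
  assumes g: "valid_path g" "path_image g \<subseteq> resolvent_set J" and \<phi>: "\<phi> holomorphic_on UNIV"
  shows "((\<lambda>\<xi>. \<phi> \<xi> * seq_of (blinfun_apply (R \<xi>) y) n) has_contour_integral
    seq_of (blinfun_apply (contour_op \<phi> g) y) n) g"
  using has_integral_linear[OF integrable_integral[OF contour_op_integrable[OF assms]] bounded_linear_entry[of y n]]
  unfolding has_contour_integral contour_op_def by (simp add: o_def mult_ac)

lemma riesz_projection_eq:
  "riesz_projection J g = blinfun_cscale (- 1 / (2 * of_real pi * \<i>)) (contour_op (\<lambda>_. 1) g)"
  unfolding riesz_projection_def contour_op_def by simp

end

section \<open>Generalised eigenvectors and the Riesz projection\<close>

lemma inverse_power_contour_integral:
  assumes g: "valid_path g" "pathfinish g = pathstart g" "z \<notin> path_image g" "winding_number g z = 1"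
  shows "((\<lambda>\<xi>. 1 / (\<xi> - z) ^ Suc m) has_contour_integral (if m = 0 then 2 * of_real pi * \<i> else 0)) g"
proof (cases m)
  case 0
  then show ?thesis using has_contour_integral_winding_number[OF g(1,3)] g(4) by simp
next
  case (Suc k)
  have "((\<lambda>\<xi>. - 1 / (of_nat m * (\<xi> - z) ^ m)) has_field_derivative 1 / (\<xi> - z) ^ Suc m) (at \<xi> within - {z})"
    if "\<xi> \<in> - {z}" for \<xi>
  proof -
    have nz: "\<xi> - z \<noteq> 0" "of_nat m \<noteq> (0::complex)"
      using that unfolding Suc of_nat_eq_0_iff by auto
    have "((\<lambda>\<xi>. \<xi> - z) has_field_derivative 1) (at \<xi> within - {z})" by (auto intro!: derivative_eq_intros)
    from DERIV_cmult[OF DERIV_inverse'[OF DERIV_power[OF this, of m]], of "- 1 / of_nat m"] nz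
    have "((\<lambda>\<xi>. - 1 / of_nat m * inverse ((\<xi> - z) ^ m)) has_field_derivative
        (- 1 / of_nat m) * - (inverse ((\<xi> - z) ^ m) * (of_nat m * (1 * (\<xi> - z) ^ (m - Suc 0))) * inverse ((\<xi> - z) ^ m)))
        (at \<xi> within - {z})" by simp
    moreover have "(- 1 / of_nat m) * - (inverse ((\<xi> - z) ^ m) * (of_nat m * (1 * (\<xi> - z) ^ (m - Suc 0))) * inverse ((\<xi> - z) ^ m))
        = 1 / (\<xi> - z) ^ Suc m"
    proof -
      have "(\<xi> - z) ^ m = (\<xi> - z) * (\<xi> - z) ^ (m - Suc 0)" by (simp add: Suc)
      then show ?thesis using nz by (simp add: divide_simps)
    qed
    moreover have "(\<lambda>\<xi>. - 1 / of_nat m * inverse ((\<xi> - z) ^ m)) = (\<lambda>\<xi>. - 1 / (of_nat m * (\<xi> - z) ^ m))"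
      by (simp add: divide_inverse fun_eq_iff)
    ultimately show ?thesis by metis
  qed
  from contour_integral_primitive[OF this g(1)] g(2,3) Suc show ?thesis by auto
qed

lemma riesz_contour_notin: "riesz_contour J z g \<Longrightarrow> z \<notin> path_image g"
  by (auto simp: riesz_contour_def spec_def)

text \<open>The circle only ensures that the choice in \<open>algebraic_mult\<close> yields an
  admissible contour. Which one is chosen remains unknown, so the later facts are proved for all of
  them.\<close>

lemma riesz_contour_exists:
  assumes e: "0 < e" and z: "z \<in> spec J" and punctured: "ball z e - {z} \<subseteq> resolvent_set J"
  shows "\<exists>g. riesz_contour J z g"
proof
  let ?g = "circlepath z (e/2)"
  have "inside (sphere z (e/2)) = ball z (e/2)"
    using inside_frontier_eq_interior[of "cball z (e/2)"] e by simp
  moreover have "ball z (e/2) \<inter> spec J = {z}"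
  proof -
    have "\<xi> = z" if "\<xi> \<in> ball z (e/2)" "\<xi> \<in> spec J" for \<xi>
    proof (rule ccontr)
      assume "\<xi> \<noteq> z"
      moreover have "dist z \<xi> < e"
        using that(1) zero_le_dist[of z \<xi>] unfolding mem_ball by linarith
      ultimately have "\<xi> \<in> ball z e - {z}" by simp
      then show False using that(2) punctured by (auto simp: spec_def)
    qed
    then show ?thesis using e z by auto
  qed
  moreover have "sphere z (e/2) \<subseteq> resolvent_set J"
    using e punctured by (auto simp: subset_iff)
  ultimately show "riesz_contour J z ?g"
    using e by (simp add: riesz_contour_def winding_number_circlepath_centre simple_path_circlepath)
qed

context linear_operator
begin

lemma shift_add: "(x, y) \<in> shift J z \<Longrightarrow> (x', y') \<in> shift J z \<Longrightarrow> (x + x', y + y') \<in> shift J z"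
  unfolding shift_iff using J_add[of x "y + z *\<^sub>C x" x' "y' + z *\<^sub>C x'"]
  by (simp add: cell2.scale_right_distrib algebra_simps)

lemma shift_cscale: "(x, y) \<in> shift J z \<Longrightarrow> (c *\<^sub>C x, c *\<^sub>C y) \<in> shift J z"
  unfolding shift_iff using J_cscale[of x "y + z *\<^sub>C x" c]
  by (simp add: cell2.scale_right_distrib mult.commute)

lemma shift_power_cscale: "(x, y) \<in> shift J z ^^ k \<Longrightarrow> (c *\<^sub>C x, c *\<^sub>C y) \<in> shift J z ^^ k"
proof (induction k arbitrary: x y)
  case (Suc k)
  then obtain u where "(x, u) \<in> shift J z ^^ k" "(u, y) \<in> shift J z" by (auto elim: relpow_Suc_E)
  then show ?case using Suc.IH shift_cscale by (meson relpow_Suc_I)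
qed simp

text \<open>With \<open>v' = (J - z) v\<close> one has
  \<open>R \<xi> v = (R \<xi> v' - v) / (\<xi> - z)\<close>. Each step adds a factor to the
  denominator, so the claim carries an arbitrary \<open>m\<close>. The minus sign comes from the
  resolvent being the inverse of \<open>J - \<xi>\<close>.\<close>

lemma generalized_eigenvector_contour_integral:
  assumes g: "riesz_contour J z g" and v: "(v, 0) \<in> shift J z ^^ k"
  shows "((\<lambda>\<xi>. seq_of (blinfun_apply (R \<xi>) v) n / (\<xi> - z) ^ m) has_contour_integral
    (if m = 0 then - 2 * of_real pi * \<i> * seq_of v n else 0)) g"
  using v
proof (induction k arbitrary: v m)
  case 0
  then show ?case by (simp add: blinfun.zero_right has_contour_integral_0)
next
  case (Suc k)
  note path = g[unfolded riesz_contour_def]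
  obtain v' where v': "(v, v') \<in> shift J z" "(v', 0) \<in> shift J z ^^ k"
    using relpow_Suc_D2[OF Suc.prems] by blast
  have eq: "seq_of (blinfun_apply (R \<xi>) v) n / (\<xi> - z) ^ m
      = seq_of (blinfun_apply (R \<xi>) v') n / (\<xi> - z) ^ Suc m - seq_of v n * (1 / (\<xi> - z) ^ Suc m)"
    if "\<xi> \<in> path_image g" for \<xi>
  proof -
    have \<xi>: "\<xi> \<in> resolvent_set J" "\<xi> - z \<noteq> 0" using that path riesz_contour_notin[OF g] by auto
    have "(v, (v' - (\<xi> - z) *\<^sub>C v) + \<xi> *\<^sub>C v) \<in> J"
      using v'(1) by (simp add: shift_iff cell2.scale_left_diff_distrib)
    from resolvent_eqI[OF \<xi>(1) this]
    have "blinfun_apply (R \<xi>) v' - (\<xi> - z) *\<^sub>C blinfun_apply (R \<xi>) v = v"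
      by (simp add: blinfun.diff_right resolvent_cscale[OF \<xi>(1)])
    from arg_cong[OF this, of "\<lambda>u. seq_of u n"]
    have "seq_of (blinfun_apply (R \<xi>) v') n - (\<xi> - z) * seq_of (blinfun_apply (R \<xi>) v) n = seq_of v n" by simp
    then have "seq_of (blinfun_apply (R \<xi>) v) n = (seq_of (blinfun_apply (R \<xi>) v') n - seq_of v n) / (\<xi> - z)"
      using \<xi>(2) by (simp add: field_simps)
    then show ?thesis by (simp add: diff_divide_distrib)
  qed
  have "((\<lambda>\<xi>. seq_of (blinfun_apply (R \<xi>) v') n / (\<xi> - z) ^ Suc m - seq_of v n * (1 / (\<xi> - z) ^ Suc m))
      has_contour_integral (0 - seq_of v n * (if m = 0 then 2 * of_real pi * \<i> else 0))) g"
    using Suc.IH[OF v'(2), of "Suc m"]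
    by (intro has_contour_integral_diff has_contour_integral_lmul inverse_power_contour_integral)
      (use path riesz_contour_notin[OF g] in auto)
  from has_contour_integral_eq[OF this eq[symmetric]] show ?case by (simp add: mult.commute split: if_splits)
qed

lemma riesz_projection_generalized_eigenvector:
  assumes g: "riesz_contour J z g" and v: "(v, 0) \<in> shift J z ^^ k"
  shows "blinfun_apply (riesz_projection J g) v = v"
proof (rule ell2_eqI)
  fix n
  have "((\<lambda>\<xi>. 1 * seq_of (blinfun_apply (R \<xi>) v) n) has_contour_integral
      seq_of (blinfun_apply (contour_op (\<lambda>_. 1) g) v) n) g"
    using g by (intro contour_op_entry) (auto simp: riesz_contour_def)
  with generalized_eigenvector_contour_integral[OF g v, of n 0]
  have "seq_of (blinfun_apply (contour_op (\<lambda>_. 1) g) v) n = - 2 * of_real pi * \<i> * seq_of v n"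
    using has_contour_integral_unique by fastforce
  then show "seq_of (blinfun_apply (riesz_projection J g) v) n = seq_of v n"
    by (simp add: riesz_projection_eq)
qed

text \<open>Multiplied by \<open>(\<xi> - z) ^ \<nu>\<close>, each resolvent entry is bounded near
  \<open>z\<close>, so the singularity is removable and the global Cauchy theorem applies to the
  extension.\<close>

lemma contour_op_pole_order_eq_0:
  assumes g: "riesz_contour J z g" and e: "0 < e"
    and bound: "\<And>\<xi>. \<xi> \<in> ball z e - {z} \<Longrightarrow> \<xi> \<in> resolvent_set J \<and> norm ((\<xi> - z) ^ \<nu>) * norm (R \<xi>) \<le> C"
  shows "blinfun_apply (contour_op (\<lambda>\<xi>. (\<xi> - z) ^ \<nu>) g) y = 0"
proof (rule ell2_eqI)
  fix n
  note path = g[unfolded riesz_contour_def]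
  let ?h = "\<lambda>\<xi>. (\<xi> - z) ^ \<nu> * seq_of (blinfun_apply (R \<xi>) y) n"
  let ?S = "resolvent_set J \<union> ball z e"
  have S: "?S - {z} \<subseteq> resolvent_set J" using bound by blast
  have "?h holomorphic_on ?S - {z}"
    by (intro holomorphic_intros holomorphic_on_subset[OF resolvent_entry_holomorphic S])
  moreover have "z \<in> interior ?S"
    using e open_resolvent_set by (simp add: interior_open open_Un)
  moreover have "\<forall>\<^sub>F \<xi> in at z. norm (?h \<xi>) \<le> C * norm y"
    unfolding eventually_at
  proof (intro exI[of _ e] conjI ballI impI e)
    fix \<xi> assume "\<xi> \<noteq> z \<and> dist \<xi> z < e"
    then have "norm ((\<xi> - z) ^ \<nu>) * norm (R \<xi>) \<le> C" using bound[of \<xi>] by (simp add: dist_commute)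
    then have "norm ((\<xi> - z) ^ \<nu>) * norm (R \<xi>) * norm y \<le> C * norm y" by (rule mult_right_mono) simp
    moreover have "norm (?h \<xi>) \<le> norm ((\<xi> - z) ^ \<nu>) * (norm (R \<xi>) * norm y)"
      unfolding norm_mult by (intro mult_left_mono order_trans[OF norm_seq_of_le norm_blinfun]) simp
    ultimately show "norm (?h \<xi>) \<le> C * norm y" by (simp add: mult.assoc)
  qed
  ultimately obtain k where k: "k holomorphic_on ?S" "\<And>\<xi>. \<xi> \<in> ?S - {z} \<Longrightarrow> k \<xi> = ?h \<xi>"
    using holomorphic_on_extend_bounded[of ?h ?S z] by blast
  have "(k has_contour_integral 0) g"
  proof (rule Cauchy_theorem_global[OF _ k(1)])
    \<comment> \<open>Points outside the domain of the extension are spectral points other than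
      \<open>z\<close>; the contour encloses none of these, so its winding number about them is
      0.\<close>
    fix \<zeta> assume \<zeta>: "\<zeta> \<notin> ?S"
    then have "\<zeta> \<noteq> z" "\<zeta> \<notin> path_image g" using path e by auto
    moreover have "\<zeta> \<in> spec J" using \<zeta> by (simp add: spec_def)
    ultimately have "\<zeta> \<in> outside (path_image g)"
      using path inside_Un_outside[of "path_image g"] by blast
    then show "winding_number g \<zeta> = 0"
      using path by (intro winding_number_zero_in_outside valid_path_imp_path) auto
  qed (use path open_resolvent_set in auto)
  moreover have "k \<xi> = ?h \<xi>" if "\<xi> \<in> path_image g" for \<xi>
    using that path riesz_contour_notin[OF g] by (intro k(2)) auto
  ultimately have "(?h has_contour_integral 0) g" by (rule has_contour_integral_eq)
  moreover have "(?h has_contour_integral seq_of (blinfun_apply (contour_op (\<lambda>\<xi>. (\<xi> - z) ^ \<nu>) g) y) n) g"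
    using path by (intro contour_op_entry) (auto intro!: holomorphic_intros)
  ultimately show "seq_of (blinfun_apply (contour_op (\<lambda>\<xi>. (\<xi> - z) ^ \<nu>) g) y) n = seq_of 0 n"
    by (simp add: has_contour_integral_unique)
qed

end

section \<open>Laurent coefficients of the resolvent and Jordan chains\<close>

sublocale jacobi_data \<subseteq> linear_operator "J_max lam w"
  by unfold_locales (auto intro: J_max_add J_max_cscale)

context jacobi_data
begin

abbreviation "J \<equiv> J_max lam w"

text \<open>\<open>(J - z) R \<xi> = I + (\<xi> - z) R \<xi>\<close>, and the integral of the entire
  term \<open>(\<xi> - z) ^ k\<close> vanishes. Since \<open>J\<close> involves only three entries
  at a time, it passes under the integral without any closedness argument.\<close>

lemma contour_op_step:
  assumes g: "riesz_contour J z g"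
  shows "(blinfun_apply (contour_op (\<lambda>\<xi>. (\<xi> - z) ^ k) g) y,
    blinfun_apply (contour_op (\<lambda>\<xi>. (\<xi> - z) ^ Suc k) g) y) \<in> shift J z"
proof -
  note path = g[unfolded riesz_contour_def]
  let ?r = "\<lambda>\<xi> n. seq_of (blinfun_apply (R \<xi>) y) n"
  let ?p = "\<lambda>k n. seq_of (blinfun_apply (contour_op (\<lambda>\<xi>. (\<xi> - z) ^ k) g) y) n"
  have p: "((\<lambda>\<xi>. (\<xi> - z) ^ k * ?r \<xi> n) has_contour_integral ?p k n) g" for k n
    using path by (intro contour_op_entry) (auto intro!: holomorphic_intros)
  have "jacobi lam w (?p k) n = ?p (Suc k) n + z * ?p k n" for n
  proof -
    have "((\<lambda>\<xi>. w (n - 1) * ((\<xi> - z) ^ k * ?r \<xi> (n - 1)) + lam n * ((\<xi> - z) ^ k * ?r \<xi> n)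
        + w n * ((\<xi> - z) ^ k * ?r \<xi> (n + 1))) has_contour_integral jacobi lam w (?p k) n) g"
      unfolding jacobi_def by (intro has_contour_integral_add has_contour_integral_lmul p)
    moreover have "w (n - 1) * ((\<xi> - z) ^ k * ?r \<xi> (n - 1)) + lam n * ((\<xi> - z) ^ k * ?r \<xi> n)
        + w n * ((\<xi> - z) ^ k * ?r \<xi> (n + 1))
        = (\<xi> - z) ^ k * seq_of y n + ((\<xi> - z) ^ Suc k * ?r \<xi> n + z * ((\<xi> - z) ^ k * ?r \<xi> n))"
      if "\<xi> \<in> path_image g" for \<xi>
    proof -
      have "jacobi lam w (?r \<xi>) n = seq_of y n + \<xi> * ?r \<xi> n"
        using resolvent_in[of \<xi> y] that path by (auto simp: J_max_iff fun_eq_iff)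
      from arg_cong[OF this, of "\<lambda>u. (\<xi> - z) ^ k * u"] show ?thesis
        by (simp add: jacobi_def algebra_simps)
    qed
    ultimately have "((\<lambda>\<xi>. (\<xi> - z) ^ k * seq_of y n + ((\<xi> - z) ^ Suc k * ?r \<xi> n + z * ((\<xi> - z) ^ k * ?r \<xi> n)))
        has_contour_integral jacobi lam w (?p k) n) g"
      by (rule has_contour_integral_eq)
    moreover have "((\<lambda>\<xi>. (\<xi> - z) ^ k * seq_of y n) has_contour_integral 0) g"
      using path by (intro Cauchy_theorem_global[of UNIV]) (auto intro!: holomorphic_intros)
    then have "((\<lambda>\<xi>. (\<xi> - z) ^ k * seq_of y n + ((\<xi> - z) ^ Suc k * ?r \<xi> n + z * ((\<xi> - z) ^ k * ?r \<xi> n)))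
        has_contour_integral (0 + (?p (Suc k) n + z * ?p k n))) g"
      by (intro has_contour_integral_add has_contour_integral_lmul p)
    ultimately show ?thesis using has_contour_integral_unique by fastforce
  qed
  then show ?thesis by (simp add: shift_iff J_max_iff fun_eq_iff)
qed

text \<open>\<open>J - z\<close> moves from one Laurent coefficient to the next, and the bound on
  the pole order makes the coefficient with index \<open>\<nu>\<close> zero.\<close>

lemma riesz_projection_range:
  assumes g: "riesz_contour J z g" and e: "0 < e"
    and bound: "\<And>\<xi>. \<xi> \<in> ball z e - {z} \<Longrightarrow> \<xi> \<in> resolvent_set J \<and> norm ((\<xi> - z) ^ \<nu>) * norm (R \<xi>) \<le> C"
  shows "(blinfun_apply (riesz_projection J g) y, 0) \<in> shift J z ^^ \<nu>"
proof -
  let ?p = "\<lambda>k. blinfun_apply (contour_op (\<lambda>\<xi>. (\<xi> - z) ^ k) g) y"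
  have "(?p 0, ?p k) \<in> shift J z ^^ k" for k
  proof (induction k)
    case (Suc k)
    then show ?case by (rule relpow_Suc_I[OF _ contour_op_step[OF g]])
  qed simp
  then have "(?p 0, 0) \<in> shift J z ^^ \<nu>"
    using contour_op_pole_order_eq_0[OF g e bound, of y] by metis
  from shift_power_cscale[OF this, of "- 1 / (2 * of_real pi * \<i>)"] show ?thesis
    by (simp add: riesz_projection_eq)
qed

lemma span_image_lessThan_preimage:
  assumes step: "\<And>j. j < k \<Longrightarrow> (v (Suc j), of_nat (Suc j) *\<^sub>C v j) \<in> shift J z"
    and x: "x \<in> cell2.span (v ` {..<k})"
  shows "\<exists>u\<in>cell2.span (v ` {..<Suc k}). (u, x) \<in> shift J z"
  using x
proof (rule cell2.span_induct)
  show "cell2.subspace {x. \<exists>u\<in>cell2.span (v ` {..<Suc k}). (u, x) \<in> shift J z}"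
  proof (rule cell2.subspaceI; clarsimp)
    show "\<exists>u\<in>cell2.span (v ` {..<Suc k}). (u, 0) \<in> shift J z"
      by (intro bexI[of _ 0] cell2.span_zero) (simp add: shift_iff J_max_iff jacobi_def fun_eq_iff)
  next
    fix x x' u u' assume "u \<in> cell2.span (v ` {..<Suc k})" "(u, x) \<in> shift J z"
      "u' \<in> cell2.span (v ` {..<Suc k})" "(u', x') \<in> shift J z"
    then show "\<exists>u\<in>cell2.span (v ` {..<Suc k}). (u, x + x') \<in> shift J z"
      by (intro bexI[of _ "u + u'"] shift_add cell2.span_add)
  next
    fix c x u assume "u \<in> cell2.span (v ` {..<Suc k})" "(u, x) \<in> shift J z"
    then show "\<exists>u\<in>cell2.span (v ` {..<Suc k}). (u, c *\<^sub>C x) \<in> shift J z"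
      by (intro bexI[of _ "c *\<^sub>C u"] shift_cscale cell2.span_scale)
  qed
next
  fix x assume "x \<in> v ` {..<k}"
  then obtain j where j: "j < k" "x = v j" by auto
  have "v (Suc j) \<in> cell2.span (v ` {..<Suc k})" using j by (intro cell2.span_base) auto
  moreover have "((1 / of_nat (Suc j)) *\<^sub>C v (Suc j), x) \<in> shift J z"
    using shift_cscale[OF step[OF j(1)], of "1 / of_nat (Suc j)"] j(2) by (simp del: of_nat_Suc)
  ultimately show "\<exists>u\<in>cell2.span (v ` {..<Suc k}). (u, x) \<in> shift J z"
    by (meson cell2.span_scale)
qed

text \<open>By induction \<open>(J - z) x\<close> lies in the span of the shorter chain and has a
  preimage \<open>u\<close> in the span of the longer one. Then \<open>x - u\<close> lies in the
  one-dimensional kernel, spanned by \<open>v 0\<close>.\<close>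

lemma kernel_shift_power_subset:
  assumes JJ: "J_min lam w = J" and v0: "v 0 \<noteq> 0" "(v 0, 0) \<in> shift J z"
    and step: "\<And>j. Suc j < k \<Longrightarrow> (v (Suc j), of_nat (Suc j) *\<^sub>C v j) \<in> shift J z"
  shows "(x, 0) \<in> shift J z ^^ k \<Longrightarrow> x \<in> cell2.span (v ` {..<k})"
  using step
proof (induction k arbitrary: x)
  case (Suc k)
  obtain x' where x': "(x, x') \<in> shift J z" "(x', 0) \<in> shift J z ^^ k"
    using relpow_Suc_D2[OF Suc.prems(1)] by blast
  have "x' \<in> cell2.span (v ` {..<k})" using Suc.IH[OF x'(2)] Suc.prems(2) by simp
  then obtain u where u: "u \<in> cell2.span (v ` {..<Suc k})" "(u, x') \<in> shift J z"
    using span_image_lessThan_preimage[of k v z x'] Suc.prems(2) by auto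
  have "(x - u, 0) \<in> shift J z"
    using shift_add[OF x'(1) shift_cscale[OF u(2), of "-1"]] by simp
  then have "x - u \<in> kernel (shift J z)" by (simp add: kernel_def)
  also have "kernel (shift J z) = cell2.span {v 0}"
    using v0 by (intro kernel_eq_span[OF w_nonzero JJ]) (simp add: kernel_def)
  also have "\<dots> \<subseteq> cell2.span (v ` {..<Suc k})" by (rule cell2.span_mono) auto
  finally show ?case using cell2.span_add[OF _ u(1), of "x - u"] by simp
qed simp

lemma single_valued_shift: "single_valued (shift J z)"
proof (rule single_valuedI)
  fix x y y' assume "(x, y) \<in> shift J z" "(x, y') \<in> shift J z"
  then have "seq_of (y + z *\<^sub>C x) = seq_of (y' + z *\<^sub>C x)" by (simp only: shift_iff J_max_iff)
  then show "y = y'" by (simp only: seq_of_inject add_right_cancel)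
qed

lemma shift_power_chain:
  assumes "\<And>i. Suc i \<le> j \<Longrightarrow> (v (Suc i), of_nat (Suc i) *\<^sub>C v i) \<in> shift J z"
  shows "(v j, fact j *\<^sub>C v 0) \<in> shift J z ^^ j"
  using assms
proof (induction j)
  case (Suc j)
  have "(of_nat (Suc j) *\<^sub>C v j, of_nat (Suc j) *\<^sub>C (fact j *\<^sub>C v 0)) \<in> shift J z ^^ j"
    using Suc by (intro shift_power_cscale) simp
  with Suc.prems[of j] have "(v (Suc j), of_nat (Suc j) *\<^sub>C (fact j *\<^sub>C v 0)) \<in> shift J z ^^ Suc j"
    by (intro relpow_Suc_I2) auto
  then show ?case by (simp add: mult.commute del: of_nat_Suc)
qed simp

lemma zero_shift_power: "(0, 0) \<in> shift J z ^^ k"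
proof (induction k)
  case (Suc k)
  moreover have "(0, 0) \<in> shift J z" by (simp add: shift_iff J_max_iff jacobi_def fun_eq_iff)
  ultimately show ?case by (rule relpow_Suc_I)
qed simp

lemma shift_power_add: "(x, y) \<in> shift J z ^^ k \<Longrightarrow> (x', y') \<in> shift J z ^^ k \<Longrightarrow> (x + x', y + y') \<in> shift J z ^^ k"
proof (induction k arbitrary: y y')
  case (Suc k)
  then obtain u u' where "(x, u) \<in> shift J z ^^ k" "(u, y) \<in> shift J z"
    "(x', u') \<in> shift J z ^^ k" "(u', y') \<in> shift J z" by (meson relpow_Suc_E)
  then show ?case using Suc.IH shift_add by (meson relpow_Suc_I)
qed simp

lemma kernel_shift_power_eq:
  assumes JJ: "J_min lam w = J" and v0: "v 0 \<noteq> 0" "(v 0, 0) \<in> shift J z"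
    and step: "\<And>j. Suc j < k \<Longrightarrow> (v (Suc j), of_nat (Suc j) *\<^sub>C v j) \<in> shift J z"
  shows "kernel (shift J z ^^ k) = cell2.span (v ` {..<k})"
proof
  show "kernel (shift J z ^^ k) \<subseteq> cell2.span (v ` {..<k})"
    using kernel_shift_power_subset[OF JJ v0 step] by (auto simp: kernel_def)
  show "cell2.span (v ` {..<k}) \<subseteq> kernel (shift J z ^^ k)"
  proof (rule cell2.span_minimal)
    show "cell2.subspace (kernel (shift J z ^^ k))"
    proof (rule cell2.subspaceI)
      show "0 \<in> kernel (shift J z ^^ k)" by (simp add: kernel_def zero_shift_power)
      show "x + y \<in> kernel (shift J z ^^ k)"
        if "x \<in> kernel (shift J z ^^ k)" "y \<in> kernel (shift J z ^^ k)" for x y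
        using shift_power_add[of x 0 k z y 0] that by (simp add: kernel_def)
      show "c *\<^sub>C x \<in> kernel (shift J z ^^ k)" if "x \<in> kernel (shift J z ^^ k)" for c x
        using shift_power_cscale[of x 0 k z c] that by (simp add: kernel_def)
    qed
    show "v ` {..<k} \<subseteq> kernel (shift J z ^^ k)"
    proof clarify
      fix j assume "j < k"
      then have "(v j, fact j *\<^sub>C v 0) \<in> shift J z ^^ j" by (intro shift_power_chain step) auto
      moreover have "(fact j *\<^sub>C v 0, 0) \<in> shift J z" using shift_cscale[OF v0(2)] by simp
      ultimately have "(v j, 0) \<in> shift J z ^^ Suc j" by (rule relpow_Suc_I)
      then have "(v j, 0) \<in> shift J z ^^ (Suc j + (k - Suc j))"
        unfolding relpow_add by (rule relcompI[OF _ zero_shift_power])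
      then show "v j \<in> kernel (shift J z ^^ k)" using \<open>j < k\<close> by (simp add: kernel_def)
    qed
  qed
qed

text \<open>Were \<open>v k\<close> in the span of its predecessors, \<open>(J - z) ^ k\<close>
  would annihilate it; but that power sends it to \<open>fact k *\<^sub>C v 0\<close>, which is
  nonzero.\<close>

lemma independent_chain:
  assumes JJ: "J_min lam w = J" and v0: "v 0 \<noteq> 0" "(v 0, 0) \<in> shift J z"
    and step: "\<And>j. Suc j < k \<Longrightarrow> (v (Suc j), of_nat (Suc j) *\<^sub>C v j) \<in> shift J z"
  shows "cell2.independent (v ` {..<k}) \<and> card (v ` {..<k}) = k"
  using step
proof (induction k)
  case (Suc k)
  have IH: "cell2.independent (v ` {..<k})" "card (v ` {..<k}) = k"
    using Suc.IH Suc.prems by auto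
  have "v k \<notin> cell2.span (v ` {..<k})"
  proof
    assume "v k \<in> cell2.span (v ` {..<k})"
    then have "v k \<in> kernel (shift J z ^^ k)"
      using kernel_shift_power_eq[OF JJ, of v z k] v0 Suc.prems by simp
    then have 1: "(v k, 0) \<in> shift J z ^^ k" by (simp add: kernel_def)
    have 2: "(v k, fact k *\<^sub>C v 0) \<in> shift J z ^^ k"
      by (rule shift_power_chain) (use Suc.prems in auto)
    have "fact k *\<^sub>C v 0 = 0"
      by (rule single_valuedD[OF single_valued_relpow[OF single_valued_shift] 2 1])
    then show False using v0(1) by simp
  qed
  moreover from this have "v k \<notin> v ` {..<k}" using cell2.span_base[of "v k" "v ` {..<k}"] by argo
  ultimately show ?case using IH by (simp add: lessThan_Suc cell2.independent_insert)
qed (simp add: cell2.independent_empty)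

end

section \<open>Limit points of the diagonal and the spectrum\<close>

text \<open>Indices are counted, not values, so a value repeated infinitely often is a limit point.
  For the converse, indices of strictly growing modulus are selected, which makes them
  distinct.\<close>

lemma der_iff: "l \<in> der lam \<longleftrightarrow> (\<forall>e>0. infinite {n. dist (lam n) l < e})"
proof
  assume "l \<in> der lam"
  then obtain n :: "nat \<Rightarrow> int" where n: "inj n" "(\<lambda>k. lam (n k)) \<longlonglongrightarrow> l" by (auto simp: der_def)
  show "\<forall>e>0. infinite {n. dist (lam n) l < e}"
  proof (intro allI impI)
    fix e :: real assume "0 < e"
    then obtain N where N: "\<And>k. k \<ge> N \<Longrightarrow> dist (lam (n k)) l < e"
      using n(2) by (auto simp: lim_sequentially)
    have "infinite (n ` {N..})"
      using n(1) by (simp add: finite_image_iff inj_on_subset infinite_Ici)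
    moreover have "n ` {N..} \<subseteq> {n. dist (lam n) l < e}" using N by auto
    ultimately show "infinite {n. dist (lam n) l < e}" using finite_subset by blast
  qed
next
  assume inf: "\<forall>e>0. infinite {n. dist (lam n) l < e}"
  have next_index: "\<exists>y. dist (lam y) l < e \<and> \<bar>x\<bar> < \<bar>y\<bar>" if "0 < e" for e and x :: int
  proof (rule ccontr)
    assume "\<nexists>y. dist (lam y) l < e \<and> \<bar>x\<bar> < \<bar>y\<bar>"
    then have "{n. dist (lam n) l < e} \<subseteq> {- \<bar>x\<bar>..\<bar>x\<bar>}" by force
    then show False using inf that finite_subset by blast
  qed
  have "\<exists>n. \<forall>k. dist (lam (n k)) l < 1 / real (Suc k) \<and> \<bar>n k\<bar> < \<bar>n (Suc k)\<bar>"
  proof (rule dependent_nat_choice)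
    show "\<exists>x. dist (lam x) l < 1 / real (Suc 0)" using next_index[of 1] by auto
    show "\<exists>y. dist (lam y) l < 1 / real (Suc (Suc k)) \<and> \<bar>x\<bar> < \<bar>y\<bar>" for x k
      by (rule next_index) simp
  qed
  then obtain n where n: "\<And>k. dist (lam (n k)) l < 1 / real (Suc k)" "\<And>k. \<bar>n k\<bar> < \<bar>n (Suc k)\<bar>" by blast
  have "inj (\<lambda>k. \<bar>n k\<bar>)" by (intro strict_mono_imp_inj_on) (simp add: strict_mono_Suc_iff n(2))
  then have "inj n" by (auto simp: inj_on_def)
  moreover have "(\<lambda>k. lam (n k)) \<longlonglongrightarrow> l"
  proof (rule metric_tendsto_imp_tendsto[OF LIMSEQ_inverse_real_of_nat])
    show "\<forall>\<^sub>F k in sequentially. dist (lam (n k)) l \<le> dist (inverse (real (Suc k))) 0"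
      using n(1) by (auto intro!: always_eventually less_imp_le simp: divide_inverse dist_real_def simp del: of_nat_Suc)
  qed
  ultimately show "l \<in> der lam" by (auto simp: der_def)
qed

lemma open_Compl_der: "open (- der lam)"
  unfolding open_contains_ball
proof
  fix l assume "l \<in> - der lam"
  then obtain e where e: "0 < e" "finite {n. dist (lam n) l < e}" by (auto simp: der_iff)
  have "l' \<notin> der lam" if "l' \<in> ball l (e/2)" for l'
  proof -
    have "{n. dist (lam n) l' < e/2} \<subseteq> {n. dist (lam n) l < e}"
    proof clarify
      fix n assume "dist (lam n) l' < e/2"
      then show "dist (lam n) l < e"
        using dist_triangle[of "lam n" l l'] that by (simp add: dist_commute)
    qed
    then show ?thesis using e finite_subset by (auto simp: der_iff intro!: exI[of _ "e/2"])
  qed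
  then show "\<exists>e>0. ball l e \<subseteq> - der lam" using e(1) by (intro exI[of _ "e/2"]) auto
qed

text \<open>A point of the closure outside the range is approached by infinitely many values, hence
  by infinitely many indices. So \<open>C0 lam\<close> differs from the complement of
  \<open>der lam\<close> by a countable set only.\<close>

lemma C0_eq: "C0 lam = - der lam - range lam"
proof -
  have "l \<in> der lam" if "l \<in> closure (range lam)" "l \<notin> range lam" for l
    unfolding der_iff
  proof (intro allI impI)
    fix e :: real assume "0 < e"
    have "l islimpt range lam" using that by (simp add: closure_def)
    then have "infinite (range lam \<inter> ball l e)"
      using \<open>0 < e\<close> by (simp add: islimpt_eq_infinite_ball)
    moreover have "range lam \<inter> ball l e \<subseteq> lam ` {n. dist (lam n) l < e}" by (auto simp: dist_commute)
    ultimately show "infinite {n. dist (lam n) l < e}"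
      using finite_subset finite_imageI by blast
  qed
  moreover have "der lam \<subseteq> closure (range lam)"
  proof
    fix l assume "l \<in> der lam"
    then obtain n :: "nat \<Rightarrow> int" where "(\<lambda>k. lam (n k)) \<longlonglongrightarrow> l" by (auto simp: der_def)
    then show "l \<in> closure (range lam)"
      unfolding closure_sequential by (intro exI[of _ "\<lambda>k. lam (n k)"]) simp
  qed
  ultimately show ?thesis
    unfolding C0_def using closure_subset[of "range lam"] by blast
qed

text \<open>Removing countably many points does not disconnect an open connected subset of the
  plane. Connectedness turns nonvanishing of \<open>char_fun\<close> at one point into finite order
  at each of its zeros.\<close>

lemma connected_C0: "connected (- der lam) \<Longrightarrow> connected (C0 lam)"
  unfolding C0_eq by (rule connected_open_diff_countable) (auto simp: open_Compl_der)

context jacobi_data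
begin

lemma char_fun_eq_0_on_spec:
  assumes JJ: "J_min lam w = J" and z: "z \<in> spec J" "z \<in> C0 lam"
  shows "char_fun lam \<gamma> z = 0"
proof (rule ccontr)
  assume F: "char_fun lam \<gamma> z \<noteq> 0"
  obtain r C where "0 < r" "\<And>\<xi>. \<xi> \<in> cball z r \<Longrightarrow> char_fun lam \<gamma> \<xi> \<noteq> 0 \<Longrightarrow>
      \<exists>R. is_resolvent J \<xi> R \<and> norm (char_fun lam \<gamma> \<xi>) * norm R \<le> C"
    using resolvent_local_bound[OF JJ z(2)] by metis
  then have "\<exists>R. is_resolvent J z R" using F by (meson centre_in_cball less_imp_le)
  then have "z \<in> resolvent_set J" by (simp add: resolvent_set_def)
  with z(1) show False by (simp add: spec_def)
qed

theorem spectral_point: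
  assumes JJ: "J_min lam w = J" and conn: "connected (C0 lam)"
    and nonzero: "\<exists>z\<in>C0 lam. char_fun lam \<gamma> z \<noteq> 0" and z: "z \<in> spec J" "z \<in> C0 lam"
  shows "z isolated_in spec J \<and> z \<in> point_spec J \<and>
    int (algebraic_mult J z) = zorder (char_fun lam \<gamma>) z \<and>
    (\<forall>j<algebraic_mult J z. f_deriv lam w \<gamma> j z \<in> range seq_of) \<and>
    generalized_eigenspace J z = cell2.span {v. \<exists>j<algebraic_mult J z. seq_of v = f_deriv lam w \<gamma> j z}"
proof -
  let ?F = "char_fun lam \<gamma>"
  define \<nu> where "\<nu> = nat (zorder ?F z)"
  define h where "h = zor_poly ?F z"
  have F0: "?F z = 0" by (rule char_fun_eq_0_on_spec[OF JJ z])
  from zorder_exist_zero[OF char_fun_holomorphic open_C0 conn z(2) nonzero] F0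
  obtain r1 where zo: "0 < zorder ?F z" and r1: "0 < r1" "cball z r1 \<subseteq> C0 lam" "h holomorphic_on cball z r1"
    and h: "\<And>\<xi>. \<xi> \<in> cball z r1 \<Longrightarrow> ?F \<xi> = h \<xi> * (\<xi> - z) ^ \<nu>" "\<And>\<xi>. \<xi> \<in> cball z r1 \<Longrightarrow> h \<xi> \<noteq> 0"
    unfolding \<nu>_def h_def by auto
  have \<nu>: "0 < \<nu>" "int \<nu> = zorder ?F z" using zo by (auto simp: \<nu>_def)
  obtain r2 C where r2: "0 < r2" "\<And>\<xi>. \<xi> \<in> cball z r2 \<Longrightarrow> ?F \<xi> \<noteq> 0 \<Longrightarrow>
      \<exists>R. is_resolvent J \<xi> R \<and> norm (?F \<xi>) * norm R \<le> C"
    using resolvent_local_bound[OF JJ z(2)] by metis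
  \<comment> \<open>Since \<open>(\<xi> - z) ^ \<nu>\<close> is \<open>char_fun\<close> divided by
    \<open>h\<close>, a bound on \<open>1 / h\<close> turns the bound on \<open>char_fun\<close>
    times the resolvent into a bound on the pole order.\<close>
  have "compact ((\<lambda>\<xi>. 1 / h \<xi>) ` cball z r1)"
    using h(2) by (intro compact_continuous_image continuous_intros holomorphic_on_imp_continuous_on[OF r1(3)]) auto
  then obtain B where B: "0 < B" "\<And>\<xi>. \<xi> \<in> cball z r1 \<Longrightarrow> norm (1 / h \<xi>) \<le> B"
    using compact_imp_bounded bounded_pos by (metis (no_types, lifting) imageI)
  define e where "e = min r1 r2"
  have e: "0 < e" using r1 r2 by (simp add: e_def)
  have bound: "\<xi> \<in> resolvent_set J \<and> norm ((\<xi> - z) ^ \<nu>) * norm (R \<xi>) \<le> C * B" if "\<xi> \<in> ball z e - {z}" for \<xi>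
  proof -
    have \<xi>: "\<xi> \<in> cball z r1" "\<xi> \<in> cball z r2" "\<xi> \<noteq> z" using that by (auto simp: e_def)
    then have "?F \<xi> \<noteq> 0" using h by simp
    then obtain S where S: "is_resolvent J \<xi> S" "norm (?F \<xi>) * norm S \<le> C" using r2(2) \<xi>(2) by blast
    have "norm ((\<xi> - z) ^ \<nu>) * norm S = (norm (?F \<xi>) * norm S) * norm (1 / h \<xi>)"
      using h(1,2)[OF \<xi>(1)] by (simp add: norm_mult norm_divide)
    also have "\<dots> \<le> C * B"
      by (intro mult_mono S B \<xi>) (auto intro: order_trans[OF _ S(2)])
    finally show ?thesis using S(1) by (auto simp: resolvent_eq[OF S(1)] resolvent_set_def)
  qed
  have punctured: "ball z e - {z} \<subseteq> resolvent_set J" using bound by blast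
  have "z isolated_in spec J"
    unfolding isolated_in_def
  proof (intro conjI exI[of _ "ball z e"])
    have "z \<in> ball z e" using e by simp
    then show "ball z e \<inter> spec J = {z}"
      using punctured z(1) unfolding spec_def by blast
  qed (use z in auto)
  have in_ell2: "f_deriv lam w \<gamma> j z \<in> range seq_of" if "j < \<nu>" for j
    by (rule f_deriv_in_ell2[OF z(2) r1(1) _ _ that, of h])
      (auto intro!: holomorphic_on_subset[OF r1(3)] h)
  then have "\<exists>u. j < \<nu> \<longrightarrow> seq_of u = f_deriv lam w \<gamma> j z" for j by (metis imageE)
  then obtain v where v: "\<And>j. j < \<nu> \<Longrightarrow> seq_of (v j) = f_deriv lam w \<gamma> j z" by metis
  have v0: "v 0 \<noteq> 0" "(v 0, 0) \<in> shift J z"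
  proof -
    show "v 0 \<noteq> 0" using v[OF \<nu>(1)] f_sol_nonzero[OF z(2)] by (auto simp: f_deriv_def fun_eq_iff)
    show "(v 0, 0) \<in> shift J z"
      using f_deriv_recurrence[OF z(2), of 0] by (simp add: shift_iff J_max_iff v[OF \<nu>(1)] fun_eq_iff)
  qed
  then have "z \<in> point_spec J" by (auto simp: point_spec_def shift_iff)
  have step: "(v (Suc j), of_nat (Suc j) *\<^sub>C v j) \<in> shift J z" if "Suc j < \<nu>" for j
    using f_deriv_recurrence[OF z(2), of "Suc j"] that
    by (simp add: shift_iff J_max_iff v fun_eq_iff add.commute)
  have ker: "kernel (shift J z ^^ \<nu>) = cell2.span (v ` {..<\<nu>})"
    by (rule kernel_shift_power_eq[OF JJ v0 step])
  have ind: "cell2.independent (v ` {..<\<nu>})" "card (v ` {..<\<nu>}) = \<nu>"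
    using independent_chain[where v=v and k=\<nu>, OF JJ v0 step] by blast+
  define g where "g = (SOME g. riesz_contour J z g)"
  have g: "riesz_contour J z g"
    unfolding g_def by (rule someI_ex[OF riesz_contour_exists[OF e z(1) punctured]])
  \<comment> \<open>Holds for every exponent; together with the range lying in the kernel of the
    power \<open>\<nu>\<close>, it shows that the kernels of the powers stop growing at
    \<open>\<nu>\<close>.\<close>
  have gen: "kernel (shift J z ^^ k) \<subseteq> range (blinfun_apply (riesz_projection J g))" for k
    using riesz_projection_generalized_eigenvector[OF g] by (auto simp: kernel_def) (metis rangeI)
  have ran: "range (blinfun_apply (riesz_projection J g)) = kernel (shift J z ^^ \<nu>)"
    using gen[of \<nu>] riesz_projection_range[OF g e bound] by (auto simp: kernel_def)
  have ge: "generalized_eigenspace J z = kernel (shift J z ^^ \<nu>)"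
    using gen unfolding ran generalized_eigenspace_def by blast
  have "algebraic_mult J z = \<nu>"
    unfolding algebraic_mult_def g_def[symmetric] ran ker
    by (simp add: cell2.dim_eq_card_independent[OF ind(1)] ind(2))
  moreover have "{u. \<exists>j<\<nu>. seq_of u = f_deriv lam w \<gamma> j z} = v ` {..<\<nu>}"
    using v by (auto simp: image_iff seq_of_inject[symmetric])
  ultimately show ?thesis
    using in_ell2 \<nu>(2) \<open>z \<in> point_spec J\<close> \<open>z isolated_in spec J\<close> ge ker by simp
qed

end

theorem theorem20:
  fixes lam w \<gamma> :: "int \<Rightarrow> complex" and J :: operator
  assumes w_nonzero: "\<And>n. w n \<noteq> 0"
    and gamma: "\<And>n. \<gamma> n * \<gamma> (n + 1) = w n"
    and summability: "\<exists>z0\<in>C0 lam.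
      (\<lambda>n. norm ((w n)\<^sup>2 / ((lam n - z0) * (lam (n + 1) - z0)))) summable_on UNIV"
    and F_nonzero: "\<exists>z\<in>C0 lam. char_fun lam \<gamma> z \<noteq> 0"
    and J_eq_min: "J = J_min lam w"
    and J_eq_max: "J = J_max lam w"
  shows "(\<forall>z\<in>point_spec J. geometric_mult J z = 1) \<and>
    (connected (- der lam) \<longrightarrow>
      (\<forall>z\<in>spec J \<inter> C0 lam.
        z isolated_in spec J \<and> z \<in> point_spec J \<and>
        char_fun lam \<gamma> z = 0 \<and>
        int (algebraic_mult J z) = zorder (char_fun lam \<gamma>) z \<and>
        (\<forall>j<algebraic_mult J z. f_deriv lam w \<gamma> j z \<in> range seq_of) \<and>
        generalized_eigenspace J z =
          cell2.span {v. \<exists>j<algebraic_mult J z. seq_of v = f_deriv lam w \<gamma> j z}))"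
proof -
  interpret jacobi_data lam w \<gamma>
    by unfold_locales (fact w_nonzero gamma summability)+
  have JJ: "J_min lam w = J_max lam w" using J_eq_min J_eq_max by simp
  show ?thesis
    unfolding J_eq_max
    using geometric_mult_eq_1[OF w_nonzero JJ] spectral_point[OF JJ connected_C0 F_nonzero]
      char_fun_eq_0_on_spec[OF JJ]
    by blast
qed

end
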